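(* Let $m\ge2$, $n=2m-1$, $I=[0,1]$, and consider the scaled marginal kernel $$\hat{\bar{\mathcal{H}}}:=\frac{1}{\mathrm{Vol}(M^{2m-1})}\frac{2}{(2m-1)!(m-2)!}\,\bar{\mathcal{H}}.$$ Then $\hat{\bar{\mathcal{H}}}(\cdot,s)\in\Pi^{2m-1}_0$ for every $s\in I$. Moreover, let $\{p_j,\ j=1,\dots,2m-2\}$ be a basis of $\Pi^{2m-1}_0$ and consider the resulting expansion of $\hat{\bar{\mathcal{H}}}(\cdot,s)$ in this basis for each $s\in I$: $$\hat{\bar{\mathcal{H}}}(t_*,s)=\sum_{j=1}^{2m-2}\bar h_j(s)\,p_j(t_* ),\qquad(t_*,s)\in I\times I.$$ Then $\{p_j,\ j=1,\dots,2m-2\}$ and $\{\bar h_j,\ j=1,\dots,2m-2\}$ form an $L^2(I)$ biorthogonal system, that is, $$\int_I\bar h_j\,p_k=\delta_{jk},\qquad j,k=1,\dots,2m-2 .$$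
   Context: $\Pi^{n}_0$ is the space of real polynomials $\phi$ of degree at most $n$ with $\phi(0)=\phi(1)=0$. $M^n\subset\mathbb{R}^n$ is the set of vectors $(\mathbb{E}_{t\sim\mu}[t^i])_{i=1}^n$ as $\mu$ ranges over Borel probability measures on $[0,1]$, and $\mathrm{Vol}$ is $n$-dimensional Lebesgue measure. With $\Delta_N(t):=\prod_{1\le j<k\le N}(t_k-t_j)$, for $t_*\in I$, $t\in I^{m-1}$, $$\mathcal{J}^c_{ol}(t_*,t):=t_*\prod_{j=1}^{m-1}(t_j-t_* )^2\prod_{j=1}^{m-1}t_j^2\cdot\Delta_{m-1}^4(t),\quad \mathcal{J}^c_{ou}(t_*,t):=(1-t_* )\prod_{j=1}^{m-1}(t_j-t_* )^2\prod_{j=1}^{m-1}(1-t_j)^2\cdot\Delta_{m-1}^4(t),$$ $$\mathcal{H}(t_*,t):=\mathcal{J}^c_{ou}(0,t)-\mathcal{J}^c_{ol}(t_*,t)-\mathcal{J}^c_{ou}(t_*,t),$$ $$\bar{\mathcal{H}}(t_*,s):=\int_{I^{m-2}}\mathcal{H}\bigl(t_*,(s,t_2,\dots,t_{m-1})\bigr)\,dt_2\cdots dt_{m-1}\quad(\text{no integration if } m=2).$$ *)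

theory Defs
  imports "HOL-Probability.Probability" "HOL-Computational_Algebra.Polynomial"
begin

text \<open>Vectors in R^N are functions \<^typ>\<open>nat \<Rightarrow> real\<close>, with the coordinates indexed by the finite set
  written out in each definition; Lebesgue measure on them is \<^term>\<open>Pi\<^sub>M J (\<lambda>_. lborel)\<close>, whose
  underlying space consists of the functions that are \<^term>\<open>undefined\<close> off \<^term>\<open>J\<close>.\<close>

definition Pi0 :: "nat \<Rightarrow> real poly set" where
  "Pi0 n = {p. degree p \<le> n \<and> poly p 0 = 0 \<and> poly p 1 = 0}"

text \<open>An indexed basis of a linear subspace of the real polynomials (which are not an instance of
  \<^class>\<open>real_vector\<close>, so the scalar multiplication is passed explicitly).\<close>

definition is_poly_basis :: "'i set \<Rightarrow> ('i \<Rightarrow> real poly) \<Rightarrow> real poly set \<Rightarrow> bool" where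
  "is_poly_basis J p V \<longleftrightarrow>
     inj_on p J \<and> \<not> module.dependent smult (p ` J) \<and> module.span smult (p ` J) = V"

definition moment_space :: "nat \<Rightarrow> (nat \<Rightarrow> real) set" where
  "moment_space n =
     {(\<lambda>i\<in>{1..n}. \<integral>t. t ^ i \<partial>\<mu>) | \<mu>.
        prob_space \<mu> \<and> sets \<mu> = sets (restrict_space borel {0..1::real})}"

definition Vol :: "nat \<Rightarrow> (nat \<Rightarrow> real) set \<Rightarrow> real" where
  "Vol n A = measure (Pi\<^sub>M {1..n} (\<lambda>_. lborel)) A"

definition Delta :: "nat \<Rightarrow> (nat \<Rightarrow> real) \<Rightarrow> real" where
  "Delta N t = (\<Prod>k\<in>{1..N}. \<Prod>j\<in>{1..<k}. t k - t j)"

definition J_ol :: "nat \<Rightarrow> real \<Rightarrow> (nat \<Rightarrow> real) \<Rightarrow> real" where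
  "J_ol m ts t = ts * (\<Prod>j\<in>{1..m-1}. (t j - ts)\<^sup>2) * (\<Prod>j\<in>{1..m-1}. (t j)\<^sup>2) * Delta (m-1) t ^ 4"

definition J_ou :: "nat \<Rightarrow> real \<Rightarrow> (nat \<Rightarrow> real) \<Rightarrow> real" where
  "J_ou m ts t =
     (1 - ts) * (\<Prod>j\<in>{1..m-1}. (t j - ts)\<^sup>2) * (\<Prod>j\<in>{1..m-1}. (1 - t j)\<^sup>2) * Delta (m-1) t ^ 4"

definition H_kernel :: "nat \<Rightarrow> real \<Rightarrow> (nat \<Rightarrow> real) \<Rightarrow> real" where
  "H_kernel m ts t = J_ou m 0 t - J_ol m ts t - J_ou m ts t"

text \<open>For \<^term>\<open>m = 2\<close> the index set \<^term>\<open>{2..m-1}\<close> is empty and its product measure is a unit point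
  mass, so no integration takes place.\<close>

definition H_bar :: "nat \<Rightarrow> real \<Rightarrow> real \<Rightarrow> real" where
  "H_bar m ts s =
     set_lebesgue_integral (Pi\<^sub>M {2..m-1} (\<lambda>_. lborel)) (PiE {2..m-1} (\<lambda>_. {0..1}))
       (\<lambda>t. H_kernel m ts (t(1 := s)))"

definition H_bar_hat :: "nat \<Rightarrow> real \<Rightarrow> real \<Rightarrow> real" where
  "H_bar_hat m ts s =
     1 / Vol (2*m-1) (moment_space (2*m-1)) * (2 / (fact (2*m-1) * fact (m-2))) * H_bar m ts s"

definition in_L2_I :: "(real \<Rightarrow> real) \<Rightarrow> bool" where
  "in_L2_I f \<longleftrightarrow>
     set_borel_measurable lborel {0..1} f \<and> set_integrable lborel {0..1} (\<lambda>x. (f x)\<^sup>2)"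

definition L2_biorthogonal :: "'i set \<Rightarrow> ('i \<Rightarrow> real \<Rightarrow> real) \<Rightarrow> ('i \<Rightarrow> real \<Rightarrow> real) \<Rightarrow> bool" where
  "L2_biorthogonal J f g \<longleftrightarrow>
     (\<forall>j\<in>J. in_L2_I (f j) \<and> in_L2_I (g j)) \<and>
     (\<forall>j\<in>J. \<forall>k\<in>J. (LBINT x:{0..1}. f j x * g k x) = (if j = k then 1 else 0))"

end

theory Submission
  imports Defs
begin

text \<open>Both assertions follow from one reproducing property: for every polynomial \<open>\<phi>\<close> of degree at most
\<open>2m-1\<close> that vanishes at \<open>0\<close> and \<open>1\<close>, and every \<open>x\<close> in \<open>(0,1)\<close>, the integral of
\<open>\<phi>(s)\<close> against the scaled kernel at \<open>(x,s)\<close> is \<open>\<phi>(x)\<close> (\<open>H_bar_hat_reproducing\<close>). Indeed, as a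
function of its first argument the kernel lies in the span of the \<open>p\<^sub>j\<close>, so its coefficient functions
\<open>h\<^sub>j\<close> are determined by finitely many of its values. Applying the reproducing property to \<open>p\<^sub>k\<close> gives
\<open>p\<^sub>k = (\<Sum>j. (\<integral> h\<^sub>j p\<^sub>k) p\<^sub>j)\<close>, and the linear independence of the \<open>p\<^sub>j\<close> reads off the
biorthogonality.

The reproducing property comes from the residue theorem for the rational function \<open>f / P\<close>, where \<open>P\<close> has
simple zeros at a finite set \<open>E\<close> and double zeros at the integration variables \<open>t\<^sub>j\<close>. Multiplied by the
confluent Vandermonde product with these nodes, the sum of residues becomes a polynomial identity in which the term of
\<open>t\<^sub>j\<close> is \<open>f' g - f g'\<close> at \<open>t\<^sub>j\<close>, with \<open>g\<close> formed from the remaining nodes, times a factor free of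
\<open>t\<^sub>j\<close> (\<open>cvand_residue_identity\<close>). For \<open>E = {0, 1, x}\<close> and \<open>f = 1\<close> it expresses the kernel
\<open>H\<close> as a combination of the \<open>g'(t\<^sub>j)\<close>; after multiplication by \<open>\<phi>(t\<^sub>1)\<close> and integration only
\<open>- \<integral> \<phi> g'\<close> remains, because \<open>g\<close> vanishes at both ends. For the same \<open>E\<close> and \<open>f = \<phi>\<close> the terms
\<open>\<integral> (\<phi>' g - \<phi> g') = - 2 \<integral> \<phi> g'\<close> add up to \<open>\<phi>(x)\<close> times a Selberg integral with
Vandermonde exponent four. Comparing the two gives the reproducing property up to a constant (\<open>H_bar_reproducing\<close>).

It remains to see that this constant is one, that is, to compute a Selberg integral and the volume of the moment space.
The Selberg integral is evaluated by the same identity with \<open>E\<close> contained in \<open>{0, 1}\<close> and \<open>f\<close> equal to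
one or to a shifted Legendre polynomial: then \<open>\<integral> (f' g - f g')\<close> involves only the end points, and the
integral over \<open>N\<close> variables is a multiple of one with one weight factor or one variable fewer
(\<open>selberg_evaluation\<close>).

The volume is computed one moment at a time. A vector lies in the moment space exactly if the functional that it induces
is nonnegative on the polynomials that are nonnegative on the unit interval. Over a nondegenerate vector of \<open>n - 1\<close>
moments, the possible values of the next moment form an interval \<open>[l, u]\<close>, whose end points come from Gauss type
quadrature at the zeros of an orthogonal polynomial, with \<open>0\<close> or \<open>1\<close> as further nodes. If the \<open>n\<close>-th moment
is \<open>x\<close>, then the interval for the moment after it has length \<open>(x - l) (u - x) / (u - l)\<close>; this is an identity
between orthogonal polynomials for the weights \<open>1\<close>, \<open>t\<close>, \<open>1 - t\<close> and \<open>t (1 - t)\<close>. Hence the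
integral of the \<open>k\<close>-th power of the interval length over the moment space is a Beta integral times the integral of the
\<open>(k+1)\<close>-st power one dimension lower, and the volume is a product of Beta values (\<open>Vol_moment_space\<close>).\<close>

section \<open>Partial fractions with simple and double nodes\<close>

definition node_poly :: "real set \<Rightarrow> real set \<Rightarrow> real poly" where
  "node_poly E T = (\<Prod>e\<in>E. [:-e, 1:]) * (\<Prod>x\<in>T. [:-x, 1:]\<^sup>2)"

lemmas pderiv_sum_distrib = higher_pderiv_sum[of 1, simplified]

lemma node_poly_nonzero: "finite E \<Longrightarrow> finite T \<Longrightarrow> node_poly E T \<noteq> 0"
  by (simp add: node_poly_def)

lemma poly_node_poly: "poly (node_poly E T) z = (\<Prod>e\<in>E. z - e) * (\<Prod>x\<in>T. (z - x)\<^sup>2)"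
  by (simp add: node_poly_def poly_prod)

lemma degree_node_poly:
  assumes "finite E" "finite T" shows "degree (node_poly E T) = card E + 2 * card T"
proof -
  have "degree (\<Prod>e\<in>E. [:-e, 1:]) = card E"
    by (subst degree_prod_eq_sum_degree) (auto simp: assms)
  moreover have "degree (\<Prod>x\<in>T. [:-x, 1:]\<^sup>2) = 2 * card T"
    by (subst degree_prod_eq_sum_degree) (auto simp: assms degree_power_eq)
  ultimately show ?thesis
    unfolding node_poly_def by (subst degree_mult_eq) (auto simp: assms)
qed

lemma lead_coeff_node_poly:
  assumes "finite E" "finite T" shows "lead_coeff (node_poly E T) = 1"
  by (simp add: node_poly_def lead_coeff_mult lead_coeff_prod lead_coeff_power assms)

lemma prod_linear_powers_dvd:
  fixes h :: "real poly"
  assumes "finite Z" "\<And>z. z \<in> Z \<Longrightarrow> [:-z, 1:] ^ r z dvd h"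
  shows "(\<Prod>z\<in>Z. [:-z, 1:] ^ r z) dvd h"
  using assms
proof (induction Z rule: finite_induct)
  case (insert z Z)
  then obtain q where q: "h = (\<Prod>z\<in>Z. [:-z, 1:] ^ r z) * q" by (auto elim: dvdE)
  show ?case
  proof (cases "h = 0")
    case False
    have P: "poly (\<Prod>z\<in>Z. [:-z, 1:] ^ r z) z \<noteq> 0"
      using insert by (auto simp: poly_prod)
    have "[:-z, 1:] ^ r z dvd h" using insert by auto
    then have "r z \<le> order z h" using False order_divides by blast
    also have "order z h = order z q"
      using False P unfolding q by (subst order_mult) (auto simp: order_0I)
    finally have "[:-z, 1:] ^ r z dvd q" using order_divides by blast
    then show ?thesis using insert by (auto simp: q mult.commute intro: mult_dvd_mono)
  qed auto
qed auto

text \<open>The prescribed zeros, counted with multiplicity, divide the polynomial, and there are more of them than its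
degree allows.\<close>

lemma hermite_unique:
  fixes h :: "real poly"
  assumes fin: "finite E" "finite T" and disj: "E \<inter> T = {}"
    and deg: "degree h < card E + 2 * card T"
    and E: "\<And>e. e \<in> E \<Longrightarrow> poly h e = 0"
    and T: "\<And>x. x \<in> T \<Longrightarrow> poly h x = 0 \<and> poly (pderiv h) x = 0"
  shows "h = 0"
proof (rule ccontr)
  assume "h \<noteq> 0"
  define r :: "real \<Rightarrow> nat" where "r z = (if z \<in> T then 2 else 1)" for z
  have "[:-z, 1:] ^ r z dvd h" if z: "z \<in> E \<union> T" for z
  proof (cases "z \<in> T")
    case True
    then obtain q where q: "h = [:-z, 1:] * q"
      using T by (metis poly_eq_0_iff_dvd dvdE)
    have "poly (pderiv h) z = poly q z"
      unfolding q by (simp add: pderiv_mult pderiv_pCons del: mult_pCons_left)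
    then have "[:-z, 1:] dvd q" using T True poly_eq_0_iff_dvd by metis
    then show ?thesis using True
      unfolding r_def q power2_eq_square by (simp only: if_True power2_eq_square) (intro mult_dvd_mono dvd_refl)
  next
    case False
    then show ?thesis using z E by (auto simp: r_def poly_eq_0_iff_dvd[symmetric])
  qed
  then have "(\<Prod>z\<in>E\<union>T. [:-z, 1:] ^ r z) dvd h"
    using fin by (intro prod_linear_powers_dvd) auto
  also have "(\<Prod>z\<in>E\<union>T. [:-z, 1:] ^ r z) = node_poly E T"
    unfolding node_poly_def using fin disj
    by (subst prod.union_disjoint) (auto simp: r_def intro!: arg_cong2[where f="(*)"] prod.cong)
  finally have "degree (node_poly E T) \<le> degree h"
    using \<open>h \<noteq> 0\<close> by (rule dvd_imp_degree_le)
  with deg fin show False by (simp add: degree_node_poly)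
qed

text \<open>Both sides have degree below the number of nodes counted with multiplicity, the same values at all nodes
and the same derivatives at the double nodes. For \<open>T = {}\<close> this is Lagrange interpolation.\<close>

lemma partial_fractions:
  assumes fin: "finite E" "finite T" and disj: "E \<inter> T = {}"
    and deg: "degree f < card E + 2 * card T"
  defines "G \<equiv> \<lambda>x. node_poly E (T - {x})"
  shows "f = (\<Sum>e\<in>E. smult (poly f e / poly (node_poly (E - {e}) T) e) (node_poly (E - {e}) T)) +
     (\<Sum>x\<in>T. smult (poly f x / poly (G x) x) (G x) +
        smult ((poly (pderiv f) x * poly (G x) x - poly f x * poly (pderiv (G x)) x) / (poly (G x) x)\<^sup>2)
          ([:-x, 1:] * G x))"
    (is "f = ?S + ?D")
proof -
  have G0: "poly (G x) x \<noteq> 0" if "x \<in> T" for x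
    using that fin disj by (auto simp: G_def poly_node_poly)
  have N0: "poly (node_poly (E - {e}) T) e \<noteq> 0" if "e \<in> E" for e
    using that fin disj by (auto simp: poly_node_poly)
  have NE: "poly (node_poly (E - {e}) T) z = 0" if "e \<in> E" "z \<in> E" "z \<noteq> e" for e z
    using that fin by (auto simp: poly_node_poly)
  have NT: "[:-x, 1:]\<^sup>2 dvd node_poly E' T" if "x \<in> T" for E' x
    unfolding node_poly_def using that fin
    by (metis (no_types, lifting) dvd_mult dvd_prodI)
  have GT: "[:-x, 1:]\<^sup>2 dvd G y" if "x \<in> T" "y \<in> T" "x \<noteq> y" for x y
    unfolding node_poly_def G_def using that fin
    by (intro dvd_mult dvd_prodI) auto
  have double: "poly g x = 0 \<and> poly (pderiv g) x = 0" if "[:-x, 1:]\<^sup>2 dvd g" for x :: real and g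
  proof -
    from that obtain k where "g = [:-x, 1:] * ([:-x, 1:] * k)"
      by (metis dvdE mult.assoc power2_eq_square)
    then show ?thesis by (simp add: pderiv_mult pderiv_pCons del: mult_pCons_left)
  qed
  have GE: "poly (G x) e = 0" if "e \<in> E" for x e
    using that fin by (auto simp: G_def poly_node_poly)
  let ?h = "f - (?S + ?D)"
  have "?h = 0"
  proof (rule hermite_unique[OF fin disj])
    have "degree ?S \<le> card E + 2 * card T - 1"
      using fin by (intro degree_sum_le order.trans[OF degree_smult_le])
        (auto simp: degree_node_poly Suc_diff_le dest: card_gt_0_iff[THEN iffD2, OF conjI, rotated])
    moreover have "degree ?D \<le> card E + 2 * card T - 1"
    proof (intro degree_sum_le degree_add_le fin(2))
      fix x assume x: "x \<in> T"
      then have c: "card T > 0" using fin by (auto simp: card_gt_0_iff)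
      have G: "degree (G x) = card E + 2 * card T - 2"
        using x fin c by (simp add: G_def degree_node_poly)
      then show "degree (smult (poly f x / poly (G x) x) (G x)) \<le> card E + 2 * card T - 1"
        by (intro order.trans[OF degree_smult_le]) simp
      have "degree ([:-x, 1:] * G x) \<le> 1 + degree (G x)"
        by (intro order.trans[OF degree_mult_le]) simp
      then show "degree (smult ((poly (pderiv f) x * poly (G x) x - poly f x * poly (pderiv (G x)) x) /
          (poly (G x) x)\<^sup>2) ([:-x, 1:] * G x)) \<le> card E + 2 * card T - 1"
        using c by (intro order.trans[OF degree_smult_le]) (simp add: G)
    qed
    ultimately have "degree (?S + ?D) \<le> card E + 2 * card T - 1" by (rule degree_add_le)
    then show "degree ?h < card E + 2 * card T"
      using deg by (intro degree_diff_less) auto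
  next
    fix e assume e: "e \<in> E"
    have "poly ?S e = (\<Sum>e'\<in>E. if e' = e then poly f e else 0)"
      unfolding poly_sum using e N0 NE by (intro sum.cong) auto
    moreover have "poly ?D e = 0"
      using GE[OF e] by (simp add: poly_sum)
    ultimately show "poly ?h e = 0" using e fin by simp
  next
    fix x assume x: "x \<in> T"
    have "poly ?S x = 0" "poly (pderiv ?S) x = 0"
      using double[OF NT[OF x]] by (auto simp: poly_sum pderiv_sum_distrib pderiv_smult)
    moreover have "poly ?D x = (\<Sum>y\<in>T. if y = x then poly f x else 0)"
      unfolding poly_sum using x G0 double[OF GT[OF x]] by (intro sum.cong) auto
    moreover have "poly (pderiv ?D) x = (\<Sum>y\<in>T. if y = x then poly (pderiv f) x else 0)"
      unfolding poly_sum pderiv_sum_distrib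
    proof (rule sum.cong[OF refl])
      fix y assume y: "y \<in> T"
      show "poly (pderiv (smult (poly f y / poly (G y) y) (G y) +
         smult ((poly (pderiv f) y * poly (G y) y - poly f y * poly (pderiv (G y)) y) / (poly (G y) y)\<^sup>2)
         ([:- y, 1:] * G y))) x = (if y = x then poly (pderiv f) x else 0)"
      proof (cases "y = x")
        case True
        have "poly (pderiv ([:- x, 1:] * G x)) x = poly (G x) x"
          by (simp add: pderiv_mult pderiv_pCons del: mult_pCons_left)
        then show ?thesis using G0[OF x] True
          by (simp add: pderiv_add pderiv_smult power2_eq_square field_simps del: mult_pCons_left)
      next
        case False
        then show ?thesis using double[OF GT[OF x y]]
          by (simp add: pderiv_add pderiv_smult pderiv_mult pderiv_pCons del: mult_pCons_left)
      qed
    qed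
    ultimately show "poly ?h x = 0 \<and> poly (pderiv ?h) x = 0"
      using x fin by (simp add: pderiv_diff pderiv_add)
  qed
  then show ?thesis by simp
qed

text \<open>Comparison of the leading coefficients in the partial fraction expansion. The summands on the right are the
residues of \<open>f / P\<close> at its finite poles, where \<open>P\<close> is the node polynomial; the left side is minus its residue at
infinity.\<close>

lemma residue_sum:
  assumes fin: "finite E" "finite T" and disj: "E \<inter> T = {}"
    and deg: "degree f < card E + 2 * card T"
  defines "G \<equiv> \<lambda>x. node_poly E (T - {x})"
  shows "coeff f (card E + 2 * card T - 1) =
     (\<Sum>e\<in>E. poly f e / poly (node_poly (E - {e}) T) e) +
     (\<Sum>x\<in>T. (poly (pderiv f) x * poly (G x) x - poly f x * poly (pderiv (G x)) x) / (poly (G x) x)\<^sup>2)"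
proof -
  let ?d = "card E + 2 * card T - 1"
  have 1: "coeff (node_poly (E - {e}) T) ?d = 1" if "e \<in> E" for e
  proof -
    have "card E > 0" using that fin by (auto simp: card_gt_0_iff)
    then show ?thesis
      using lead_coeff_node_poly[of "E - {e}" T] fin that by (simp add: degree_node_poly)
  qed
  have 2: "coeff (G x) ?d = 0" "coeff ([:-x, 1:] * G x) ?d = 1" if "x \<in> T" for x
  proof -
    have c: "card T > 0" using that fin by (auto simp: card_gt_0_iff)
    have g: "degree (G x) = ?d - 1" using c fin that by (simp add: G_def degree_node_poly)
    show z: "coeff (G x) ?d = 0" using g c by (intro coeff_eq_0) auto
    have "coeff ([:-x, 1:] * G x) ?d = coeff (G x) (?d - 1)"
      using z c by (cases ?d) (auto simp: coeff_pCons)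
    also have "\<dots> = 1" using lead_coeff_node_poly[of E "T - {x}"] fin g by (simp add: G_def)
    finally show "coeff ([:-x, 1:] * G x) ?d = 1" .
  qed
  note pf = arg_cong[OF partial_fractions[OF fin disj deg], of "\<lambda>p. coeff p ?d"]
  show ?thesis
    using 1 2 unfolding G_def
    by (subst pf) (simp add: coeff_sum del: mult_pCons_left)
qed

section \<open>Integration over the unit cube\<close>

text \<open>Restricting the space, rather than weighting by an indicator function, makes bounds on the unit interval hold at
every point of the measure space.\<close>

definition I01 :: "real measure" where "I01 = restrict_space lborel {0..1}"

abbreviation cube :: "nat set \<Rightarrow> (nat \<Rightarrow> real) measure" where "cube J \<equiv> PiM J (\<lambda>_. I01)"

lemma space_I01 [simp]: "space I01 = {0..1}" by (simp add: I01_def space_restrict_space)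

lemma prob_space_I01: "prob_space I01"
  by standard (simp add: I01_def emeasure_restrict_space space_restrict_space)

lemma space_cube: "space (cube J) = PiE J (\<lambda>_. {0..1})"
  by (simp add: space_PiM)

interpretation I01: prob_space I01 by (rule prob_space_I01)

interpretation cube: product_sigma_finite "\<lambda>_::nat. I01"
  by standard

lemma prob_space_cube: "prob_space (cube J)"
  by (intro prob_space_PiM prob_space_I01)

lemma borel_measurable_I01: "f \<in> borel_measurable borel \<Longrightarrow> f \<in> borel_measurable I01"
  by (simp add: I01_def measurable_restrict_space1)

lemma borel_measurable_coordinate: "j \<in> J \<Longrightarrow> (\<lambda>t. t j) \<in> borel_measurable (cube J)"
  using measurable_compose[OF measurable_component_singleton[of j J "\<lambda>_. I01"] borel_measurable_I01[of "\<lambda>x. x"]]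
  by auto

lemma integral_I01: "integral\<^sup>L I01 f = (LBINT x:{0..1}. f x)" for f :: "real \<Rightarrow> real"
  by (simp add: I01_def integral_restrict_space set_lebesgue_integral_def)

lemma integral_pderiv_I01: "(\<integral>x. poly (pderiv g) x \<partial>I01) = poly g 1 - poly g 0" for g :: "real poly"
  using integral_FTC_Icc_real[of 0 1 "poly g" "poly (pderiv g)"]
  by (simp add: integral_I01 set_lebesgue_integral_def mult.commute)

text \<open>Passes between set integrals with respect to Lebesgue measure and the product of probability measures, where
bounded functions are integrable and variables can be permuted.\<close>

lemma integral_cube:
  fixes F :: "(nat \<Rightarrow> real) \<Rightarrow> real"
  assumes J: "finite J" and F [measurable]: "F \<in> borel_measurable (PiM J (\<lambda>_. lborel))"
  shows "integral\<^sup>L (cube J) F = set_lebesgue_integral (PiM J (\<lambda>_. lborel)) (PiE J (\<lambda>_. {0..1})) F"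
proof -
  let ?L = "PiM J (\<lambda>_. lborel :: real measure)" and ?B = "PiE J (\<lambda>_. {0..1::real})"
  let ?M = "density lborel (indicator {0..1}) :: real measure"
  interpret l: product_sigma_finite "\<lambda>_::nat. lborel :: real measure" by standard
  have M: "emeasure ?M A = emeasure lborel (A \<inter> {0..1})" if "A \<in> sets borel" for A
    using that by (simp add: emeasure_restricted Int_commute)
  have "prob_space ?M" by standard (simp add: M)
  then interpret m: prob_space ?M .
  interpret m: product_sigma_finite "\<lambda>_::nat. ?M" by standard
  have B [measurable]: "?B \<in> sets ?L" using J by (intro sets_PiM_I_finite) auto
  have S: "sets (PiM J (\<lambda>_. ?M)) = sets ?L" by (intro sets_PiM_cong) auto
  have id: "(\<lambda>t. t) \<in> measurable (cube J) ?L"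
    by (rule measurable_PiM_single')
       (auto simp: space_cube intro: borel_measurable_coordinate)
  have "density ?L (indicator ?B) = PiM J (\<lambda>_. ?M)"
  proof (rule m.PiM_eqI[OF J])
    fix A :: "nat \<Rightarrow> real set" assume "\<And>i. i \<in> J \<Longrightarrow> A i \<in> sets ?M"
    then have A: "\<And>i. i \<in> J \<Longrightarrow> A i \<in> sets borel" by simp
    then have [measurable]: "PiE J A \<in> sets ?L" using J by (intro sets_PiM_I_finite) auto
    have "emeasure (density ?L (indicator ?B)) (PiE J A) = emeasure ?L (?B \<inter> PiE J A)"
      by (simp add: emeasure_restricted)
    also have "?B \<inter> PiE J A = PiE J (\<lambda>i. A i \<inter> {0..1})" by (auto simp: PiE_iff)
    also have "emeasure ?L \<dots> = (\<Prod>i\<in>J. emeasure lborel (A i \<inter> {0..1}))"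
      using A by (intro l.emeasure_PiM J) auto
    finally show "emeasure (density ?L (indicator ?B)) (PiE J A) = (\<Prod>i\<in>J. emeasure ?M (A i))"
      using A by (simp add: M)
  qed (simp add: S)
  moreover have "distr (cube J) ?L (\<lambda>t. t) = PiM J (\<lambda>_. ?M)"
  proof (rule m.PiM_eqI[OF J])
    fix A :: "nat \<Rightarrow> real set" assume "\<And>i. i \<in> J \<Longrightarrow> A i \<in> sets ?M"
    then have A: "\<And>i. i \<in> J \<Longrightarrow> A i \<in> sets borel" by simp
    then have [measurable]: "PiE J A \<in> sets ?L" using J by (intro sets_PiM_I_finite) auto
    have "emeasure (distr (cube J) ?L (\<lambda>t. t)) (PiE J A) = emeasure (cube J) (PiE J (\<lambda>i. A i \<inter> {0..1}))"
      by (subst emeasure_distr[OF id]) (auto simp: space_cube PiE_iff intro!: arg_cong[where f="emeasure _"])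
    also have "\<dots> = (\<Prod>i\<in>J. emeasure I01 (A i \<inter> {0..1}))"
      using A by (intro cube.emeasure_PiM J) (auto simp: I01_def sets_restrict_space_iff)
    finally show "emeasure (distr (cube J) ?L (\<lambda>t. t)) (PiE J A) = (\<Prod>i\<in>J. emeasure ?M (A i))"
      using A by (simp add: M I01_def emeasure_restrict_space)
  qed (simp add: S)
  ultimately have "distr (cube J) ?L (\<lambda>t. t) = density ?L (indicator ?B)" by simp
  then have "integral\<^sup>L (distr (cube J) ?L (\<lambda>t. t)) F = integral\<^sup>L (density ?L (indicator ?B)) F" by simp
  moreover have "integral\<^sup>L (distr (cube J) ?L (\<lambda>t. t)) F = integral\<^sup>L (cube J) F"
    by (intro integral_distr id F)
  moreover have "integral\<^sup>L (density ?L (indicator ?B)) F = (LINT t|?L. indicator ?B t *\<^sub>R F t)"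
    using integral_density[of F ?L "indicator ?B"] F by (simp add: ennreal_indicator)
  ultimately show ?thesis by (simp add: set_lebesgue_integral_def)
qed

text \<open>All integrands below are polynomial expressions in the coordinates. Boundedness and measurability are
inherited along the formation of such expressions and imply integrability.\<close>

definition bounded_meas :: "nat set \<Rightarrow> ((nat \<Rightarrow> real) \<Rightarrow> real) \<Rightarrow> bool" where
  "bounded_meas J F \<longleftrightarrow> F \<in> borel_measurable (cube J) \<and> (\<exists>B. \<forall>t\<in>space (cube J). \<bar>F t\<bar> \<le> B)"

lemma bounded_measI: "F \<in> borel_measurable (cube J) \<Longrightarrow> (\<And>t. t \<in> space (cube J) \<Longrightarrow> \<bar>F t\<bar> \<le> B) \<Longrightarrow> bounded_meas J F"
  by (auto simp: bounded_meas_def)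

named_theorems bounded_meas_intros

lemma bounded_meas_const [bounded_meas_intros]: "bounded_meas J (\<lambda>_. c)" by (rule bounded_measI[of _ _ "\<bar>c\<bar>"]) auto

lemma bounded_meas_coord [bounded_meas_intros]: "j \<in> J \<Longrightarrow> bounded_meas J (\<lambda>t. t j)"
  by (rule bounded_measI[of _ _ 1]) (auto intro: borel_measurable_coordinate simp: space_cube PiE_iff)

lemma bounded_meas_add [bounded_meas_intros]: assumes "bounded_meas J F" "bounded_meas J G" shows "bounded_meas J (\<lambda>t. F t + G t)"
proof -
  obtain B C where "\<forall>t\<in>space (cube J). \<bar>F t\<bar> \<le> B" "\<forall>t\<in>space (cube J). \<bar>G t\<bar> \<le> C"
    using assms by (auto simp: bounded_meas_def)
  then show ?thesis using assms
    by (intro bounded_measI[of _ _ "B + C"]) (auto simp: bounded_meas_def intro: order.trans[OF abs_triangle_ineq add_mono])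
qed

lemma bounded_meas_mult [bounded_meas_intros]: assumes "bounded_meas J F" "bounded_meas J G" shows "bounded_meas J (\<lambda>t. F t * G t)"
proof -
  obtain B C where B: "\<forall>t\<in>space (cube J). \<bar>F t\<bar> \<le> B" "\<forall>t\<in>space (cube J). \<bar>G t\<bar> \<le> C"
    using assms by (auto simp: bounded_meas_def)
  have "\<bar>F t * G t\<bar> \<le> \<bar>B\<bar> * \<bar>C\<bar>" if "t \<in> space (cube J)" for t
    unfolding abs_mult using B that by (intro mult_mono) force+
  then show ?thesis using assms by (intro bounded_measI) (auto simp: bounded_meas_def)
qed

lemma bounded_meas_diff [bounded_meas_intros]: "bounded_meas J F \<Longrightarrow> bounded_meas J G \<Longrightarrow> bounded_meas J (\<lambda>t. F t - G t)"
  using bounded_meas_add[of J F "\<lambda>t. - 1 * G t"] bounded_meas_mult[OF bounded_meas_const[of J "-1"], of G] by simp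

lemma bounded_meas_power [bounded_meas_intros]: "bounded_meas J F \<Longrightarrow> bounded_meas J (\<lambda>t. F t ^ n)"
  by (induction n) (auto intro: bounded_meas_intros)

lemma bounded_meas_sum [bounded_meas_intros]: "(\<And>i. i \<in> A \<Longrightarrow> bounded_meas J (F i)) \<Longrightarrow> bounded_meas J (\<lambda>t. \<Sum>i\<in>A. F i t)"
  by (induction A rule: infinite_finite_induct) (auto intro: bounded_meas_intros)

lemma bounded_meas_prod [bounded_meas_intros]: "(\<And>i. i \<in> A \<Longrightarrow> bounded_meas J (F i)) \<Longrightarrow> bounded_meas J (\<lambda>t. \<Prod>i\<in>A. F i t)"
  by (induction A rule: infinite_finite_induct) (auto intro: bounded_meas_intros)

lemma bounded_meas_integrable: "bounded_meas J F \<Longrightarrow> integrable (cube J) F"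
proof -
  interpret prob_space "cube J" by (rule prob_space_cube)
  show "bounded_meas J F \<Longrightarrow> integrable (cube J) F"
    unfolding bounded_meas_def by (auto intro!: integrable_const_bound[OF AE_I2])
qed

lemma integral_cube_insert:
  assumes "finite J" "j \<in> J" "bounded_meas J F"
  shows "integral\<^sup>L (cube J) F = (\<integral>t. (\<integral>s. F (t(j := s)) \<partial>I01) \<partial>cube (J - {j}))"
  using cube.product_integral_insert[of "J - {j}" j F] bounded_meas_integrable[OF assms(3)] assms
  by (simp add: insert_absorb)

text \<open>The node polynomial depends on some of the variables and its derivative is evaluated at another
one. Controlling all its coefficients as functions of the variables makes this evaluation a bounded measurable function.\<close>

definition bounded_meas_poly :: "nat set \<Rightarrow> ((nat \<Rightarrow> real) \<Rightarrow> real poly) \<Rightarrow> bool" where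
  "bounded_meas_poly J Q \<longleftrightarrow> (\<exists>d. \<forall>t. degree (Q t) \<le> d) \<and> (\<forall>i. bounded_meas J (\<lambda>t. coeff (Q t) i))"

lemma bounded_meas_poly_const [bounded_meas_intros]: "bounded_meas_poly J (\<lambda>_. p)" by (auto simp: bounded_meas_poly_def intro: bounded_meas_intros)

lemma bounded_meas_poly_linear [bounded_meas_intros]: "j \<in> J \<Longrightarrow> bounded_meas_poly J (\<lambda>t. [:- t j, 1:])"
proof -
  assume j: "j \<in> J"
  have "bounded_meas J (\<lambda>t. - t j)" using bounded_meas_diff[OF bounded_meas_const[of J 0] bounded_meas_coord[OF j]] by simp
  then have "bounded_meas J (\<lambda>t. coeff [:- t j, 1:] i)" for i
    by (cases "i \<le> 1") (auto simp: le_Suc_eq coeff_eq_0 bounded_meas_const)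
  then show ?thesis by (auto simp: bounded_meas_poly_def intro!: exI[of _ 1])
qed

lemma bounded_meas_poly_mult [bounded_meas_intros]: assumes "bounded_meas_poly J P" "bounded_meas_poly J Q" shows "bounded_meas_poly J (\<lambda>t. P t * Q t)"
proof -
  obtain d e where "\<forall>t. degree (P t) \<le> d" "\<forall>t. degree (Q t) \<le> e" using assms by (auto simp: bounded_meas_poly_def)
  then have "degree (P t * Q t) \<le> d + e" for t
    by (meson add_mono degree_mult_le order.trans)
  then show ?thesis using assms unfolding bounded_meas_poly_def coeff_mult by (auto intro!: bounded_meas_intros)
qed

lemma bounded_meas_poly_power [bounded_meas_intros]: "bounded_meas_poly J P \<Longrightarrow> bounded_meas_poly J (\<lambda>t. P t ^ n)"
  by (induction n) (auto intro: bounded_meas_intros)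

lemma bounded_meas_poly_prod [bounded_meas_intros]: "(\<And>i. i \<in> A \<Longrightarrow> bounded_meas_poly J (P i)) \<Longrightarrow> bounded_meas_poly J (\<lambda>t. \<Prod>i\<in>A. P i t)"
  by (induction A rule: infinite_finite_induct) (auto intro: bounded_meas_intros)

lemma bounded_meas_poly_pderiv [bounded_meas_intros]: assumes "bounded_meas_poly J P" shows "bounded_meas_poly J (\<lambda>t. pderiv (P t))"
proof -
  obtain d where "\<And>t. degree (P t) \<le> d" using assms by (auto simp: bounded_meas_poly_def)
  then have "\<forall>t. degree (pderiv (P t)) \<le> d" by (metis degree_pderiv diff_le_self order.trans)
  then show ?thesis using assms unfolding bounded_meas_poly_def coeff_pderiv
    by (intro conjI exI[of _ d] allI bounded_meas_mult bounded_meas_const) auto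
qed

lemma bounded_meas_eval [bounded_meas_intros]: assumes "bounded_meas_poly J P" "bounded_meas J z" shows "bounded_meas J (\<lambda>t. poly (P t) (z t))"
proof -
  obtain d where d: "\<And>t. degree (P t) \<le> d" using assms by (auto simp: bounded_meas_poly_def)
  have "poly (P t) (z t) = (\<Sum>i\<le>d. coeff (P t) i * z t ^ i)" for t
    unfolding poly_altdef using d[of t]
    by (intro sum.mono_neutral_left) (auto simp: coeff_eq_0)
  then show ?thesis using assms by (auto simp: bounded_meas_poly_def intro!: bounded_meas_intros)
qed

text \<open>By Fubini: for fixed remaining coordinates the coincidence is a single point of the line of \<open>t i\<close>.\<close>

lemma AE_cube_neq:
  assumes "finite J" "i \<in> J" "j \<in> J" "i \<noteq> j"
  shows "AE t in cube J. t i \<noteq> t j"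
proof -
  note [measurable] = borel_measurable_coordinate[OF assms(2)] borel_measurable_coordinate[OF assms(3)]
  let ?N = "{t\<in>space (cube J). t i = t j}"
  have N: "?N \<in> sets (cube J)" by measurable
  have "emeasure (cube J) ?N = (\<integral>\<^sup>+t. indicator ?N t \<partial>cube (insert i (J - {i})))"
    using N assms by (simp add: insert_absorb)
  also have "\<dots> = (\<integral>\<^sup>+t. (\<integral>\<^sup>+s. indicator ?N (t(i := s)) \<partial>I01) \<partial>cube (J - {i}))"
    using N assms by (intro cube.product_nn_integral_insert) (auto simp: insert_absorb)
  also have "\<dots> = (\<integral>\<^sup>+t. 0 \<partial>cube (J - {i}))"
  proof (intro nn_integral_cong)
    fix t :: "nat \<Rightarrow> real"
    assume "t \<in> space (cube (J - {i}))"
    then have "t j \<in> {0..1}" using assms by (auto simp: space_cube PiE_iff)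
    then have "emeasure I01 {t j} = 0" by (auto simp: I01_def emeasure_restrict_space)
    moreover have "{t j} \<in> sets I01" using \<open>t j \<in> {0..1}\<close> by (auto simp: I01_def sets_restrict_space_iff)
    moreover have "(\<integral>\<^sup>+s. indicator ?N (t(i := s)) \<partial>I01) \<le> (\<integral>\<^sup>+s. indicator {t j} s \<partial>I01)"
      using assms(4) by (intro nn_integral_mono) (auto split: split_indicator)
    ultimately show "(\<integral>\<^sup>+s. indicator ?N (t(i := s)) \<partial>I01) = 0" by simp
  qed
  finally have "emeasure (cube J) ?N = 0" by simp
  then show ?thesis using N by (intro AE_I[of _ _ ?N]) auto
qed

lemma AE_cube_neq_const:
  assumes "finite J" "i \<in> J"
  shows "AE t in cube J. t i \<noteq> c"
proof (rule AE_PiM_component[OF prob_space_I01])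
  show "AE x in I01. x \<noteq> c"
    unfolding I01_def using AE_lborel_singleton[of c]
    by (subst AE_restrict_space_iff) (auto elim: eventually_mono)
qed fact+

lemma AE_cube_generic:
  assumes "finite J" "finite E"
  shows "AE t in cube J. inj_on t J \<and> t ` J \<inter> E = {}"
proof -
  have "AE t in cube J. \<forall>i\<in>J. \<forall>j\<in>J - {i}. t i \<noteq> t j"
    using assms by (intro AE_finite_allI AE_cube_neq) auto
  moreover have "AE t in cube J. \<forall>i\<in>J. \<forall>e\<in>E. t i \<noteq> e"
    using assms by (intro AE_finite_allI AE_cube_neq_const) auto
  ultimately show ?thesis by eventually_elim (auto simp: inj_on_def)
qed

section \<open>A residue identity for confluent Vandermonde products\<close>

text \<open>The confluent Vandermonde determinant with simple nodes \<open>E\<close> and double nodes \<open>t j\<close>, up to sign and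
up to the factor formed by the differences within \<open>E\<close>. Each unordered pair occurs twice in the product of squares,
which gives the fourth power of the difference without reference to an ordering of the variables.\<close>

definition cvand :: "real set \<Rightarrow> nat set \<Rightarrow> (nat \<Rightarrow> real) \<Rightarrow> real" where
  "cvand E J t = (\<Prod>j\<in>J. (\<Prod>e\<in>E. t j - e)\<^sup>2) * (\<Prod>i\<in>J. \<Prod>j\<in>J - {i}. (t i - t j)\<^sup>2)"

text \<open>For distinct \<open>t j\<close> this is \<open>node_poly E (t ` J)\<close>. The product over the index set keeps the
multiplicities when the values coincide.\<close>

definition var_node_poly :: "real set \<Rightarrow> nat set \<Rightarrow> (nat \<Rightarrow> real) \<Rightarrow> real poly" where
  "var_node_poly E J t = (\<Prod>e\<in>E. [:-e, 1:]) * (\<Prod>j\<in>J. [:- t j, 1:]\<^sup>2)"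

lemma bounded_meas_cvand [bounded_meas_intros]: "J \<subseteq> K \<Longrightarrow> bounded_meas K (cvand E J)"
  unfolding cvand_def[abs_def] by (intro bounded_meas_intros) auto

lemma bounded_meas_poly_var_node_poly [bounded_meas_intros]: "J \<subseteq> K \<Longrightarrow> bounded_meas_poly K (var_node_poly E J)"
  unfolding var_node_poly_def[abs_def] by (intro bounded_meas_intros) auto

lemma var_node_poly_eq_node_poly: "inj_on t J \<Longrightarrow> var_node_poly E J t = node_poly E (t ` J)"
  by (simp add: var_node_poly_def node_poly_def prod.reindex)

lemma poly_var_node_poly: "poly (var_node_poly E J t) z = (\<Prod>e\<in>E. z - e) * (\<Prod>j\<in>J. (z - t j)\<^sup>2)"
  by (simp add: var_node_poly_def poly_prod)

lemma cvand_cong: "(\<And>j. j \<in> J \<Longrightarrow> t j = t' j) \<Longrightarrow> cvand E J t = cvand E J t'"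
  unfolding cvand_def by (intro arg_cong2[where f="(*)"] prod.cong refl) auto

lemma var_node_poly_cong: "(\<And>j. j \<in> J \<Longrightarrow> t j = t' j) \<Longrightarrow> var_node_poly E J t = var_node_poly E J t'"
  unfolding var_node_poly_def by (intro arg_cong2[where f="(*)"] prod.cong refl) auto

text \<open>This is the factor that turns the denominators of the residues at the double nodes into the
Vandermonde product of the remaining variables.\<close>

lemma cvand_remove_variable:
  assumes "finite J" "j \<in> J"
  shows "cvand E J t = (poly (var_node_poly E (J - {j}) t) (t j))\<^sup>2 * cvand E (J - {j}) t"
proof -
  let ?K = "J - {j}"
  have J: "J = insert j ?K" "finite ?K" "j \<notin> ?K" using assms by auto
  have "(\<Prod>i\<in>J. \<Prod>k\<in>J - {i}. (t i - t k)\<^sup>2) =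
      (\<Prod>k\<in>?K. (t j - t k)\<^sup>2) * (\<Prod>i\<in>?K. \<Prod>k\<in>J - {i}. (t i - t k)\<^sup>2)"
    using assms by (subst prod.remove[of J j]) auto
  also have "(\<Prod>i\<in>?K. \<Prod>k\<in>J - {i}. (t i - t k)\<^sup>2) = (\<Prod>i\<in>?K. (t j - t i)\<^sup>2 * (\<Prod>k\<in>?K - {i}. (t i - t k)\<^sup>2))"
  proof (rule prod.cong[OF refl])
    fix i assume i: "i \<in> ?K"
    then have "(\<Prod>k\<in>J - {i}. (t i - t k)\<^sup>2) = (t i - t j)\<^sup>2 * (\<Prod>k\<in>J - {i} - {j}. (t i - t k)\<^sup>2)"
      using assms by (intro prod.remove) auto
    also have "J - {i} - {j} = ?K - {i}" by auto
    finally show "(\<Prod>k\<in>J - {i}. (t i - t k)\<^sup>2) = (t j - t i)\<^sup>2 * (\<Prod>k\<in>?K - {i}. (t i - t k)\<^sup>2)"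
      by (simp add: power2_commute)
  qed
  finally have "(\<Prod>i\<in>J. \<Prod>k\<in>J - {i}. (t i - t k)\<^sup>2) =
      (\<Prod>k\<in>?K. (t j - t k)\<^sup>2)\<^sup>2 * (\<Prod>i\<in>?K. \<Prod>k\<in>?K - {i}. (t i - t k)\<^sup>2)"
    by (simp add: prod.distrib power2_eq_square)
  moreover have "(\<Prod>i\<in>J. (\<Prod>e\<in>E. t i - e)\<^sup>2) = (\<Prod>e\<in>E. t j - e)\<^sup>2 * (\<Prod>i\<in>?K. (\<Prod>e\<in>E. t i - e)\<^sup>2)"
    using assms by (intro prod.remove) auto
  ultimately show ?thesis by (simp add: cvand_def poly_var_node_poly power_mult_distrib)
qed

lemma cvand_remove_node:
  assumes "finite E" "e \<in> E"
  shows "cvand E J t = (\<Prod>j\<in>J. (e - t j)\<^sup>2) * cvand (E - {e}) J t"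
  by (simp add: cvand_def prod.remove[OF assms] power_mult_distrib prod.distrib power2_commute)

text \<open>The residue sum with denominators cleared. The factor \<open>cvand E (J - {j}) t\<close> and the node
polynomial in the \<open>j\<close>-th term do not involve \<open>t j\<close>, so this variable can be integrated out by itself.\<close>

lemma cvand_residue_identity:
  assumes fin: "finite E" "finite J" and gen: "inj_on t J" "t ` J \<inter> E = {}"
    and deg: "degree f < card E + 2 * card J"
  shows "coeff f (card E + 2 * card J - 1) * cvand E J t =
     (\<Sum>e\<in>E. poly f e / (\<Prod>e'\<in>E - {e}. e - e') * cvand (E - {e}) J t) +
     (\<Sum>j\<in>J. cvand E (J - {j}) t * (poly (pderiv f) (t j) * poly (var_node_poly E (J - {j}) t) (t j) -
         poly f (t j) * poly (pderiv (var_node_poly E (J - {j}) t)) (t j)))"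
proof -
  have card: "card (t ` J) = card J" using gen by (simp add: card_image)
  have G: "node_poly E (t ` J - {t j}) = var_node_poly E (J - {j}) t" if "j \<in> J" for j
  proof -
    have "t ` J - {t j} = t ` (J - {j})" using gen that by (auto simp: inj_on_def)
    then show ?thesis using gen by (simp add: var_node_poly_eq_node_poly inj_on_diff)
  qed
  have 1: "poly f e / poly (node_poly (E - {e}) (t ` J)) e * cvand E J t =
      poly f e / (\<Prod>e'\<in>E - {e}. e - e') * cvand (E - {e}) J t" if e: "e \<in> E" for e
  proof -
    have "(\<Prod>j\<in>J. (e - t j)\<^sup>2) \<noteq> 0" using gen fin e by auto
    then show ?thesis using gen
      by (simp add: poly_node_poly prod.reindex cvand_remove_node[OF fin(1) e])
  qed
  have 2: "A / (poly (var_node_poly E (J - {j}) t) (t j))\<^sup>2 * cvand E J t = cvand E (J - {j}) t * A" if j: "j \<in> J" for j A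
  proof -
    have "poly (var_node_poly E (J - {j}) t) (t j) \<noteq> 0"
      using gen fin j by (auto simp: poly_var_node_poly inj_on_def)
    then show ?thesis by (simp add: cvand_remove_variable[OF fin(2) j])
  qed
  have "coeff f (card E + 2 * card J - 1) =
     (\<Sum>e\<in>E. poly f e / poly (node_poly (E - {e}) (t ` J)) e) +
     (\<Sum>j\<in>J. (poly (pderiv f) (t j) * poly (var_node_poly E (J - {j}) t) (t j) -
         poly f (t j) * poly (pderiv (var_node_poly E (J - {j}) t)) (t j)) / (poly (var_node_poly E (J - {j}) t) (t j))\<^sup>2)"
    using residue_sum[of E "t ` J" f] fin gen deg
    by (simp add: card sum.reindex G Int_commute cong: sum.cong)
  then show ?thesis
    by (simp only: distrib_right sum_distrib_right 1 2 cong: sum.cong)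
qed

text \<open>Symmetric integrands have integrals that depend only on the number of variables.\<close>

lemma integral_cube_reindex:
  fixes F :: "(nat \<Rightarrow> real) \<Rightarrow> real"
  assumes b: "bij_betw b J K" and F: "F \<in> borel_measurable (cube J)"
  shows "(\<integral>t. F (\<lambda>n\<in>J. t (b n)) \<partial>cube K) = integral\<^sup>L (cube J) F"
proof -
  have "distr (cube K) (cube J) (\<lambda>t. \<lambda>n\<in>J. t (b n)) = cube J"
    using b by (intro distr_PiM_reindex prob_space_I01) (auto simp: bij_betw_def)
  moreover have "(\<lambda>t. \<lambda>n\<in>J. t (b n)) \<in> measurable (cube K) (cube J)"
    using b by (intro measurable_restrict measurable_component_singleton) (auto simp: bij_betw_def)
  ultimately show ?thesis using F by (metis integral_distr)
qed

lemma cvand_reindex: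
  assumes b: "bij_betw b J K"
  shows "cvand E J (\<lambda>n\<in>J. t (b n)) = cvand E K t"
proof -
  have "(\<Prod>j\<in>J. (\<Prod>e\<in>E. t (b j) - e)\<^sup>2) = (\<Prod>j\<in>K. (\<Prod>e\<in>E. t j - e)\<^sup>2)"
    by (rule prod.reindex_bij_betw[OF b])
  moreover have "(\<Prod>i\<in>J. \<Prod>j\<in>J - {i}. (t (b i) - t (b j))\<^sup>2) = (\<Prod>i\<in>J. \<Prod>j\<in>K - {b i}. (t (b i) - t j)\<^sup>2)"
  proof (rule prod.cong[OF refl])
    fix i assume "i \<in> J"
    then have "bij_betw b (J - {i}) (K - {b i})" using b by (auto simp: bij_betw_def inj_on_def)
    then show "(\<Prod>j\<in>J - {i}. (t (b i) - t (b j))\<^sup>2) = (\<Prod>j\<in>K - {b i}. (t (b i) - t j)\<^sup>2)"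
      by (rule prod.reindex_bij_betw)
  qed
  moreover have "\<dots> = (\<Prod>i\<in>K. \<Prod>j\<in>K - {i}. (t i - t j)\<^sup>2)"
    by (rule prod.reindex_bij_betw[OF b])
  ultimately show ?thesis by (simp add: cvand_def)
qed

lemma var_node_poly_reindex:
  assumes b: "bij_betw b J K"
  shows "var_node_poly E J (\<lambda>n\<in>J. t (b n)) = var_node_poly E K t"
  using prod.reindex_bij_betw[OF b, of "\<lambda>j. [:- t j, 1:]\<^sup>2"] by (simp add: var_node_poly_def)

lemma integrable_poly_I01: "integrable I01 (poly g)"
proof -
  have "bounded (poly g ` {0..1})"
    by (intro compact_imp_bounded compact_continuous_image continuous_intros) auto
  then obtain B where "\<forall>x\<in>{0..1}. norm (poly g x) \<le> B" by (auto simp: bounded_iff)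
  moreover have "poly g \<in> borel_measurable I01"
    by (intro borel_measurable_I01 borel_measurable_continuous_onI continuous_intros)
  ultimately show ?thesis by (intro I01.integrable_const_bound[of _ B] AE_I2) auto
qed

text \<open>The skew form that appears when the variable of a double node is integrated out.\<close>

definition wronskian :: "real poly \<Rightarrow> real poly \<Rightarrow> real" where
  "wronskian f g = (\<integral>x. poly (pderiv f * g - f * pderiv g) x \<partial>I01)"

text \<open>Integration by parts turns the skew form into twice one of its two halves plus boundary terms; the
next lemma keeps the other half.\<close>

lemma wronskian_eq_left: "wronskian f g = 2 * (\<integral>x. poly (pderiv f * g) x \<partial>I01) - (poly f 1 * poly g 1 - poly f 0 * poly g 0)"
proof -
  have "wronskian f g = (\<integral>x. 2 * poly (pderiv f * g) x - poly (pderiv (f * g)) x \<partial>I01)"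
    unfolding wronskian_def by (intro Bochner_Integration.integral_cong) (auto simp: pderiv_mult algebra_simps)
  also have "\<dots> = 2 * (\<integral>x. poly (pderiv f * g) x \<partial>I01) - (poly (f * g) 1 - poly (f * g) 0)"
    by (simp only: Bochner_Integration.integral_diff integrable_poly_I01 integral_pderiv_I01
        integrable_mult_right integral_mult_right_zero)
  finally show ?thesis by simp
qed

lemma wronskian_eq_right: "wronskian f g = (poly f 1 * poly g 1 - poly f 0 * poly g 0) - 2 * (\<integral>x. poly (f * pderiv g) x \<partial>I01)"
proof -
  have "wronskian f g = (\<integral>x. poly (pderiv (f * g)) x - 2 * poly (f * pderiv g) x \<partial>I01)"
    unfolding wronskian_def by (intro Bochner_Integration.integral_cong) (auto simp: pderiv_mult algebra_simps)
  also have "\<dots> = (poly (f * g) 1 - poly (f * g) 0) - 2 * (\<integral>x. poly (f * pderiv g) x \<partial>I01)"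
    by (simp only: Bochner_Integration.integral_diff integrable_poly_I01 integral_pderiv_I01
        integrable_mult_right integral_mult_right_zero)
  finally show ?thesis by simp
qed

lemma wronskian_1: "wronskian 1 g = poly g 0 - poly g 1"
  by (simp add: wronskian_eq_left)

lemma integral_poly_I01: "(\<integral>x. poly p x \<partial>I01) = (\<Sum>i\<le>degree p. coeff p i / real (Suc i))"
proof -
  define q where "q = (\<Sum>i\<le>degree p. monom (coeff p i / real (Suc i)) (Suc i))"
  have "pderiv q = p"
    unfolding q_def pderiv_sum_distrib using poly_as_sum_of_monoms[of p] by (simp add: pderiv_monom)
  then have "(\<integral>x. poly p x \<partial>I01) = poly q 1 - poly q 0" using integral_pderiv_I01[of q] by simp
  then show ?thesis by (simp add: q_def poly_sum poly_monom)
qed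

lemma bounded_meas_integral_poly [bounded_meas_intros]:
  assumes "bounded_meas_poly J Q" shows "bounded_meas J (\<lambda>t. \<integral>x. poly (Q t) x \<partial>I01)"
proof -
  obtain d where d: "\<And>t. degree (Q t) \<le> d" using assms by (auto simp: bounded_meas_poly_def)
  have "(\<integral>x. poly (Q t) x \<partial>I01) = (\<Sum>i\<le>d. coeff (Q t) i * (1 / real (Suc i)))" for t
    unfolding integral_poly_I01 using d[of t]
    by (intro sum.mono_neutral_cong_left) (auto simp: coeff_eq_0)
  moreover have "bounded_meas J (\<lambda>t. \<Sum>i\<le>d. coeff (Q t) i * (1 / real (Suc i)))"
    using assms unfolding bounded_meas_poly_def by (intro bounded_meas_intros) auto
  ultimately show ?thesis by simp
qed

lemma bounded_meas_wronskian [bounded_meas_intros]: "bounded_meas_poly J Q \<Longrightarrow> bounded_meas J (\<lambda>t. wronskian f (Q t))"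
  unfolding wronskian_eq_left by (intro bounded_meas_intros)

text \<open>Selberg's integral with Vandermonde exponent four; the nodes \<open>0\<close> and \<open>1\<close> in \<open>E\<close> raise the
exponents of \<open>t\<close> and \<open>1 - t\<close> in the weight from zero to two.\<close>

definition selberg :: "real set \<Rightarrow> nat set \<Rightarrow> real" where "selberg E J = integral\<^sup>L (cube J) (cvand E J)"

definition wronskian_term :: "real poly \<Rightarrow> real set \<Rightarrow> nat set \<Rightarrow> real" where
  "wronskian_term f E J = (\<integral>t. cvand E J t * wronskian f (var_node_poly E J t) \<partial>cube J)"

lemma selberg_card: "finite J \<Longrightarrow> finite K \<Longrightarrow> card J = card K \<Longrightarrow> selberg E J = selberg E K"
  unfolding selberg_def
  using integral_cube_reindex[of _ J K "cvand E J"] bounded_meas_cvand[of J J E] finite_same_card_bij[of J K]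
  by (auto simp: bounded_meas_def cvand_reindex)

lemma wronskian_term_card: "finite J \<Longrightarrow> finite K \<Longrightarrow> card J = card K \<Longrightarrow> wronskian_term f E J = wronskian_term f E K"
  unfolding wronskian_term_def
  using integral_cube_reindex[of _ J K "\<lambda>t. cvand E J t * wronskian f (var_node_poly E J t)"]
    bounded_meas_mult[OF bounded_meas_cvand bounded_meas_wronskian[OF bounded_meas_poly_var_node_poly], of J J J E f E] finite_same_card_bij[of J K]
  by (auto simp: bounded_meas_def cvand_reindex var_node_poly_reindex)

text \<open>Fubini isolates the variable \<open>t j\<close> on which the \<open>j\<close>-th residue term depends through
\<open>f' g - f g'\<close> only. For \<open>j = k\<close> the weight \<open>\<phi>\<close> takes part in the inner integral, otherwise it is a
constant factor.\<close>

lemma integral_residue_term: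
  assumes J: "finite J" "j \<in> J" "k \<in> J"
  shows "(\<integral>t. poly \<phi> (t k) * (cvand E (J - {j}) t * (poly (pderiv f) (t j) * poly (var_node_poly E (J - {j}) t) (t j) -
         poly f (t j) * poly (pderiv (var_node_poly E (J - {j}) t)) (t j))) \<partial>cube J) =
     (if j = k
      then \<integral>t. cvand E (J - {k}) t * (\<integral>x. poly (\<phi> * (pderiv f * var_node_poly E (J - {k}) t - f * pderiv (var_node_poly E (J - {k}) t))) x \<partial>I01) \<partial>cube (J - {k})
      else \<integral>t. poly \<phi> (t k) * cvand E (J - {j}) t * wronskian f (var_node_poly E (J - {j}) t) \<partial>cube (J - {j}))"
    (is "?L = ?R")
proof -
  have c: "cvand E (J - {j}) (t(j := s)) = cvand E (J - {j}) t"
    "var_node_poly E (J - {j}) (t(j := s)) = var_node_poly E (J - {j}) t" for t s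
    by (auto intro!: cvand_cong var_node_poly_cong split: if_splits)
  have "?L = (\<integral>t. (\<integral>s. poly \<phi> ((t(j := s)) k) * (cvand E (J - {j}) t * (poly (pderiv f) s * poly (var_node_poly E (J - {j}) t) s -
         poly f s * poly (pderiv (var_node_poly E (J - {j}) t)) s)) \<partial>I01) \<partial>cube (J - {j}))"
    using J by (subst integral_cube_insert[of J j]) (auto intro!: bounded_meas_intros simp: c)
  also have "\<dots> = ?R"
  proof (cases "j = k")
    case True
    then have eq: "(\<integral>s. poly \<phi> ((t(j := s)) k) * (cvand E (J - {j}) t * (poly (pderiv f) s * poly (var_node_poly E (J - {j}) t) s -
         poly f s * poly (pderiv (var_node_poly E (J - {j}) t)) s)) \<partial>I01) =
         cvand E (J - {k}) t * (\<integral>x. poly (\<phi> * (pderiv f * var_node_poly E (J - {k}) t - f * pderiv (var_node_poly E (J - {k}) t))) x \<partial>I01)" for t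
      by (subst integral_mult_right_zero[symmetric]) (auto intro!: Bochner_Integration.integral_cong simp: mult_ac)
    show ?thesis unfolding eq using True by simp
  next
    case False
    then have eq: "(\<integral>s. poly \<phi> ((t(j := s)) k) * (cvand E (J - {j}) t * (poly (pderiv f) s * poly (var_node_poly E (J - {j}) t) s -
         poly f s * poly (pderiv (var_node_poly E (J - {j}) t)) s)) \<partial>I01) =
         poly \<phi> (t k) * cvand E (J - {j}) t * wronskian f (var_node_poly E (J - {j}) t)" for t
      unfolding wronskian_def
      by (subst integral_mult_right_zero[symmetric]) (auto intro!: Bochner_Integration.integral_cong simp: mult_ac)
    show ?thesis unfolding eq using False by simp
  qed
  finally show ?thesis .
qed

text \<open>The pointwise identity holds at distinct nodes outside \<open>E\<close>, that is,
almost everywhere.\<close>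

lemma integrated_residue_identity_weighted:
  assumes fin: "finite E" "finite J" and k: "k \<in> J"
    and deg: "degree f < card E + 2 * card J"
  shows "coeff f (card E + 2 * card J - 1) * (\<integral>t. poly \<phi> (t k) * cvand E J t \<partial>cube J) =
     (\<Sum>e\<in>E. poly f e / (\<Prod>e'\<in>E - {e}. e - e') * (\<integral>t. poly \<phi> (t k) * cvand (E - {e}) J t \<partial>cube J)) +
     (\<integral>t. cvand E (J - {k}) t * (\<integral>x. poly (\<phi> * (pderiv f * var_node_poly E (J - {k}) t - f * pderiv (var_node_poly E (J - {k}) t))) x \<partial>I01) \<partial>cube (J - {k})) +
     (\<Sum>j\<in>J - {k}. \<integral>t. poly \<phi> (t k) * cvand E (J - {j}) t * wronskian f (var_node_poly E (J - {j}) t) \<partial>cube (J - {j}))"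
proof -
  let ?T = "\<lambda>j t. cvand E (J - {j}) t * (poly (pderiv f) (t j) * poly (var_node_poly E (J - {j}) t) (t j) -
         poly f (t j) * poly (pderiv (var_node_poly E (J - {j}) t)) (t j))"
  let ?L = "\<lambda>t. poly \<phi> (t k) * (coeff f (card E + 2 * card J - 1) * cvand E J t)"
  let ?R = "\<lambda>t. (\<Sum>e\<in>E. poly \<phi> (t k) * (poly f e / (\<Prod>e'\<in>E - {e}. e - e') * cvand (E - {e}) J t)) +
     (\<Sum>j\<in>J. poly \<phi> (t k) * ?T j t)"
  have bm1: "bounded_meas J (\<lambda>t. poly \<phi> (t k) * (poly f e / (\<Prod>e'\<in>E - {e}. e - e') * cvand (E - {e}) J t))" for e
    using k by (intro bounded_meas_intros) auto
  have bm2: "bounded_meas J (\<lambda>t. poly \<phi> (t k) * ?T j t)" if "j \<in> J" for j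
    using k that by (intro bounded_meas_intros) auto
  have R: "bounded_meas J ?R" using bm1 bm2 by (intro bounded_meas_add bounded_meas_sum)
  have L: "bounded_meas J ?L" using k by (intro bounded_meas_intros) auto
  have "integral\<^sup>L (cube J) ?L = integral\<^sup>L (cube J) ?R"
  proof (rule integral_cong_AE)
    show "AE t in cube J. ?L t = ?R t"
      using AE_cube_generic[OF fin(2,1)]
    proof eventually_elim
      case (elim t)
      then show ?case
        by (subst cvand_residue_identity[OF fin _ _ deg]) (auto simp: distrib_left sum_distrib_left)
    qed
  qed (use L R in \<open>auto simp: bounded_meas_def\<close>)
  also have "\<dots> = (\<Sum>e\<in>E. \<integral>t. poly \<phi> (t k) * (poly f e / (\<Prod>e'\<in>E - {e}. e - e') * cvand (E - {e}) J t) \<partial>cube J) +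
     (\<Sum>j\<in>J. \<integral>t. poly \<phi> (t k) * ?T j t \<partial>cube J)"
    using bm1 bm2
    by (subst Bochner_Integration.integral_add)
       (auto intro!: bounded_meas_integrable bounded_meas_sum arg_cong2[where f="(+)"] Bochner_Integration.integral_sum
         simp del: times_divide_eq_left times_divide_eq_right)
  also have "(\<Sum>j\<in>J. \<integral>t. poly \<phi> (t k) * ?T j t \<partial>cube J) =
      (\<integral>t. cvand E (J - {k}) t * (\<integral>x. poly (\<phi> * (pderiv f * var_node_poly E (J - {k}) t - f * pderiv (var_node_poly E (J - {k}) t))) x \<partial>I01) \<partial>cube (J - {k})) +
     (\<Sum>j\<in>J - {k}. \<integral>t. poly \<phi> (t k) * cvand E (J - {j}) t * wronskian f (var_node_poly E (J - {j}) t) \<partial>cube (J - {j}))"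
    using fin k by (subst sum.remove[of J k]) (auto simp: integral_residue_term)
  finally show ?thesis
    by (simp add: mult.left_commute[of "poly \<phi> _"] add.assoc)
qed

text \<open>Without a weight all variables play the same part, so that the residue terms of the double
nodes have the same integral.\<close>

lemma integrated_residue_identity:
  assumes fin: "finite E" "finite J" and deg: "degree f < card E + 2 * card J"
  shows "coeff f (card E + 2 * card J - 1) * selberg E J =
     (\<Sum>e\<in>E. poly f e / (\<Prod>e'\<in>E - {e}. e - e') * selberg (E - {e}) J) +
     card J * wronskian_term f E {..<card J - 1}"
proof (cases "J = {}")
  case False
  then obtain k where k: "k \<in> J" by auto
  have c: "card (J - {j}) = card {..<card J - 1}" if "j \<in> J" for j using that fin by simp
  have "card J > 0" using False fin by (auto simp: card_gt_0_iff)
  have "wronskian_term f E (J - {k}) + (\<Sum>j\<in>J - {k}. wronskian_term f E (J - {j})) = (\<Sum>j\<in>J. wronskian_term f E (J - {j}))"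
    using fin k by (simp add: sum.remove)
  also have "\<dots> = (\<Sum>j\<in>J. wronskian_term f E {..<card J - 1})"
    using fin c by (intro sum.cong wronskian_term_card refl) auto
  finally show ?thesis
    using integrated_residue_identity_weighted[OF fin k deg, of 1]
    by (simp add: selberg_def wronskian_term_def wronskian_def)
qed (use residue_sum[of E "{}" f] fin deg in
  \<open>simp add: selberg_def cvand_def[abs_def] poly_node_poly prob_space.prob_space[OF prob_space_cube]\<close>)

section \<open>A symplectic Selberg integral\<close>

lemma cvand_insert_1: "cvand {0, 1} J t = (\<Prod>j\<in>J. (1 - t j)\<^sup>2) * cvand {0} J t"
  using cvand_remove_node[of "{0,1}" 1 J t] by (simp add: insert_Diff_if)

lemma cvand_single: "cvand {e} J t = (\<Prod>j\<in>J. (e - t j)\<^sup>2) * cvand {} J t"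
  using cvand_remove_node[of "{e}" e J t] by simp

text \<open>The residue identity for \<open>E = {0}\<close> and \<open>f = 1\<close>: the skew form of \<open>1\<close> and the node
polynomial reduces to the value at \<open>1\<close>, which supplies the second simple node.\<close>

lemma selberg_shift:
  assumes "N > 0" shows "selberg {} {..<N} = N * selberg {0, 1} {..<N - 1}"
proof -
  have "wronskian_term 1 {0} {..<N - 1} = (\<integral>t. - cvand {0, 1} {..<N - 1} t \<partial>cube {..<N - 1})"
    unfolding wronskian_term_def by (simp add: wronskian_1 poly_var_node_poly cvand_insert_1 mult.commute)
  also have "\<dots> = - selberg {0, 1} {..<N - 1}" by (simp add: selberg_def)
  finally show ?thesis
    using integrated_residue_identity[of "{0}" "{..<N}" 1] assms by simp
qed

text \<open>The residue identity for \<open>E = {0, 1}\<close> and \<open>f = 1\<close>, in which the double nodes contribute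
nothing because the node polynomial vanishes at both end points.\<close>

lemma selberg_reflection: "selberg {0} {..<N} = selberg {1} {..<N}"
proof -
  have "wronskian_term 1 {0, 1} {..<N - 1} = 0"
    unfolding wronskian_term_def by (simp add: wronskian_1 poly_var_node_poly)
  then show ?thesis
    using integrated_residue_identity[of "{0, 1}" "{..<N}" 1] by (simp add: insert_Diff_if)
qed

text \<open>Each derivative lowers the order of the zero by one; the factors that arise multiply to the
factorial.\<close>

lemma higher_pderiv_root:
  fixes p :: "real poly"
  shows "poly ((pderiv ^^ k) ([:-a, 1:] ^ k * p)) a = fact k * poly p a"
    and "i < k \<Longrightarrow> poly ((pderiv ^^ i) ([:-a, 1:] ^ k * p)) a = 0"
proof -
  have d: "pderiv ([:-a, 1:] ^ Suc k * p) = [:-a, 1:] ^ k * (smult (of_nat (Suc k)) p + [:-a, 1:] * pderiv p)" for k p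
  proof -
    have "pderiv ([:-a, 1:] ^ Suc k * p) = [:-a, 1:] ^ Suc k * pderiv p + p * (smult (of_nat (Suc k)) ([:-a, 1:] ^ k))"
      by (simp add: pderiv_mult pderiv_power_Suc pderiv_pCons one_pCons[symmetric] del: power_Suc mult_pCons_left mult_pCons_right of_nat_Suc)
    then show ?thesis
      by (simp add: distrib_left mult_ac del: mult_pCons_left mult_pCons_right of_nat_Suc)
  qed
  show "poly ((pderiv ^^ k) ([:-a, 1:] ^ k * p)) a = fact k * poly p a"
  proof (induction k arbitrary: p)
    case (Suc k)
    show ?case
      unfolding funpow_Suc_right o_def d Suc.IH by (simp add: algebra_simps)
  qed simp
  show "i < k \<Longrightarrow> poly ((pderiv ^^ i) ([:-a, 1:] ^ k * p)) a = 0"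
  proof (induction i arbitrary: k p)
    case (Suc i)
    then obtain k' where k: "k = Suc k'" by (cases k) auto
    show ?case
      unfolding funpow_Suc_right o_def d k using Suc k by (intro Suc.IH) auto
  qed auto
qed

lemma integral_by_parts_I01:
  "(\<integral>x. poly (pderiv f * g) x \<partial>I01) = poly f 1 * poly g 1 - poly f 0 * poly g 0 - (\<integral>x. poly (f * pderiv g) x \<partial>I01)"
  using wronskian_eq_left[of f g] wronskian_eq_right[of f g] by simp

text \<open>The shifted Legendre polynomial, normalised to be monic and given by Rodrigues' formula. It is
orthogonal to all derivatives of polynomials of degree at most \<open>n\<close>, so that only boundary terms survive in its skew
form with them.\<close>

lemma legendre_exists:
  obtains f :: "real poly" where "degree f = n" "coeff f n = 1"
    "poly f 1 = 1 / (2 * n choose n)" "poly f 0 = (-1) ^ n / (2 * n choose n)"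
    "\<And>g. degree g \<le> n \<Longrightarrow> wronskian f g = poly f 1 * poly g 1 - poly f 0 * poly g 0"
proof -
  define u :: "real poly" where "u = [:-0, 1:] ^ n * [:-1, 1:] ^ n"
  have u: "u = [:-1, 1:] ^ n * [:-0, 1:] ^ n" by (simp add: u_def mult.commute)
  define f where "f = smult (fact n / fact (2 * n)) ((pderiv ^^ n) u)"
  have choose: "real (2 * n choose n) = fact (2 * n) / (fact n * fact n)"
    by (simp add: binomial_fact)
  have du: "degree u = 2 * n" by (simp add: u_def degree_mult_eq degree_power_eq)
  have lu: "coeff u (2 * n) = 1"
  proof -
    have "lead_coeff u = 1" by (simp add: u_def lead_coeff_mult lead_coeff_power)
    then show ?thesis by (simp add: du)
  qed
  have "pochhammer (real (Suc n)) n = fact (2 * n) / fact n"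
    using pochhammer_product'[of "1::real" n n]
    by (simp add: pochhammer_fact[symmetric] mult_2 add.commute)
  then have "coeff ((pderiv ^^ n) u) n = fact (2 * n) / fact n"
    using lu by (simp add: coeff_higher_pderiv mult_2)
  then have c: "coeff f n = 1" by (simp add: f_def)
  have "degree f \<le> n"
    unfolding f_def by (rule order.trans[OF degree_smult_le]) (simp add: degree_higher_pderiv du)
  then have d: "degree f = n" using c by (intro antisym le_degree) auto
  have f1: "poly f 1 = 1 / (2 * n choose n)"
    using higher_pderiv_root(1)[of n 1 "[:-0, 1:] ^ n"] by (simp add: f_def u choose)
  have f0: "poly f 0 = (-1) ^ n / (2 * n choose n)"
    using higher_pderiv_root(1)[of n 0 "[:-1, 1:] ^ n"] by (simp add: f_def u_def choose)
  have orth: "(\<integral>x. poly ((pderiv ^^ i) u * g) x \<partial>I01) = 0" if "i \<le> n" "degree g < i" for i g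
    using that
  proof (induction i arbitrary: g)
    case (Suc i)
    have z: "poly ((pderiv ^^ i) u) 0 = 0" "poly ((pderiv ^^ i) u) 1 = 0"
      using Suc.prems higher_pderiv_root(2)[of i n 0 "[:-1, 1:] ^ n"] higher_pderiv_root(2)[of i n 1 "[:-0, 1:] ^ n"]
      unfolding u[symmetric] u_def[symmetric] by simp_all
    have "(\<integral>x. poly ((pderiv ^^ i) u * pderiv g) x \<partial>I01) = 0"
    proof (cases "degree g = 0")
      case True
      then have "pderiv g = 0" by (simp add: pderiv_eq_0_iff)
      then show ?thesis by simp
    next
      case False
      then show ?thesis using Suc.prems by (intro Suc.IH) (auto simp: degree_pderiv)
    qed
    then show ?case using integral_by_parts_I01[of "(pderiv ^^ i) u" g] z by simp
  qed simp
  have "wronskian f g = poly f 1 * poly g 1 - poly f 0 * poly g 0" if g: "degree g \<le> n" for g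
  proof -
    have "(\<integral>x. poly ((pderiv ^^ n) u * pderiv g) x \<partial>I01) = 0"
    proof (cases "degree g = 0")
      case True
      then have "pderiv g = 0" by (simp add: pderiv_eq_0_iff)
      then show ?thesis by simp
    next
      case False
      then show ?thesis using g by (intro orth) (auto simp: degree_pderiv)
    qed
    then show ?thesis by (simp add: wronskian_eq_right f_def mult.assoc)
  qed
  with that d c f1 f0 show thesis by blast
qed

lemma degree_var_node_poly_le:
  assumes "finite E" "finite J" shows "degree (var_node_poly E J t) \<le> card E + 2 * card J"
proof -
  have "degree (\<Prod>e\<in>E. [:-e, 1:]) \<le> card E"
    using degree_prod_sum_le[of E "\<lambda>e. [:-e, 1:]"] assms by simp
  moreover have "degree (\<Prod>j\<in>J. [:- t j, 1:]\<^sup>2) \<le> (\<Sum>j\<in>J. degree ([:- t j, 1:]\<^sup>2))"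
    using degree_prod_sum_le[of J "\<lambda>j. [:- t j, 1:]\<^sup>2"] assms by (simp add: o_def)
  ultimately show ?thesis
    unfolding var_node_poly_def by (intro order.trans[OF degree_mult_le]) (auto simp: degree_power_eq)
qed

text \<open>The residue identity without simple nodes, for the Legendre polynomial of degree \<open>2 N - 1\<close>: its
values at the end points are opposite, and the two boundary terms add up.\<close>

lemma selberg_step_odd:
  assumes "N > 0"
  shows "selberg {} {..<N} = 2 * N / (2 * (2 * N - 1) choose (2 * N - 1)) * selberg {0} {..<N - 1}"
proof -
  obtain f :: "real poly" where f: "degree f = 2 * N - 1" "coeff f (2 * N - 1) = 1"
    "poly f 1 = 1 / (2 * (2 * N - 1) choose (2 * N - 1))"
    "poly f 0 = (-1) ^ (2 * N - 1) / (2 * (2 * N - 1) choose (2 * N - 1))"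
    "\<And>g. degree g \<le> 2 * N - 1 \<Longrightarrow> wronskian f g = poly f 1 * poly g 1 - poly f 0 * poly g 0"
    using legendre_exists[of "2 * N - 1"] by blast
  have f0: "poly f 0 = - poly f 1" using f(3,4) assms by simp
  let ?K = "{..<N - 1}"
  have "wronskian_term f {} ?K = (\<integral>t. poly f 1 * (cvand {1} ?K t + cvand {0} ?K t) \<partial>cube ?K)"
    unfolding wronskian_term_def
  proof (intro Bochner_Integration.integral_cong refl)
    fix t
    have "degree (var_node_poly {} ?K t) \<le> 2 * N - 1"
      using degree_var_node_poly_le[of "{}" ?K t] by simp
    from f(5)[OF this] show "cvand {} ?K t * wronskian f (var_node_poly {} ?K t) = poly f 1 * (cvand {1} ?K t + cvand {0} ?K t)"
      by (simp add: f0 poly_var_node_poly cvand_single algebra_simps)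
  qed
  also have "\<dots> = poly f 1 * (selberg {1} ?K + selberg {0} ?K)"
    by (simp add: selberg_def Bochner_Integration.integral_add bounded_meas_integrable bounded_meas_cvand)
  finally show ?thesis
    using integrated_residue_identity[of "{}" "{..<N}" f] assms f(1,2,3)
    by (simp add: selberg_reflection)
qed

text \<open>The residue identity for \<open>E = {0}\<close> and the Legendre polynomial of degree \<open>2 N\<close>. The boundary
term at \<open>1\<close> is again a multiple of the integral on the right, by \<open>selberg_shift\<close>.\<close>

lemma selberg_step_even:
  assumes "N > 0"
  shows "selberg {0} {..<N} = 2 / (2 * (2 * N) choose (2 * N)) * selberg {} {..<N}"
proof -
  obtain f :: "real poly" where f: "degree f = 2 * N" "coeff f (2 * N) = 1"
    "poly f 1 = 1 / (2 * (2 * N) choose (2 * N))"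
    "poly f 0 = (-1) ^ (2 * N) / (2 * (2 * N) choose (2 * N))"
    "\<And>g. degree g \<le> 2 * N \<Longrightarrow> wronskian f g = poly f 1 * poly g 1 - poly f 0 * poly g 0"
    using legendre_exists[of "2 * N"] by blast
  let ?K = "{..<N - 1}"
  have "wronskian_term f {0} ?K = (\<integral>t. poly f 1 * cvand {0, 1} ?K t \<partial>cube ?K)"
    unfolding wronskian_term_def
  proof (intro Bochner_Integration.integral_cong refl)
    fix t
    have "degree (var_node_poly {0} ?K t) \<le> 2 * N"
      using degree_var_node_poly_le[of "{0}" ?K t] assms by simp
    from f(5)[OF this] show "cvand {0} ?K t * wronskian f (var_node_poly {0} ?K t) = poly f 1 * cvand {0, 1} ?K t"
      by (simp add: poly_var_node_poly cvand_insert_1 algebra_simps)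
  qed
  also have "\<dots> = poly f 1 * selberg {0, 1} ?K" by (simp add: selberg_def)
  finally show ?thesis
    using integrated_residue_identity[of "{0}" "{..<N}" f] assms f(1,2,3,4) selberg_shift[OF assms]
    by (simp add: mult.left_commute[of "real N"])
qed

text \<open>The value of the Beta function at \<open>(j + 1, j + 1)\<close>.\<close>

definition beta_diag :: "nat \<Rightarrow> real" where "beta_diag j = (fact j)\<^sup>2 / fact (2 * j + 1)"

lemma beta_diag_central_binomial: "2 / (2 * Suc k choose Suc k) * fact k = fact (Suc k) * beta_diag k"
proof -
  have "real (2 * Suc k choose Suc k) = fact (2 * Suc k) / (fact (Suc k) * fact (2 * Suc k - Suc k))"
    by (rule binomial_fact) simp
  moreover have "2 * Suc k - Suc k = Suc k" by simp
  moreover have "fact (2 * Suc k) = real (Suc (2 * k + 1)) * fact (2 * k + 1)"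
    using fact_Suc[of "2 * k + 1", where ?'a = real] by simp
  ultimately have c: "real (2 * Suc k choose Suc k) = real (Suc (2 * k + 1)) * fact (2 * k + 1) / (fact (Suc k) * fact (Suc k))"
    by (simp only:)
  have alg: "2 / (2 * s * d / (s * a * (s * a))) * a = s * a * (a\<^sup>2 / d)" if "s > 0" "d > 0" "a > 0" for s d a :: real
    using that by (simp add: field_simps power2_eq_square)
  have "real (Suc (2 * k + 1)) = 2 * real (Suc k)" by simp
  then show ?thesis
    unfolding c beta_diag_def fact_Suc of_nat_mult
    using alg[of "real (Suc k)" "fact (2 * k + 1)" "fact k"] by simp
qed

text \<open>Alternating the two steps: each central binomial coefficient contributes one Beta value.\<close>

lemma selberg_evaluation:
  assumes "N > 0"
  shows "selberg {} {..<N} = fact (2 * N - 1) * fact N * (\<Prod>j<2 * N - 1. beta_diag j)"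
  using assms
proof (induction N rule: nat_induct_non_zero)
  case 1
  show ?case using selberg_step_odd[of 1] by (simp add: selberg_def cvand_def[abs_def] prob_space.prob_space[OF prob_space_cube] beta_diag_def)
next
  case (Suc N)
  obtain k where k: "2 * N = Suc k" using Suc by (cases "2 * N") auto
  have "selberg {0} {..<N} = (2 / (2 * Suc k choose Suc k) * fact k) * (fact N * (\<Prod>j<k. beta_diag j))"
    unfolding selberg_step_even[OF Suc.hyps(1)] Suc.IH unfolding k by simp
  also have "\<dots> = fact (Suc k) * fact N * (\<Prod>j<Suc k. beta_diag j)"
    unfolding beta_diag_central_binomial by simp
  finally have Y: "selberg {0} {..<N} = fact (Suc k) * fact N * (\<Prod>j<Suc k. beta_diag j)" .
  have eqs: "2 * Suc N - 1 = Suc (Suc k)" using k by simp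
  have "selberg {} {..<Suc N} = (2 / (2 * Suc (Suc k) choose Suc (Suc k)) * fact (Suc k)) * (fact (Suc N) * (\<Prod>j<Suc k. beta_diag j))"
    unfolding selberg_step_odd[OF zero_less_Suc] eqs diff_Suc_1 Y by simp
  also have "\<dots> = fact (2 * Suc N - 1) * fact (Suc N) * (\<Prod>j<2 * Suc N - 1. beta_diag j)"
    unfolding beta_diag_central_binomial eqs by simp
  finally show ?case .
qed

section \<open>The marginal kernel reproduces polynomials\<close>

lemma Delta_power4: "Delta N t ^ 4 = cvand {} {1..N} t"
proof (induction N)
  case 0
  show ?case by (simp add: Delta_def cvand_def)
next
  case (Suc N)
  have "{1..<Suc N} = {1..N}" by auto
  then have "Delta (Suc N) t = Delta N t * (\<Prod>j\<in>{1..N}. t (Suc N) - t j)"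
    by (simp add: Delta_def)
  moreover have "{1..Suc N} - {Suc N} = {1..N}" by auto
  then have "cvand {} {1..Suc N} t = ((\<Prod>j\<in>{1..N}. (t (Suc N) - t j)\<^sup>2))\<^sup>2 * cvand {} {1..N} t"
    using cvand_remove_variable[of "{1..Suc N}" "Suc N" "{}" t] by (simp add: poly_var_node_poly)
  ultimately show ?case
    by (simp add: Suc.IH power_mult_distrib prod_power_distrib flip: power_mult)
qed

lemma cvand_pair:
  assumes "a \<noteq> b"
  shows "cvand {a, b} J t = (\<Prod>j\<in>J. (t j - a)\<^sup>2) * (\<Prod>j\<in>J. (t j - b)\<^sup>2) * cvand {} J t"
  using cvand_remove_node[of "{a, b}" a J t] assms
  by (simp add: insert_Diff_if cvand_single power2_commute)

lemma J_ou_0: "J_ou m 0 t = cvand {0, 1} {1..m-1} t"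
  by (simp add: J_ou_def Delta_power4 cvand_pair power2_commute)

lemma J_ol_eq: "x \<noteq> 0 \<Longrightarrow> J_ol m x t = x * cvand {0, x} {1..m-1} t"
  by (simp add: J_ol_def Delta_power4 cvand_pair power2_commute mult_ac)

lemma J_ou_eq: "x \<noteq> 1 \<Longrightarrow> J_ou m x t = (1 - x) * cvand {1, x} {1..m-1} t"
  by (simp add: J_ou_def Delta_power4 cvand_pair power2_commute mult_ac)

lemma bounded_meas_H_kernel [bounded_meas_intros]: "bounded_meas {1..m-1} (H_kernel m x)"
  unfolding H_kernel_def[abs_def] J_ou_def J_ol_def Delta_power4 by (intro bounded_meas_intros) auto

text \<open>The residue identity for the simple nodes \<open>0, 1, x\<close> is used twice. For \<open>f = 1\<close>
the three simple residues form \<open>- H / (x (1 - x))\<close>. For \<open>f = \<phi>\<close> only the residue at \<open>x\<close> is left. In both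
cases the double nodes contribute multiples of the same integral \<open>T\<close> of \<open>\<phi> g'\<close>.\<close>

lemma integral_H_kernel_weighted:
  assumes m: "m \<ge> 2" and x: "0 < x" "x < 1" and \<phi>: "\<phi> \<in> Pi0 (2 * m - 1)"
  shows "2 * real (m - 1) * (\<integral>t. poly \<phi> (t 1) * H_kernel m x t \<partial>cube {1..m-1}) =
     poly \<phi> x * selberg {0, 1} {1..m-1}"
proof -
  let ?J = "{1..m-1}" let ?K = "?J - {1}"
  have phi: "degree \<phi> \<le> 2 * m - 1" "poly \<phi> 0 = 0" "poly \<phi> 1 = 0"
    using \<phi> by (auto simp: Pi0_def)
  have E: "finite {0, 1, x}" "finite ?J" "1 \<in> ?J" "card {0, 1, x} = 3" "card ?J = m - 1"
    using m x by auto
  have Ed: "{0, 1, x} - {0} = {1, x}" "{0, 1, x} - {1} = {0, x}" "{0, 1, x} - {x} = {0, 1}"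
    using x by auto
  define T where "T = (\<integral>t. cvand {0, 1, x} ?K t * (\<integral>s. poly (\<phi> * pderiv (var_node_poly {0, 1, x} ?K t)) s \<partial>I01) \<partial>cube ?K)"
  define A where "A = (\<integral>t. poly \<phi> (t 1) * cvand {1, x} ?J t \<partial>cube ?J)"
  define B where "B = (\<integral>t. poly \<phi> (t 1) * cvand {0, x} ?J t \<partial>cube ?J)"
  define C where "C = (\<integral>t. poly \<phi> (t 1) * cvand {0, 1} ?J t \<partial>cube ?J)"
  have H: "poly \<phi> (t 1) * H_kernel m x t = poly \<phi> (t 1) * cvand {0, 1} ?J t -
      x * (poly \<phi> (t 1) * cvand {0, x} ?J t) - (1 - x) * (poly \<phi> (t 1) * cvand {1, x} ?J t)" for t
    unfolding H_kernel_def using x by (simp add: J_ou_0 J_ol_eq J_ou_eq algebra_simps)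
  have int: "integrable (cube ?J) (\<lambda>t. poly \<phi> (t 1) * cvand E ?J t)" for E
    using E by (intro bounded_meas_integrable bounded_meas_intros) auto
  have HABC: "(\<integral>t. poly \<phi> (t 1) * H_kernel m x t \<partial>cube ?J) = C - x * B - (1 - x) * A"
    unfolding H A_def B_def C_def using int
    by (simp only: integral_mult_right_zero Bochner_Integration.integral_diff Bochner_Integration.integrable_diff
        integrable_mult_right)
  have "A / x + B / (1 - x) + C / (x * (x - 1)) = T"
  proof -
    have "(\<Prod>e\<in>{0, 1, x}. 0 - e) = 0" "(\<Prod>e\<in>{0, 1, x}. 1 - e) = 0"
      by (intro prod_zero; force)+
    then have "wronskian 1 (var_node_poly {0, 1, x} K t) = 0" for K t
      unfolding wronskian_1 poly_var_node_poly by (simp only: mult_zero_left diff_self)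
    moreover have "coeff (1 :: real poly) (3 + 2 * (m - 1) - 1) = 0" using m by simp
    ultimately show ?thesis
      using integrated_residue_identity_weighted[OF E(1-3), of 1 \<phi>] m x E
      by (simp add: Ed T_def A_def B_def C_def insert_Diff_if del: One_nat_def)
  qed
  then have "x * (1 - x) * (A / x + B / (1 - x) + C / (x * (x - 1))) = x * (1 - x) * T" by simp
  moreover have "x * (1 - x) * (A / x + B / (1 - x) + C / (x * (x - 1))) = (1 - x) * A + x * B - C"
    using x by (simp add: divide_simps) algebra
  ultimately have I: "(\<integral>t. poly \<phi> (t 1) * H_kernel m x t \<partial>cube ?J) = - (x * (1 - x)) * T"
    unfolding HABC by (simp add: algebra_simps)
  have "poly \<phi> x / (x * (x - 1)) * selberg {0, 1} ?J = 2 * real (m - 1) * T"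
  proof -
    have wronskian: "wronskian \<phi> g = - 2 * (\<integral>s. poly (\<phi> * pderiv g) s \<partial>I01)" for g
      by (simp add: wronskian_eq_right phi)
    have "wronskian_term \<phi> {0, 1, x} {..<card ?J - 1} = wronskian_term \<phi> {0, 1, x} ?K"
      using E by (intro wronskian_term_card) auto
    also have "\<dots> = - 2 * T"
      unfolding wronskian_term_def wronskian T_def by (subst integral_mult_right_zero[symmetric]) (simp add: mult_ac)
    finally have r: "wronskian_term \<phi> {0, 1, x} {..<card ?J - 1} = - 2 * T" .
    have "coeff \<phi> (3 + 2 * (m - 1) - 1) = 0" using phi m by (intro coeff_eq_0) auto
    then show ?thesis
      using integrated_residue_identity[OF E(1,2), of \<phi>] phi m x E r
      by (simp add: Ed insert_Diff_if del: One_nat_def)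
  qed
  moreover have "poly \<phi> x * selberg {0, 1} ?J = - (x * (1 - x)) * (poly \<phi> x / (x * (x - 1)) * selberg {0, 1} ?J)"
    using x by (simp add: divide_simps) algebra
  ultimately show ?thesis unfolding I by simp
qed

lemma H_bar_eq: "H_bar m x s = (\<integral>t. H_kernel m x (t(1 := s)) \<partial>cube {2..m-1})"
proof -
  have c: "(\<lambda>t. (t(1 := s)) j) \<in> borel_measurable (PiM {2..m-1} (\<lambda>_. lborel))" if "j \<in> {1..m-1}" for j
    using that by (cases "j = 1") (auto intro: measurable_component_singleton[of _ _ "\<lambda>_. lborel", simplified])
  have "(\<lambda>t. H_kernel m x (t(1 := s))) \<in> borel_measurable (PiM {2..m-1} (\<lambda>_. lborel))"
    unfolding H_kernel_def J_ou_def J_ol_def Delta_def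
    by (intro borel_measurable_diff borel_measurable_times borel_measurable_prod borel_measurable_power
        borel_measurable_const c) auto
  then show ?thesis unfolding H_bar_def by (subst integral_cube) auto
qed

lemma H_kernel_insert_measurable:
  assumes "m \<ge> 2"
  shows "(\<lambda>(t, s). H_kernel m x (t(1 := s))) \<in> borel_measurable (cube {2..m-1} \<Otimes>\<^sub>M I01)"
proof -
  have J: "insert 1 {2..m-1} = {1..m-1}" using assms by auto
  have "(\<lambda>(t, s). t(1 := s)) \<in> measurable (cube {2..m-1} \<Otimes>\<^sub>M I01) (cube {1..m-1})"
    using measurable_add_dim[of 1 "{2..m-1}" "\<lambda>_. I01"] unfolding J .
  moreover have "H_kernel m x \<in> borel_measurable (cube {1..m-1})"
    using bounded_meas_H_kernel by (auto simp: bounded_meas_def)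
  ultimately show ?thesis by (auto dest: measurable_compose simp: split_beta')
qed

lemma H_kernel_insert_bounded:
  assumes "m \<ge> 2"
  shows "\<exists>B. \<forall>t\<in>space (cube {2..m-1}). \<forall>s\<in>{0..1}. \<bar>H_kernel m x (t(1 := s))\<bar> \<le> B"
proof -
  have J: "insert 1 {2..m-1} = {1..m-1}" using assms by auto
  obtain B where B: "\<forall>t\<in>space (cube {1..m-1}). \<bar>H_kernel m x t\<bar> \<le> B"
    using bounded_meas_H_kernel[of m x] unfolding bounded_meas_def by blast
  have "t(1 := s) \<in> space (cube {1..m-1})" if "t \<in> space (cube {2..m-1})" "s \<in> {0..1}" for t and s :: real
    using that unfolding space_cube J[symmetric] by (rule PiE_fun_upd[rotated])
  then show ?thesis using B by blast
qed

lemma H_bar_measurable_bounded: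
  assumes m: "m \<ge> 2"
  shows "H_bar m x \<in> borel_measurable I01" and "\<exists>B. \<forall>s\<in>{0..1}. \<bar>H_bar m x s\<bar> \<le> B"
proof -
  interpret P: prob_space "cube {2..m-1}" by (rule prob_space_cube)
  have "(\<lambda>(s, t). H_kernel m x (t(1 := s))) \<in> borel_measurable (I01 \<Otimes>\<^sub>M cube {2..m-1})"
    using measurable_compose[OF measurable_pair_swap' H_kernel_insert_measurable[OF m]]
    by (simp add: split_beta')
  then show "H_bar m x \<in> borel_measurable I01"
    unfolding H_bar_eq[abs_def] by (rule P.borel_measurable_lebesgue_integral)
  obtain B where B: "\<forall>t\<in>space (cube {2..m-1}). \<forall>s\<in>{0..1}. \<bar>H_kernel m x (t(1 := s))\<bar> \<le> B"
    using H_kernel_insert_bounded[OF m] by blast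
  have "\<bar>H_bar m x s\<bar> \<le> \<bar>B\<bar>" if "s \<in> {0..1}" for s
  proof -
    have "\<bar>H_bar m x s\<bar> \<le> (\<integral>t. \<bar>H_kernel m x (t(1 := s))\<bar> \<partial>cube {2..m-1})"
      unfolding H_bar_eq using integral_norm_bound[of "cube {2..m-1}"] by simp
    also have "\<dots> \<le> (\<integral>t. \<bar>B\<bar> \<partial>cube {2..m-1})"
      using B that by (intro integral_mono') force+
    finally show ?thesis using P.prob_space by simp
  qed
  then show "\<exists>B. \<forall>s\<in>{0..1}. \<bar>H_bar m x s\<bar> \<le> B" by blast
qed

text \<open>Fubini: the inner integral over all variables but the first is the marginal kernel.\<close>

lemma H_bar_reproducing:
  assumes m: "m \<ge> 2" and x: "0 < x" "x < 1" and \<phi>: "\<phi> \<in> Pi0 (2 * m - 1)"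
  shows "2 * real (m - 1) * (\<integral>s. poly \<phi> s * H_bar m x s \<partial>I01) = poly \<phi> x * selberg {0, 1} {..<m - 1}"
proof -
  let ?K = "{2..m-1}" let ?J = "{1..m-1}"
  interpret P: prob_space "cube ?K" by (rule prob_space_cube)
  interpret Q: pair_prob_space "cube ?K" I01 ..
  have JK: "insert 1 ?K = ?J" "?J - {1} = ?K" using m by auto
  have bmF: "bounded_meas ?J (\<lambda>t. poly \<phi> (t 1) * H_kernel m x t)" using m by (intro bounded_meas_intros) auto
  have "(\<integral>t. poly \<phi> (t 1) * H_kernel m x t \<partial>cube ?J) =
     (\<integral>t. (\<integral>s. poly \<phi> s * H_kernel m x (t(1 := s)) \<partial>I01) \<partial>cube ?K)"
    using integral_cube_insert[OF _ _ bmF, of 1] m unfolding JK(2) by simp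
  also have "\<dots> = (\<integral>s. (\<integral>t. poly \<phi> s * H_kernel m x (t(1 := s)) \<partial>cube ?K) \<partial>I01)"
  proof (rule Q.Fubini_integral[symmetric])
    obtain B where B: "\<forall>t\<in>space (cube {2..m-1}). \<forall>s\<in>{0..1}. \<bar>H_kernel m x (t(1 := s))\<bar> \<le> B"
      using H_kernel_insert_bounded[OF m] by blast
    have "bounded_meas {0} (\<lambda>t. poly \<phi> (t 0))" by (intro bounded_meas_intros) auto
    then obtain C where C: "\<forall>t\<in>space (cube {0}). \<bar>poly \<phi> (t 0)\<bar> \<le> C" by (auto simp: bounded_meas_def)
    have C': "\<bar>poly \<phi> s\<bar> \<le> C" if "s \<in> {0..1}" for s
      using bspec[OF C, of "\<lambda>i\<in>{0}. s"] that by (simp add: space_cube PiE_iff)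
    have meas: "(\<lambda>(t, s). poly \<phi> s * H_kernel m x (t(1 := s))) \<in> borel_measurable (cube ?K \<Otimes>\<^sub>M I01)"
    proof -
      have "(\<lambda>p. poly \<phi> (snd p)) \<in> borel_measurable (cube ?K \<Otimes>\<^sub>M I01)"
        by (rule measurable_compose[OF measurable_snd])
           (intro borel_measurable_I01 borel_measurable_continuous_onI continuous_intros)
      from borel_measurable_times[OF this H_kernel_insert_measurable[OF m, of x]]
      show ?thesis by (simp add: split_beta')
    qed
    have "\<bar>poly \<phi> s * H_kernel m x (t(1 := s))\<bar> \<le> \<bar>C\<bar> * \<bar>B\<bar>" if "t \<in> space (cube ?K)" "s \<in> {0..1}" for t s
      unfolding abs_mult using B C' that by (intro mult_mono) force+
    then show "integrable (cube ?K \<Otimes>\<^sub>M I01) (\<lambda>(t, s). poly \<phi> s * H_kernel m x (t(1 := s)))"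
      using meas by (intro Q.P.integrable_const_bound[of _ "\<bar>C\<bar> * \<bar>B\<bar>"] AE_I2) (auto simp: space_pair_measure)
  qed
  also have "\<dots> = (\<integral>s. poly \<phi> s * H_bar m x s \<partial>I01)"
    by (simp add: H_bar_eq)
  finally show ?thesis
    using integral_H_kernel_weighted[OF m x \<phi>] selberg_card[of ?J "{..<m-1}" "{0, 1}"] by simp
qed

section \<open>Positive functionals: orthogonal polynomials and quadrature\<close>

definition nonneg01 :: "real poly \<Rightarrow> bool" where
  "nonneg01 f \<longleftrightarrow> (\<forall>x\<in>{0..1}. 0 \<le> poly f x)"

text \<open>Degree below \<open>k\<close>, where the zero polynomial counts for every \<open>k\<close>, also for \<open>k = 0\<close>.\<close>

definition lowdeg :: "nat \<Rightarrow> real poly \<Rightarrow> bool" where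
  "lowdeg k q \<longleftrightarrow> (\<forall>i\<ge>k. coeff q i = 0)"

lemma lowdeg_iff: "lowdeg k q \<longleftrightarrow> q = 0 \<or> degree q < k"
proof
  assume l: "lowdeg k q"
  show "q = 0 \<or> degree q < k"
  proof (rule ccontr)
    assume "\<not> ?thesis"
    then have "lead_coeff q \<noteq> 0" "k \<le> degree q" by auto
    then show False using l by (auto simp: lowdeg_def)
  qed
qed (auto simp: lowdeg_def coeff_eq_0)

lemma lowdeg_split:
  assumes "degree p = k" "coeff p k = 1" "lowdeg (Suc k) r"
  obtains s where "r = smult (coeff r k) p + s" "lowdeg k s"
proof
  show "r = smult (coeff r k) p + (r - smult (coeff r k) p)" by simp
  show "lowdeg k (r - smult (coeff r k) p)"
    unfolding lowdeg_def
  proof (intro allI impI)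
    fix i assume "k \<le> i"
    then show "coeff (r - smult (coeff r k) p) i = 0"
      using assms by (cases "i = k") (auto simp: lowdeg_def coeff_eq_0)
  qed
qed

text \<open>The set \<open>Z\<close> consists of the zeros of odd order inside the interval. It is built by splitting off one
zero at a time: a zero met for the second time is removed again, so that the product stays free of sign changes.\<close>

lemma sign_changes:
  fixes p :: "real poly"
  assumes "p \<noteq> 0"
  shows "\<exists>Z. finite Z \<and> Z \<subseteq> {0<..<1} \<and> (\<forall>z\<in>Z. poly p z = 0) \<and> card Z \<le> degree p \<and>
    (nonneg01 (p * (\<Prod>z\<in>Z. [:-z, 1:])) \<or> nonneg01 (- (p * (\<Prod>z\<in>Z. [:-z, 1:]))))"
  using assms
proof (induction "degree p" arbitrary: p rule: less_induct)
  case less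
  show ?case
  proof (cases "\<exists>z\<in>{0<..<1}. poly p z = 0")
    case False
    have "nonneg01 p \<or> nonneg01 (- p)"
    proof (rule ccontr)
      assume "\<not> ?thesis"
      then obtain x y where xy: "x \<in> {0..1}" "y \<in> {0..1}" "poly p x < 0" "poly p y > 0"
        by (auto simp: nonneg01_def not_le)
      then consider "x < y" | "y < x" by (metis less_irrefl linorder_cases less_asym)
      then show False
      proof cases
        case 1
        then obtain z where "x < z" "z < y" "poly p z = 0" using poly_IVT_pos[of x y p] xy by auto
        then show False using False xy by auto
      next
        case 2
        then obtain z where "y < z" "z < x" "poly p z = 0" using poly_IVT_neg[of y x p] xy by auto
        then show False using False xy by auto
      qed
    qed
    then show ?thesis by (intro exI[of _ "{}"]) auto
  next
    case True
    then obtain z where z: "z \<in> {0<..<1}" "poly p z = 0" by auto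
    then obtain q where q: "p = [:-z, 1:] * q" by (metis poly_eq_0_iff_dvd dvdE)
    with less have q0: "q \<noteq> 0" by auto
    have dq: "degree p = Suc (degree q)" unfolding q using q0 by (subst degree_mult_eq) auto
    obtain Y where Y: "finite Y" "Y \<subseteq> {0<..<1}" "\<forall>z\<in>Y. poly q z = 0" "card Y \<le> degree q"
      "nonneg01 (q * (\<Prod>z\<in>Y. [:-z, 1:])) \<or> nonneg01 (- (q * (\<Prod>z\<in>Y. [:-z, 1:])))"
      using less.hyps[of q] q0 dq by auto
    show ?thesis
    proof (cases "z \<in> Y")
      case True
      then have "p * (\<Prod>z\<in>Y - {z}. [:-z, 1:]) = q * (\<Prod>z\<in>Y. [:-z, 1:])"
        unfolding q by (simp only: prod.remove[OF Y(1) True] mult_ac)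
      then show ?thesis
        using Y dq z True by (intro exI[of _ "Y - {z}"]) (auto simp: q)
    next
      case False
      have "p * (\<Prod>z\<in>insert z Y. [:-z, 1:]) = [:-z, 1:]\<^sup>2 * (q * (\<Prod>z\<in>Y. [:-z, 1:]))"
        unfolding q by (simp only: prod.insert[OF Y(1) False] mult_ac power2_eq_square)
      moreover have "nonneg01 ([:-z, 1:]\<^sup>2 * f)" if "nonneg01 f" for f
        using that by (auto simp: nonneg01_def simp del: mult_pCons_left)
      then have "nonneg01 ([:-z, 1:]\<^sup>2 * (q * (\<Prod>z\<in>Y. [:-z, 1:]))) \<or>
         nonneg01 (- ([:-z, 1:]\<^sup>2 * (q * (\<Prod>z\<in>Y. [:-z, 1:]))))"
        using Y(5) by (metis mult_minus_right)
      ultimately show ?thesis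
        using Y dq z False by (intro exI[of _ "insert z Y"]) (auto simp: q)
    qed
  qed
qed

text \<open>Multiplying by one of these four weights with \<open>a, b \<le> 1\<close> accounts for quadrature nodes at the end points.\<close>

definition wt :: "nat \<Rightarrow> nat \<Rightarrow> real poly" where "wt a b = [:0, 1:] ^ a * [:1, -1:] ^ b"

lemma poly_wt: "poly (wt a b) x = x ^ a * (1 - x) ^ b" by (simp add: wt_def)

lemma wt_nonzero [simp]: "wt a b \<noteq> 0" by (simp add: wt_def)

lemma degree_wt [simp]: "degree (wt a b) = a + b"
  by (simp add: wt_def degree_mult_eq degree_power_eq)

lemma nonneg01_wt_mult_square: "nonneg01 (wt a b * p\<^sup>2)"
  by (auto simp: nonneg01_def poly_wt)

text \<open>A linear functional on polynomials, thought of as integration against a measure of which only some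
moments are prescribed.\<close>

locale poly_functional =
  fixes L :: "real poly \<Rightarrow> real"
  assumes add: "L (p + q) = L p + L q" and smult: "L (smult a p) = a * L p"
begin

lemma zero [simp]: "L 0 = 0" using smult[of 0 0] by simp

lemma minus: "L (- p) = - L p" using smult[of "-1" p] by simp

lemma diff: "L (p - q) = L p - L q" using add[of p "- q"] by (simp add: minus)

lemma sum: "L (\<Sum>i\<in>A. f i) = (\<Sum>i\<in>A. L (f i))"
  by (induction A rule: infinite_finite_induct) (auto simp: add)

definition pos_upto :: "nat \<Rightarrow> bool" where
  "pos_upto n \<longleftrightarrow> (\<forall>f. degree f \<le> n \<longrightarrow> nonneg01 f \<longrightarrow> 0 \<le> L f)"

definition strict_upto :: "nat \<Rightarrow> bool" where
  "strict_upto n \<longleftrightarrow> (\<forall>f. f \<noteq> 0 \<longrightarrow> degree f \<le> n \<longrightarrow> nonneg01 f \<longrightarrow> 0 < L f)"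

lemma strict_imp_pos: "strict_upto n \<Longrightarrow> pos_upto n"
  unfolding strict_upto_def pos_upto_def by (metis less_eq_real_def zero)

text \<open>The monic orthogonal polynomial of degree \<open>k\<close> for the weight \<open>w\<close>.\<close>

definition ortho :: "real poly \<Rightarrow> nat \<Rightarrow> real poly \<Rightarrow> bool" where
  "ortho w k p \<longleftrightarrow> degree p = k \<and> coeff p k = 1 \<and> (\<forall>q. lowdeg k q \<longrightarrow> L (w * p * q) = 0)"

text \<open>Gram-Schmidt orthogonalisation for the form \<open>L (w p q)\<close>, adding one degree in each step.\<close>

lemma projection:
  assumes "\<And>q. q \<noteq> 0 \<Longrightarrow> lowdeg k q \<Longrightarrow> 0 < L (w * q\<^sup>2)"
  shows "\<exists>q. lowdeg k q \<and> (\<forall>r. lowdeg k r \<longrightarrow> L (w * (p - q) * r) = 0)"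
  using assms
proof (induction k arbitrary: p)
  case 0
  then show ?case by (intro exI[of _ 0]) (auto simp: lowdeg_iff)
next
  case (Suc k)
  have low: "lowdeg k q \<Longrightarrow> lowdeg (Suc k) q" for q by (auto simp: lowdeg_def)
  have IH: "\<exists>q. lowdeg k q \<and> (\<forall>r. lowdeg k r \<longrightarrow> L (w * (p - q) * r) = 0)" for p
    using Suc.prems low by (intro Suc.IH) blast
  obtain q0 where q0: "lowdeg k q0" "\<And>r. lowdeg k r \<Longrightarrow> L (w * (monom 1 k - q0) * r) = 0"
    using IH by blast
  define \<pi> where "\<pi> = monom 1 k - q0"
  have c\<pi>: "coeff \<pi> k = 1" using q0 by (simp add: \<pi>_def lowdeg_def)
  have l\<pi>: "lowdeg (Suc k) \<pi>" using q0 by (auto simp: \<pi>_def lowdeg_def)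
  have d\<pi>: "degree \<pi> = k"
    using c\<pi> l\<pi> by (intro antisym le_degree) (auto simp: lowdeg_iff)
  have N: "0 < L (w * \<pi>\<^sup>2)" using c\<pi> l\<pi> by (intro Suc.prems) auto
  obtain q1 where q1: "lowdeg k q1" "\<And>r. lowdeg k r \<Longrightarrow> L (w * (p - q1) * r) = 0"
    using IH by blast
  define c where "c = L (w * (p - q1) * \<pi>) / L (w * \<pi>\<^sup>2)"
  have "L (w * (p - (q1 + smult c \<pi>)) * r) = 0" if r: "lowdeg (Suc k) r" for r
  proof -
    obtain s where s: "r = smult (coeff r k) \<pi> + s" "lowdeg k s"
      using lowdeg_split[OF d\<pi> c\<pi> r] by blast
    have "w * (p - (q1 + smult c \<pi>)) * r = smult (coeff r k) (w * (p - q1) * \<pi> - smult c (w * \<pi>\<^sup>2)) +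
        (w * (p - q1) * s - smult c (w * \<pi> * s))"
      by (subst s(1)) (simp add: algebra_simps power2_eq_square smult_add_right smult_diff_right)
    then show ?thesis
      using q1(2)[OF s(2)] q0(2)[OF s(2)] N
      by (simp add: add diff smult c_def flip: \<pi>_def)
  qed
  moreover have "lowdeg (Suc k) (q1 + smult c \<pi>)" using q1(1) l\<pi> by (auto simp: lowdeg_def)
  ultimately show ?case by blast
qed

lemma ortho_exists:
  assumes strict: "strict_upto (n - 1)" and n: "n = a + b + 2 * k"
  obtains p where "ortho (wt a b) k p"
proof -
  have "0 < L (wt a b * q\<^sup>2)" if q: "q \<noteq> 0" "lowdeg k q" for q
  proof -
    have "degree (wt a b * q\<^sup>2) \<le> n - 1"
      using q n by (auto simp: lowdeg_iff degree_mult_eq degree_power_eq)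
    then show ?thesis
      using strict q by (auto simp: strict_upto_def nonneg01_wt_mult_square)
  qed
  then obtain q where q: "lowdeg k q" "\<And>r. lowdeg k r \<Longrightarrow> L (wt a b * (monom 1 k - q) * r) = 0"
    using projection[of k "wt a b" "monom 1 k"] by blast
  have c: "coeff (monom 1 k - q) k = 1" using q by (simp add: lowdeg_def)
  have "lowdeg (Suc k) (monom 1 k - q)" using q by (auto simp: lowdeg_def)
  then have "degree (monom 1 k - q) = k" using c by (intro antisym le_degree) (auto simp: lowdeg_iff)
  with c q that[of "monom 1 k - q"] show thesis by (auto simp: ortho_def)
qed

lemma ortho_unique:
  assumes strict: "strict_upto (n - 1)" and n: "n = a + b + 2 * k" and o: "ortho (wt a b) k p"
    and q: "lowdeg (Suc k) q" "\<And>r. lowdeg k r \<Longrightarrow> L (wt a b * q * r) = 0"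
  shows "q = smult (coeff q k) p"
proof -
  obtain s where s: "q = smult (coeff q k) p + s" "lowdeg k s"
    using o q lowdeg_split[of p k q] unfolding ortho_def by blast
  have "wt a b * s\<^sup>2 = wt a b * q * s - smult (coeff q k) (wt a b * p * s)"
    by (subst s(1)) (simp add: algebra_simps power2_eq_square)
  moreover have "L (wt a b * p * s) = 0" using o s(2) by (auto simp: ortho_def)
  ultimately have "L (wt a b * s\<^sup>2) = 0" using q(2)[OF s(2)] by (simp only: diff smult)
  moreover have "degree (wt a b * s\<^sup>2) \<le> n - 1" if "s \<noteq> 0"
    using s n that by (auto simp: lowdeg_iff degree_mult_eq degree_power_eq)
  moreover have "wt a b * s\<^sup>2 \<noteq> 0" if "s \<noteq> 0" using that by simp
  ultimately have "s = 0"
    using strict nonneg01_wt_mult_square[of a b s] unfolding strict_upto_def by (metis less_irrefl)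
  with s(1) show ?thesis by (metis add.right_neutral)
qed

text \<open>With fewer than \<open>k\<close> sign changes, multiplying by the polynomial \<open>q\<close> that has exactly these zeros
would give a polynomial of one sign on which the functional vanishes by orthogonality.\<close>

lemma ortho_zeros:
  assumes strict: "strict_upto (n - 1)" and n: "n = a + b + 2 * k" and o: "ortho (wt a b) k p"
  obtains Z where "finite Z" "Z \<subseteq> {0<..<1}" "card Z = k" "p = (\<Prod>z\<in>Z. [:-z, 1:])"
proof -
  have p: "p \<noteq> 0" "degree p = k" "lead_coeff p = 1" using o by (auto simp: ortho_def)
  obtain Z where Z: "finite Z" "Z \<subseteq> {0<..<1}" "\<forall>z\<in>Z. poly p z = 0" "card Z \<le> k"
    "nonneg01 (p * (\<Prod>z\<in>Z. [:-z, 1:])) \<or> nonneg01 (- (p * (\<Prod>z\<in>Z. [:-z, 1:])))"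
    using sign_changes[OF p(1)] p(2) by auto
  let ?q = "\<Prod>z\<in>Z. [:-z, 1:]"
  have q: "degree ?q = card Z" "lead_coeff ?q = 1" "?q \<noteq> 0"
    using degree_node_poly[of Z "{}"] lead_coeff_node_poly[of Z "{}"] node_poly_nonzero[of Z "{}"] Z(1)
    by (simp_all add: node_poly_def)
  have card: "card Z = k"
  proof (rule ccontr)
    assume "card Z \<noteq> k"
    with Z(4) have less: "card Z < k" by simp
    then have "lowdeg k ?q" using q by (auto simp: lowdeg_iff)
    then have 0: "L (wt a b * p * ?q) = 0" using o by (auto simp: ortho_def)
    have deg: "degree (wt a b * p * ?q) \<le> n - 1"
      using less n p q by (simp add: degree_mult_eq)
    have nz: "wt a b * p * ?q \<noteq> 0" using p(1) q(3) by (metis mult_eq_0_iff wt_nonzero)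
    have w: "nonneg01 (wt a b * g)" if "nonneg01 g" for g
      using that by (auto simp: nonneg01_def poly_wt)
    from Z(5) show False
    proof
      assume "nonneg01 (p * ?q)"
      from w[OF this] have "nonneg01 (wt a b * p * ?q)" by (simp add: mult.assoc)
      then have "0 < L (wt a b * p * ?q)" using strict deg nz unfolding strict_upto_def by blast
      then show False using 0 by simp
    next
      assume "nonneg01 (- (p * ?q))"
      from w[OF this] have "nonneg01 (- (wt a b * p * ?q))" by (simp add: mult.assoc)
      moreover have "degree (- (wt a b * p * ?q)) \<le> n - 1" "- (wt a b * p * ?q) \<noteq> 0"
        using deg nz by (auto simp: degree_minus)
      ultimately have "0 < L (- (wt a b * p * ?q))" using strict unfolding strict_upto_def by blast
      then show False using 0 by (simp only: minus)
    qed
  qed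
  have "?q dvd p"
    using prod_linear_powers_dvd[of Z "\<lambda>_. 1" p] Z by (simp add: poly_eq_0_iff_dvd)
  then obtain r where r: "p = ?q * r" by (auto elim: dvdE)
  have "r \<noteq> 0" using r p(1) by auto
  then have "degree r = 0" using r p(2) q card by (simp add: degree_mult_eq)
  then obtain c where "r = [:c:]" by (rule degree_eq_zeroE)
  moreover have "lead_coeff r = 1" using r p(3) q(2) by (simp add: lead_coeff_mult)
  ultimately have "p = ?q" using r by simp
  with Z card that show thesis by blast
qed

end

context poly_functional
begin

text \<open>Gauss, Radau and Lobatto quadrature in one statement. The functional annihilates the multiples of the node
polynomial, hence depends only on the values at the nodes; a weight is nonnegative because it is the value on a
nonnegative polynomial that vanishes at all other nodes. The bound \<open>D\<close> on the degrees may exceed the usual one if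
the functional also annihilates the multiples of \<open>w p\<^sup>2\<close>, which happens at the boundary of the moment space.\<close>

lemma quadrature:
  assumes strict: "strict_upto (n - 1)" and n: "n = a + b + 2 * k" "a \<le> 1" "b \<le> 1" "n \<ge> 1"
    and o: "ortho (wt a b) k p" and D: "n - 1 \<le> D"
    and van: "\<And>q. degree (wt a b * p\<^sup>2 * q) \<le> D \<Longrightarrow> L (wt a b * p\<^sup>2 * q) = 0"
  obtains N v where "finite N" "N \<subseteq> {0..1}" "\<And>z. z \<in> N \<Longrightarrow> 0 \<le> v z"
    "\<And>f. degree f \<le> D \<Longrightarrow> L f = (\<Sum>z\<in>N. v z * poly f z)"
proof -
  obtain Z where Z: "finite Z" "Z \<subseteq> {0<..<1}" "card Z = k" "p = (\<Prod>z\<in>Z. [:-z, 1:])"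
    using ortho_zeros[OF strict n(1) o] by blast
  have p: "p \<noteq> 0" "degree p = k" "coeff p k = 1" using o by (auto simp: ortho_def)
  define A B where "A = (if a = 1 then {0::real} else {})" and "B = (if b = 1 then {1::real} else {})"
  define N where "N = Z \<union> A \<union> B"
  have fin: "finite N" "finite A" "finite B" using Z by (auto simp: N_def A_def B_def)
  have dis: "Z \<inter> A = {}" "(Z \<union> A) \<inter> B = {}" using Z by (auto simp: A_def B_def)
  have cN: "card N = k + a + b"
    using Z n fin dis by (auto simp: N_def card_Un_disjoint A_def B_def)
  define \<omega> where "\<omega> = (\<Prod>z\<in>N. [:-z, 1:])"
  have wp: "wt a b * p = smult ((-1) ^ b) \<omega>"
  proof -
    have "\<omega> = p * (\<Prod>z\<in>A. [:-z, 1:]) * (\<Prod>z\<in>B. [:-z, 1:])"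
      unfolding \<omega>_def N_def Z(4) using Z fin dis by (simp add: prod.union_disjoint)
    moreover have "(\<Prod>z\<in>A. [:-z, 1:]) = [:0, 1:] ^ a" using n(2) by (cases a) (auto simp: A_def)
    moreover have "(\<Prod>z\<in>B. [:-z, 1:]) = smult ((-1) ^ b) ([:1, -1:] ^ b)" using n(3) by (cases b) (auto simp: B_def)
    ultimately have "smult ((-1) ^ b) \<omega> = smult ((-1) ^ b * (-1) ^ b) (p * [:0, 1:] ^ a * [:1, -1:] ^ b)"
      by (simp only: mult_smult_right smult_smult)
    also have "(-1) ^ b * (-1) ^ b = (1 :: real)" by (simp flip: power_mult_distrib)
    finally show ?thesis by (simp only: wt_def smult_1_left mult_ac)
  qed
  have \<omega>: "\<omega> \<noteq> 0" "degree \<omega> = k + a + b"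
    using degree_node_poly[of N "{}"] node_poly_nonzero[of N "{}"] fin cN by (simp_all add: \<omega>_def node_poly_def)
  have van': "L (\<omega> * g) = 0" if g: "degree (\<omega> * g) \<le> D" for g
  proof -
    define q r where "q = g div p" and "r = g mod p"
    have qr: "g = p * q + r" by (simp add: q_def r_def)
    have r: "lowdeg k r" using degree_mod_less[OF p(1), of g] p(2) by (auto simp: lowdeg_iff r_def)
    have "L (wt a b * p\<^sup>2 * q) = 0"
    proof (cases "q = 0")
      case False
      then have dpq: "degree (p * q) = k + degree q" using p by (simp add: degree_mult_eq)
      have dg: "degree g = k + degree q"
      proof (cases "r = 0")
        case False
        then have "degree r < degree (p * q)" using r dpq by (auto simp: lowdeg_iff)
        then show ?thesis unfolding qr by (simp only: degree_add_eq_left dpq)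
      qed (simp add: qr dpq)
      then have "g \<noteq> 0" using dpq False p(1) r qr by (metis add_eq_0_iff degree_minus dg lowdeg_iff mult_eq_0_iff neg_0_equal_iff_equal not_add_less1)
      then have "degree (\<omega> * g) = k + a + b + (k + degree q)" using \<omega> dg by (simp add: degree_mult_eq)
      then have "degree (wt a b * p\<^sup>2 * q) \<le> D"
        using g False p by (simp add: degree_mult_eq degree_power_eq)
      then show ?thesis by (rule van)
    qed simp
    moreover have "L (wt a b * p * r) = 0" using o r by (auto simp: ortho_def)
    moreover have "wt a b * p * g = wt a b * p\<^sup>2 * q + wt a b * p * r"
      by (subst qr) (simp add: algebra_simps power2_eq_square)
    ultimately have "L (wt a b * p * g) = 0" by (simp add: add)
    then have "(-1) ^ b * L (\<omega> * g) = 0" by (simp add: wp smult)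
    then show ?thesis by simp
  qed
  define l where "l z = node_poly (N - {z}) {}" for z
  define v where "v z = L (l z) / poly (l z) z" for z
  have main: "L f = (\<Sum>z\<in>N. v z * poly f z)" if f: "degree f \<le> D" for f
  proof -
    define q r where "q = f div \<omega>" and "r = f mod \<omega>"
    have qr: "f = \<omega> * q + r" by (simp add: q_def r_def)
    have "card N > 0" using cN n by auto
    then have dr: "degree r < card N" using degree_mod_less[OF \<omega>(1), of f] \<omega>(2) cN by (auto simp: r_def)
    have "degree (f - r) \<le> D"
      using f dr cN n D by (intro degree_diff_le) auto
    then have "L (\<omega> * q) = 0" using qr by (intro van') simp
    then have "L f = L r" by (subst qr) (simp add: add)
    also have "\<dots> = (\<Sum>z\<in>N. L (smult (poly r z / poly (l z) z) (l z)))"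
      unfolding l_def
      using arg_cong[OF partial_fractions[of N "{}" r], of L] dr fin by (simp add: sum)
    also have "\<dots> = (\<Sum>z\<in>N. v z * poly f z)"
    proof (rule sum.cong[OF refl])
      fix z assume "z \<in> N"
      then have "poly \<omega> z = 0" using fin by (auto simp: \<omega>_def poly_prod)
      then have "poly f z = poly r z" by (subst qr) simp
      then show "L (smult (poly r z / poly (l z) z) (l z)) = v z * poly f z"
        by (simp add: smult v_def)
    qed
    finally show ?thesis .
  qed
  have nonneg: "0 \<le> v z" if z: "z \<in> N" for z
  proof -
    \<comment> \<open>inside the interval, the square of the product over the other zeros of p will do; at an end point, the square of p with the factor of that end point dropped from the weight\<close>
    have ex: "\<exists>f. degree f \<le> n - 1 \<and> nonneg01 f \<and> poly f z > 0 \<and> (\<forall>y\<in>N - {z}. poly f y = 0)"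
    proof -
      consider "z \<in> Z" | "z = 0" "a = 1" | "z = 1" "b = 1"
        using z by (auto simp: N_def A_def B_def split: if_splits)
      then show ?thesis
      proof cases
        case 1
        let ?q = "\<Prod>y\<in>Z - {z}. [:-y, 1:]"
        have dq: "degree ?q = k - 1" "?q \<noteq> 0"
          using degree_node_poly[of "Z - {z}" "{}"] Z 1 by (simp_all add: node_poly_def)
        have "k \<ge> 1" using Z 1 by (metis One_nat_def Suc_leI card_gt_0_iff empty_iff)
        then have "degree (wt a b * ?q\<^sup>2) \<le> n - 1"
          using dq n by (simp add: degree_mult_eq degree_power_eq)
        moreover have "poly (wt a b * ?q\<^sup>2) z > 0"
          using 1 Z by (auto simp: poly_wt poly_prod)
        moreover have "poly (wt a b * ?q\<^sup>2) y = 0" if "y \<in> N - {z}" for y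
          using that Z by (auto simp: N_def A_def B_def poly_wt poly_prod split: if_splits)
        ultimately show ?thesis using nonneg01_wt_mult_square by blast
      next
        case 2
        have "degree (wt 0 b * p\<^sup>2) \<le> n - 1"
          using p n 2 by (simp add: degree_mult_eq degree_power_eq)
        moreover have "poly (wt 0 b * p\<^sup>2) z > 0"
          using 2 Z by (auto simp: poly_wt poly_prod)
        moreover have "poly (wt 0 b * p\<^sup>2) y = 0" if "y \<in> N - {z}" for y
          using that Z 2 by (auto simp: N_def A_def B_def poly_wt poly_prod split: if_splits)
        ultimately show ?thesis using nonneg01_wt_mult_square by blast
      next
        case 3
        have "degree (wt a 0 * p\<^sup>2) \<le> n - 1"
          using p n 3 by (simp add: degree_mult_eq degree_power_eq)
        moreover have "poly (wt a 0 * p\<^sup>2) z > 0"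
          using 3 Z by (auto simp: poly_wt poly_prod)
        moreover have "poly (wt a 0 * p\<^sup>2) y = 0" if "y \<in> N - {z}" for y
          using that Z 3 by (auto simp: N_def A_def B_def poly_wt poly_prod split: if_splits)
        ultimately show ?thesis using nonneg01_wt_mult_square by blast
      qed
    qed
    then obtain f where f: "degree f \<le> n - 1" "nonneg01 f" "poly f z > 0" "\<forall>y\<in>N - {z}. poly f y = 0" by blast
    have "L f = (\<Sum>y\<in>N. if y = z then v z * poly f z else 0)"
      using f D by (subst main) (auto intro!: sum.cong)
    also have "\<dots> = v z * poly f z" using z fin by simp
    finally have "0 \<le> v z * poly f z" using f strict_imp_pos[OF strict] by (auto simp: pos_upto_def)
    then show ?thesis using f(3) by (simp add: zero_le_mult_iff)
  qed
  have "N \<subseteq> {0..1}" using Z by (auto simp: N_def A_def B_def)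
  from that[OF fin(1) this nonneg main] show thesis .
qed

text \<open>On the unit interval \<open>g\<close> is bounded by some \<open>C\<close>, so \<open>C f + f g\<close> and \<open>C f - f g\<close> are
both nonnegative there.\<close>

lemma null_multiple:
  assumes pos: "pos_upto D" and f: "nonneg01 f" "L f = 0" and deg: "degree (f * g) \<le> D"
  shows "L (f * g) = 0"
proof (cases "f * g = 0")
  case False
  then have f0: "f \<noteq> 0" "g \<noteq> 0" by auto
  have "bounded (poly g ` {0..1})"
    by (intro compact_imp_bounded compact_continuous_image continuous_intros) auto
  then obtain C where C: "\<forall>x\<in>{0..1}. \<bar>poly g x\<bar> \<le> C" by (auto simp: bounded_iff)
  have df: "degree f \<le> D" using deg f0 by (simp add: degree_mult_eq)
  have "nonneg01 (smult C f + f * g)" "nonneg01 (smult C f - f * g)"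
  proof -
    have "0 \<le> poly f x * (C + poly g x) \<and> 0 \<le> poly f x * (C - poly g x)" if x: "x \<in> {0..1}" for x
    proof -
      have "0 \<le> poly f x" "\<bar>poly g x\<bar> \<le> C" using f(1) C x unfolding nonneg01_def by blast+
      then show ?thesis by (intro conjI mult_nonneg_nonneg) auto
    qed
    then show "nonneg01 (smult C f + f * g)" "nonneg01 (smult C f - f * g)"
      by (auto simp: nonneg01_def algebra_simps)
  qed
  moreover have "degree (smult C f + f * g) \<le> D" "degree (smult C f - f * g) \<le> D"
    using df deg by (auto intro!: degree_add_le degree_diff_le order.trans[OF degree_smult_le])
  ultimately have "0 \<le> L (smult C f + f * g)" "0 \<le> L (smult C f - f * g)"
    using pos by (auto simp: pos_upto_def)
  then show ?thesis using f(2) by (simp add: add diff smult)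
next
  case True
  show ?thesis unfolding True by (rule zero)
qed

end

lemma wt_simps: "wt 0 0 = 1" "wt 1 0 = [:0, 1:]" "wt 0 1 = [:1, -1:]" "wt 1 1 = [:0, 1:] * [:1, -1:]"
  by (simp_all add: wt_def)

lemma X_mult: "[:0, 1:] * r = pCons 0 r" for r :: "real poly" by simp

lemma one_minus_X_mult: "[:1, -1:] * r = r - pCons 0 r" for r :: "real poly" by simp

lemma lowdeg_mult:
  assumes "lowdeg k r" shows "lowdeg (Suc k) ([:0, 1:] * r)" "lowdeg (Suc k) ([:1, -1:] * r)"
  using assms unfolding X_mult one_minus_X_mult
  by (auto simp: lowdeg_def coeff_pCons split: nat.split)

context poly_functional
begin

lemma ortho_cross:
  assumes "ortho w k p" "lowdeg k (q - smult c p)"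
  shows "L (w * p * q) = c * L (w * p\<^sup>2)"
proof -
  have "w * p * q = smult c (w * p\<^sup>2) + w * p * (q - smult c p)"
    by (simp add: algebra_simps power2_eq_square)
  moreover have "L (w * p * (q - smult c p)) = 0" using assms by (simp add: ortho_def)
  ultimately show ?thesis by (simp only: add smult add_0_right)
qed

lemma ortho_lowdeg_diff:
  assumes "ortho w k p" "ortho w' k p'" shows "lowdeg k (p - p')"
  using assms by (auto simp: ortho_def lowdeg_def coeff_eq_0 le_less)

text \<open>In the two following lemmas \<open>A\<close> and \<open>B\<close> are the distances of a moment to the ends of its range,
and \<open>S\<close> is the length of the range of the next moment.\<close>

lemma gap_algebra:
  fixes A B S \<kappa> \<kappa>' :: real
  assumes "\<kappa> * A = S" "\<kappa>' * B = - S" "\<kappa> - \<kappa>' = 1"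
  shows "S * (A + B) = A * B"
proof -
  have "S * (A + B) = \<kappa> * A * B + S * A" using assms by (simp add: algebra_simps)
  also have "S * A = - \<kappa>' * B * A" using assms by simp
  finally have "S * (A + B) = (\<kappa> - \<kappa>') * (A * B)" by (simp add: algebra_simps)
  then show ?thesis using assms by simp
qed

text \<open>The four orthogonal polynomials of two consecutive levels are linked by two relations:
\<open>t Q + (1 - t) Q'\<close> is orthogonal to all lower degrees for the weight \<open>1\<close>, hence is a multiple of \<open>P\<close>, and
\<open>Q - Q'\<close> is likewise a multiple of \<open>R\<close>. The two factors are \<open>S / A\<close> and \<open>- S / B\<close>, and comparing
coefficients shows that they differ by one.\<close>

lemma gap_identity_even:
  assumes strict: "strict_upto (2 * k - 1)" and k: "k \<ge> 1"
    and P: "ortho (wt 0 0) k P" and R: "ortho (wt 1 1) (k - 1) R"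
    and Q: "ortho (wt 1 0) k Q" and Q': "ortho (wt 0 1) k Q'"
  defines "S \<equiv> L (wt 1 0 * Q\<^sup>2) + L (wt 0 1 * Q'\<^sup>2)"
  shows "S * (L (wt 0 0 * P\<^sup>2) + L (wt 1 1 * R\<^sup>2)) = L (wt 0 0 * P\<^sup>2) * L (wt 1 1 * R\<^sup>2)"
proof -
  define X1 where "X1 = [:0, 1:] * Q + [:1, -1:] * Q'"
  define X2 where "X2 = Q - Q'"
  have cQ: "coeff Q k = 1" "coeff Q' k = 1" "lowdeg (Suc k) Q" "lowdeg (Suc k) Q'"
    using Q Q' by (auto simp: ortho_def lowdeg_iff)
  have X1: "X1 = smult (coeff X1 k) P"
  proof (rule ortho_unique[of "2 * k" 0 0 k P X1])
    show "lowdeg (Suc k) X1"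
      unfolding lowdeg_def
    proof (intro allI impI)
      fix i assume "i \<ge> Suc k"
      then show "coeff X1 i = 0"
        using cQ unfolding X1_def X_mult one_minus_X_mult lowdeg_def by (cases "i = Suc k"; cases i) auto
    qed
    show "L (wt 0 0 * X1 * r) = 0" if "lowdeg k r" for r
    proof -
      have "wt 0 0 * X1 * r = wt 1 0 * Q * r + wt 0 1 * Q' * r"
        by (simp only: wt_simps X1_def distrib_left distrib_right mult_1_left)
      then show ?thesis using Q Q' that by (simp add: add ortho_def)
    qed
  qed (use strict P in auto)
  have X2: "X2 = smult (coeff X2 (k - 1)) R"
  proof (rule ortho_unique[of "2 * k" 1 1 "k - 1" R X2])
    have "lowdeg k X2" unfolding X2_def by (rule ortho_lowdeg_diff[OF Q Q'])
    then show "lowdeg (Suc (k - 1)) X2" using k by simp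
    show "L (wt 1 1 * X2 * r) = 0" if "lowdeg (k - 1) r" for r
    proof -
      have "wt 1 1 * X2 * r = wt 1 0 * Q * ([:1, -1:] * r) - wt 0 1 * Q' * ([:0, 1:] * r)"
        by (simp only: wt_simps X2_def algebra_simps)
      moreover have "lowdeg k ([:1, -1:] * r)" "lowdeg k ([:0, 1:] * r)"
        using lowdeg_mult[OF that] k by auto
      ultimately show ?thesis using Q Q' by (simp only: diff ortho_def)
    qed
  qed (use strict R k in auto)
  have "coeff X1 k * L (wt 0 0 * P\<^sup>2) = S"
  proof -
    have "coeff X1 k * L (wt 0 0 * P\<^sup>2) = L (wt 0 0 * X1 * P)"
      by (subst (2) X1) (simp add: smult power2_eq_square mult.assoc)
    also have "wt 0 0 * X1 * P = wt 1 0 * Q * P + wt 0 1 * Q' * P"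
      by (simp only: wt_simps X1_def distrib_left distrib_right mult_1_left)
    also have "L \<dots> = S"
      using ortho_cross[OF Q, of P 1] ortho_cross[OF Q', of P 1] ortho_lowdeg_diff[OF P Q] ortho_lowdeg_diff[OF P Q']
      by (simp add: add S_def)
    finally show ?thesis .
  qed
  moreover have "coeff X2 (k - 1) * L (wt 1 1 * R\<^sup>2) = - S"
  proof -
    have cR: "coeff R (k - 1) = 1" "\<And>i. i \<ge> k \<Longrightarrow> coeff R i = 0"
      using R k by (auto simp: ortho_def intro!: coeff_eq_0)
    have "coeff X2 (k - 1) * L (wt 1 1 * R\<^sup>2) = L (wt 1 1 * X2 * R)"
      by (subst (2) X2) (simp add: smult power2_eq_square mult.assoc)
    also have "wt 1 1 * X2 * R = wt 1 0 * Q * ([:1, -1:] * R) - wt 0 1 * Q' * ([:0, 1:] * R)"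
      by (simp only: wt_simps X2_def algebra_simps)
    also have "L \<dots> = L (wt 1 0 * Q * ([:1, -1:] * R)) - L (wt 0 1 * Q' * ([:0, 1:] * R))" by (rule diff)
    also have "L (wt 1 0 * Q * ([:1, -1:] * R)) = - 1 * L (wt 1 0 * Q\<^sup>2)"
    proof (rule ortho_cross[OF Q])
      show "lowdeg k ([:1, -1:] * R - smult (- 1) Q)"
        unfolding lowdeg_def
      proof (intro allI impI)
        fix i assume i: "i \<ge> k"
        obtain l j where "k = Suc l" "i = Suc j" using i k by (cases k; cases i) auto
        then show "coeff ([:1, -1:] * R - smult (- 1) Q) i = 0"
          using cR cQ i unfolding one_minus_X_mult lowdeg_def by (cases "j = l") auto
      qed
    qed
    also have "L (wt 0 1 * Q' * ([:0, 1:] * R)) = 1 * L (wt 0 1 * Q'\<^sup>2)"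
    proof (rule ortho_cross[OF Q'])
      show "lowdeg k ([:0, 1:] * R - smult 1 Q')"
        unfolding lowdeg_def
      proof (intro allI impI)
        fix i assume i: "i \<ge> k"
        obtain l j where "k = Suc l" "i = Suc j" using i k by (cases k; cases i) auto
        then show "coeff ([:0, 1:] * R - smult 1 Q') i = 0"
          using cR cQ i unfolding X_mult lowdeg_def by (cases "j = l") auto
      qed
    qed
    finally show ?thesis by (simp add: S_def)
  qed
  moreover have "coeff X1 k - coeff X2 (k - 1) = 1"
    using k cQ unfolding X1_def X2_def X_mult one_minus_X_mult
    by (cases k) (auto simp: coeff_pCons)
  ultimately show ?thesis by (rule gap_algebra)
qed

text \<open>As in the even case, with \<open>P + (1 - t) R\<close> a multiple of \<open>Q\<close> and \<open>P - t R\<close> a multiple of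
\<open>Q'\<close>; their difference is \<open>R\<close>.\<close>

lemma gap_identity_odd:
  assumes strict: "strict_upto (2 * k)"
    and P: "ortho (wt 0 0) (Suc k) P" and R: "ortho (wt 1 1) k R"
    and Q: "ortho (wt 1 0) k Q" and Q': "ortho (wt 0 1) k Q'"
  defines "S \<equiv> L (wt 0 0 * P\<^sup>2) + L (wt 1 1 * R\<^sup>2)"
  shows "S * (L (wt 1 0 * Q\<^sup>2) + L (wt 0 1 * Q'\<^sup>2)) = L (wt 1 0 * Q\<^sup>2) * L (wt 0 1 * Q'\<^sup>2)"
proof -
  define X1 where "X1 = P + [:1, -1:] * R"
  define X2 where "X2 = P - [:0, 1:] * R"
  have cP: "coeff P (Suc k) = 1" "lowdeg (Suc (Suc k)) P" "coeff R k = 1" "lowdeg (Suc k) R"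
    using P R by (auto simp: ortho_def lowdeg_iff)
  have cQ: "coeff Q k = 1" "coeff Q' k = 1" "lowdeg (Suc k) Q" "lowdeg (Suc k) Q'"
    using Q Q' by (auto simp: ortho_def lowdeg_iff)
  have low: "lowdeg (Suc k) X1" "lowdeg (Suc k) X2"
  proof -
    have "coeff X1 i = 0 \<and> coeff X2 i = 0" if i: "i \<ge> Suc k" for i
    proof -
      obtain j where j: "i = Suc j" using i by (cases i) auto
      show ?thesis
        using cP i unfolding X1_def X2_def X_mult one_minus_X_mult j lowdeg_def
        by (cases "j = k") auto
    qed
    then show "lowdeg (Suc k) X1" "lowdeg (Suc k) X2" by (auto simp: lowdeg_def)
  qed
  have w1: "wt 1 0 * X1 * r = wt 0 0 * P * ([:0, 1:] * r) + wt 1 1 * R * r" for r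
  proof -
    have "x * (P + y * R) * r = 1 * P * (x * r) + x * y * R * r" for x y :: "real poly"
      by (simp add: algebra_simps)
    then show ?thesis unfolding wt_simps X1_def .
  qed
  have w2: "wt 0 1 * X2 * r = wt 0 0 * P * ([:1, -1:] * r) - wt 1 1 * R * r" for r
  proof -
    have "y * (P - x * R) * r = 1 * P * (y * r) - x * y * R * r" for x y :: "real poly"
      by (simp add: algebra_simps)
    then show ?thesis unfolding wt_simps X2_def .
  qed
  have X1: "X1 = smult (coeff X1 k) Q"
  proof (rule ortho_unique[of "2 * k + 1" 1 0 k Q X1, OF _ _ Q low(1)])
    show "L (wt 1 0 * X1 * r) = 0" if "lowdeg k r" for r
      unfolding w1 using P R lowdeg_mult(1)[OF that] that by (simp only: add ortho_def)
  qed (use strict in auto)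
  have X2: "X2 = smult (coeff X2 k) Q'"
  proof (rule ortho_unique[of "2 * k + 1" 0 1 k Q' X2, OF _ _ Q' low(2)])
    show "L (wt 0 1 * X2 * r) = 0" if "lowdeg k r" for r
      unfolding w2 using P R lowdeg_mult(2)[OF that] that by (simp only: diff ortho_def)
  qed (use strict in auto)
  have "coeff X1 k * L (wt 1 0 * Q\<^sup>2) = S"
  proof -
    have "coeff X1 k * L (wt 1 0 * Q\<^sup>2) = L (wt 1 0 * X1 * Q)"
      by (subst (2) X1) (simp add: smult power2_eq_square mult.assoc)
    also have "\<dots> = L (wt 0 0 * P * ([:0, 1:] * Q)) + L (wt 1 1 * R * Q)" unfolding w1 by (rule add)
    also have "L (wt 0 0 * P * ([:0, 1:] * Q)) = 1 * L (wt 0 0 * P\<^sup>2)"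
    proof (rule ortho_cross[OF P])
      show "lowdeg (Suc k) ([:0, 1:] * Q - smult 1 P)"
        unfolding lowdeg_def
      proof (intro allI impI)
        fix i assume "i \<ge> Suc k"
        then show "coeff ([:0, 1:] * Q - smult 1 P) i = 0"
          using cP cQ unfolding X_mult lowdeg_def by (cases "i = Suc k"; cases i) auto
      qed
    qed
    also have "L (wt 1 1 * R * Q) = 1 * L (wt 1 1 * R\<^sup>2)"
      using ortho_lowdeg_diff[OF Q R] by (intro ortho_cross[OF R]) simp
    finally show ?thesis by (simp add: S_def)
  qed
  moreover have "coeff X2 k * L (wt 0 1 * Q'\<^sup>2) = - S"
  proof -
    have "coeff X2 k * L (wt 0 1 * Q'\<^sup>2) = L (wt 0 1 * X2 * Q')"
      by (subst (2) X2) (simp add: smult power2_eq_square mult.assoc)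
    also have "\<dots> = L (wt 0 0 * P * ([:1, -1:] * Q')) - L (wt 1 1 * R * Q')" unfolding w2 by (rule diff)
    also have "L (wt 0 0 * P * ([:1, -1:] * Q')) = - 1 * L (wt 0 0 * P\<^sup>2)"
    proof (rule ortho_cross[OF P])
      show "lowdeg (Suc k) ([:1, -1:] * Q' - smult (- 1) P)"
        unfolding lowdeg_def
      proof (intro allI impI)
        fix i assume "i \<ge> Suc k"
        then show "coeff ([:1, -1:] * Q' - smult (- 1) P) i = 0"
          using cP cQ unfolding one_minus_X_mult lowdeg_def by (cases "i = Suc k"; cases i) auto
      qed
    qed
    also have "L (wt 1 1 * R * Q') = 1 * L (wt 1 1 * R\<^sup>2)"
      using ortho_lowdeg_diff[OF Q' R] by (intro ortho_cross[OF R]) simp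
    finally show ?thesis by (simp add: S_def)
  qed
  moreover have "coeff X1 k - coeff X2 k = 1"
    using cP unfolding X1_def X2_def X_mult one_minus_X_mult by (simp add: coeff_pCons)
  ultimately show ?thesis by (rule gap_algebra)
qed

end

section \<open>One further moment: the slices of the moment space\<close>

text \<open>The functional with moments \<open>c\<close>. The moment of order zero is one whatever the value \<open>c 0\<close>, since vectors in
\<open>PiM {1..n}\<close> are undefined there.\<close>

definition Lc :: "(nat \<Rightarrow> real) \<Rightarrow> real poly \<Rightarrow> real" where
  "Lc c p = (\<Sum>i\<le>degree p. coeff p i * (if i = 0 then 1 else c i))"

lemma Lc_sum: "degree p \<le> N \<Longrightarrow> Lc c p = (\<Sum>i\<le>N. coeff p i * (if i = 0 then 1 else c i))"
  unfolding Lc_def by (intro sum.mono_neutral_left) (auto simp: coeff_eq_0)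

interpretation Lc: poly_functional "Lc c" for c
proof
  fix p q :: "real poly" and a :: real
  let ?N = "max (degree p) (degree q)"
  have "degree (p + q) \<le> ?N" by (rule degree_add_le) auto
  then show "Lc c (p + q) = Lc c p + Lc c q"
    by (simp add: Lc_sum[of _ ?N] sum.distrib distrib_right)
  show "Lc c (smult a p) = a * Lc c p"
    using Lc_sum[OF degree_smult_le[of a p], of c] by (simp add: Lc_def sum_distrib_left mult.assoc)
qed

lemma Lc_upd: "n \<ge> 1 \<Longrightarrow> Lc (c(n := x)) p = Lc c p + (x - c n) * coeff p n"
proof -
  assume n: "n \<ge> 1"
  let ?N = "max (degree p) n"
  have "Lc (c(n := x)) p = (\<Sum>i\<le>?N. coeff p i * (if i = 0 then 1 else c i) + (if i = n then (x - c n) * coeff p n else 0))"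
    unfolding Lc_sum[of p ?N, OF max.cobounded1] using n by (intro sum.cong) (auto simp: algebra_simps)
  then show ?thesis by (simp add: sum.distrib Lc_sum[of p ?N])
qed

lemma Lc_agree: "degree p < n \<Longrightarrow> Lc (c(n := x)) p = Lc c p"
  by (subst Lc_upd) (auto simp: coeff_eq_0)

lemma Lc_const: "Lc c [:a:] = a" by (simp add: Lc_def)

lemma Lc_one [simp]: "Lc c 1 = 1" using Lc_const[of c 1] by (simp add: one_pCons)

lemma strict_upd: "m < n \<Longrightarrow> Lc.strict_upto (c(n := x)) m \<longleftrightarrow> Lc.strict_upto c m"
  by (auto simp: Lc.strict_upto_def Lc_agree)

lemma pos_upd: "m < n \<Longrightarrow> Lc.pos_upto (c(n := x)) m \<longleftrightarrow> Lc.pos_upto c m"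
  by (auto simp: Lc.pos_upto_def Lc_agree)

lemma ortho_upd:
  assumes "n = a + b + 2 * k"
  shows "Lc.ortho (c(n := x)) (wt a b) k p \<longleftrightarrow> Lc.ortho c (wt a b) k p"
proof -
  have "Lc (c(n := x)) (wt a b * p * q) = Lc c (wt a b * p * q)" if "lowdeg k q" "degree p = k" for q
  proof (cases "q = 0 \<or> p = 0")
    case False
    then have "degree (wt a b * p * q) < n" using that assms by (auto simp: lowdeg_iff degree_mult_eq)
    then show ?thesis by (rule Lc_agree)
  qed auto
  then show ?thesis by (auto simp: Lc.ortho_def)
qed

lemma coeff_wt_square:
  assumes "n = a + b + 2 * k" "degree p = k" "coeff p k = 1"
  shows "coeff (wt a b * p\<^sup>2) n = (-1) ^ b" "degree (wt a b * p\<^sup>2) = n"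
proof -
  have p: "p \<noteq> 0" using assms by auto
  then show d: "degree (wt a b * p\<^sup>2) = n" using assms by (simp add: degree_mult_eq degree_power_eq)
  have "lead_coeff (wt a b * p\<^sup>2) = (-1) ^ b"
    using assms by (simp add: lead_coeff_mult lead_coeff_power wt_def)
  then show "coeff (wt a b * p\<^sup>2) n = (-1) ^ b" using d by simp
qed

abbreviation slice :: "nat \<Rightarrow> (nat \<Rightarrow> real) \<Rightarrow> real set" where
  "slice n c \<equiv> {x. Lc.pos_upto (c(n := x)) n}"

text \<open>The extreme values of the \<open>n\<close>-th moment are attained by quadratures whose nodes are the zeros of
\<open>w p\<close>, where \<open>w p\<^sup>2\<close> has degree \<open>n\<close>. At the lower end \<open>w\<close> is \<open>1\<close> or \<open>t\<close>, at the upper end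
\<open>t (1 - t)\<close> or \<open>1 - t\<close>, according to the parity of \<open>n\<close>.\<close>

definition lower_ortho :: "nat \<Rightarrow> (nat \<Rightarrow> real) \<Rightarrow> real poly \<Rightarrow> bool" where
  "lower_ortho n c p \<longleftrightarrow> Lc.ortho c (wt (n mod 2) 0) (n div 2) p"

definition upper_ortho :: "nat \<Rightarrow> (nat \<Rightarrow> real) \<Rightarrow> real poly \<Rightarrow> bool" where
  "upper_ortho n c p \<longleftrightarrow> Lc.ortho c (wt (Suc n mod 2) 1) ((n - 1) div 2) p"

text \<open>Since \<open>w p\<^sup>2\<close> has leading coefficient \<open>1\<close> or \<open>-1\<close>, the value of the functional on it is the
distance of the \<open>n\<close>-th moment to the respective end of its range.\<close>

definition lower_gap :: "nat \<Rightarrow> (nat \<Rightarrow> real) \<Rightarrow> real poly \<Rightarrow> real" where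
  "lower_gap n c p = Lc c (wt (n mod 2) 0 * p\<^sup>2)"

definition upper_gap :: "nat \<Rightarrow> (nat \<Rightarrow> real) \<Rightarrow> real poly \<Rightarrow> real" where
  "upper_gap n c p = Lc c (wt (Suc n mod 2) 1 * p\<^sup>2)"

lemma level_lower: "(n :: nat) = n mod 2 + 0 + 2 * (n div 2)" by simp

lemma level_upper: "n \<ge> 1 \<Longrightarrow> n = Suc n mod 2 + 1 + 2 * ((n - 1) div 2)" by presburger

lemma ortho_both_exist:
  assumes "n \<ge> 1" "Lc.strict_upto c (n - 1)"
  obtains p p' where "lower_ortho n c p" "upper_ortho n c p'"
  using Lc.ortho_exists[OF assms(2) level_lower] Lc.ortho_exists[OF assms(2) level_upper[OF assms(1)]]
  unfolding lower_ortho_def upper_ortho_def by metis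

text \<open>If the functional annihilates \<open>w p\<^sup>2\<close>, the quadrature at the zeros of \<open>w p\<close> is exact up to
degree \<open>n\<close>, and a sum over nodes with nonnegative weights is nonnegative.\<close>

lemma endpoint_pos:
  assumes n: "n \<ge> 1" "n = a + b + 2 * k" "a \<le> 1" "b \<le> 1" and strict: "Lc.strict_upto c (n - 1)"
    and o: "Lc.ortho c (wt a b) k p" and 0: "Lc c (wt a b * p\<^sup>2) = 0"
  shows "Lc.pos_upto c n"
proof -
  have van: "Lc c (wt a b * p\<^sup>2 * q) = 0" if "degree (wt a b * p\<^sup>2 * q) \<le> n" for q
  proof (cases "q = 0")
    case False
    have p: "p \<noteq> 0" "degree (wt a b * p\<^sup>2) = n"
      using o coeff_wt_square[OF n(2)] by (auto simp: Lc.ortho_def)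
    then have "degree q = 0" using that False by (auto simp: degree_mult_eq)
    then obtain e where "q = [:e:]" by (rule degree_eq_zeroE)
    then show ?thesis using 0 Lc.smult by (simp add: mult.commute[of _ "[:e:]"])
  qed simp
  obtain N v where N: "finite N" "N \<subseteq> {0..1}" "\<And>z. z \<in> N \<Longrightarrow> 0 \<le> v z"
    "\<And>f. degree f \<le> n \<Longrightarrow> Lc c f = (\<Sum>z\<in>N. v z * poly f z)"
    using Lc.quadrature[OF strict n(2,3,4,1) o diff_le_self van] by blast
  show ?thesis
    unfolding Lc.pos_upto_def using N by (auto simp: nonneg01_def intro!: sum_nonneg mult_nonneg_nonneg)
qed

text \<open>Positivity on the two polynomials \<open>w p\<^sup>2\<close> confines the moment to the interval, the end points are
admissible by quadrature, and the values between them by convexity. On a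
polynomial of exact degree \<open>n\<close> the functional takes different values at the two end points, both nonnegative if the
polynomial is, so its value in the interior is positive.\<close>

lemma slice_interval:
  assumes n: "n \<ge> 1" and strict: "Lc.strict_upto c (n - 1)"
    and p: "lower_ortho n c p" and p': "upper_ortho n c p'"
  shows "slice n c = {c n - lower_gap n c p .. c n + upper_gap n c p'}" (is ?slice)
    and "lower_gap n c p + upper_gap n c p' > 0" (is ?pos)
    and "x \<in> {c n - lower_gap n c p <..< c n + upper_gap n c p'} \<Longrightarrow> Lc.strict_upto (c(n := x)) n"
proof -
  let ?A = "lower_gap n c p" and ?B = "upper_gap n c p'"
  let ?W = "wt (n mod 2) 0 * p\<^sup>2" and ?W' = "wt (Suc n mod 2) 1 * p'\<^sup>2"
  have W: "coeff ?W n = 1" "degree ?W = n" "coeff ?W' n = -1" "degree ?W' = n"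
    using coeff_wt_square[OF level_lower, of p] coeff_wt_square[OF level_upper[OF n], of p'] p p'
    by (auto simp: lower_ortho_def upper_ortho_def Lc.ortho_def)
  have LW: "Lc (c(n := x)) ?W = x - (c n - ?A)" "Lc (c(n := x)) ?W' = (c n + ?B) - x" for x
    using Lc_upd[OF n, of c x] W by (simp_all add: lower_gap_def upper_gap_def)
  have l: "Lc.pos_upto (c(n := c n - ?A)) n"
  proof (rule endpoint_pos[OF n level_lower])
    show "Lc.ortho (c(n := c n - ?A)) (wt (n mod 2) 0) (n div 2) p"
      using p unfolding lower_ortho_def ortho_upd[OF level_lower] .
  qed (use n strict in \<open>auto simp: strict_upd LW simp del: One_nat_def\<close>)
  have u: "Lc.pos_upto (c(n := c n + ?B)) n"
  proof (rule endpoint_pos[OF n level_upper[OF n]])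
    show "Lc.ortho (c(n := c n + ?B)) (wt (Suc n mod 2) 1) ((n - 1) div 2) p'"
      using p' unfolding upper_ortho_def ortho_upd[OF level_upper[OF n]] .
  qed (use n strict in \<open>auto simp: strict_upd LW simp del: One_nat_def\<close>)
  show ?slice
  proof (intro set_eqI iffI)
    fix x assume "x \<in> slice n c"
    then have "0 \<le> Lc (c(n := x)) ?W" "0 \<le> Lc (c(n := x)) ?W'"
      using W nonneg01_wt_mult_square by (auto simp: Lc.pos_upto_def)
    then show "x \<in> {c n - ?A..c n + ?B}" by (simp add: LW del: One_nat_def)
  next
    fix x assume x: "x \<in> {c n - ?A..c n + ?B}"
    have "0 \<le> Lc (c(n := x)) f" if f: "degree f \<le> n" "nonneg01 f" for f
    proof -
      have 1: "0 \<le> Lc (c(n := c n - ?A)) f" "0 \<le> Lc (c(n := c n + ?B)) f"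
        using l u f by (auto simp: Lc.pos_upto_def)
      show ?thesis
      proof (cases "coeff f n \<ge> 0")
        case True
        then have "0 \<le> (x - (c n - ?A)) * coeff f n" using x by auto
        then show ?thesis using 1(1) by (simp add: Lc_upd[OF n] algebra_simps)
      next
        case False
        then have "0 \<le> (c n + ?B - x) * - coeff f n" using x by (intro mult_nonneg_nonneg) auto
        then show ?thesis using 1(2) by (simp add: Lc_upd[OF n] algebra_simps)
      qed
    qed
    then show "x \<in> slice n c" by (simp add: Lc.pos_upto_def)
  qed
  show ?pos
  proof -
    have "degree (?W + ?W') \<le> n" using W by (intro degree_add_le) auto
    moreover have "coeff (?W + ?W') n = 0" using W by simp
    ultimately have "degree (?W + ?W') \<noteq> n \<or> ?W + ?W' = 0" by (metis leading_coeff_0_iff)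
    with \<open>degree (?W + ?W') \<le> n\<close> have "degree (?W + ?W') \<le> n - 1" by auto
    moreover have "nonneg01 ?W" "nonneg01 ?W'" by (rule nonneg01_wt_mult_square)+
    then have "nonneg01 (?W + ?W')" by (auto simp: nonneg01_def)
    moreover have "?W + ?W' \<noteq> 0"
    proof
      assume 0: "?W + ?W' = 0"
      have "poly ?W x = 0" if "x \<in> {0..1}" for x
      proof -
        have "poly ?W x + poly ?W' x = 0" using arg_cong[OF 0, of "\<lambda>f. poly f x"] by simp
        moreover have "0 \<le> poly ?W x" "0 \<le> poly ?W' x"
          using nonneg01_wt_mult_square that by (simp_all only: nonneg01_def)
        ultimately show ?thesis by linarith
      qed
      then have "{0..1} \<subseteq> {x. poly ?W x = 0}" by blast
      moreover have "?W \<noteq> 0" using W by auto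
      ultimately have "finite {0..1::real}" using poly_roots_finite[of ?W] finite_subset by blast
      then show False using infinite_Icc[of 0 "1::real"] by simp
    qed
    ultimately have "0 < Lc c (?W + ?W')" using strict by (auto simp: Lc.strict_upto_def)
    then show ?thesis by (simp add: Lc.add lower_gap_def upper_gap_def)
  qed
  show "Lc.strict_upto (c(n := x)) n" if x: "x \<in> {c n - ?A <..< c n + ?B}"
    unfolding Lc.strict_upto_def
  proof (intro allI impI)
    fix f :: "real poly" assume f: "f \<noteq> 0" "degree f \<le> n" "nonneg01 f"
    have 1: "0 \<le> Lc (c(n := c n - ?A)) f" "0 \<le> Lc (c(n := c n + ?B)) f"
      using l u f by (auto simp: Lc.pos_upto_def)
    consider "coeff f n = 0" | "coeff f n > 0" | "coeff f n < 0" by linarith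
    then show "0 < Lc (c(n := x)) f"
    proof cases
      case 1
      then have "degree f < n" using f leading_coeff_0_iff[of f] by (cases "degree f = n") auto
      then have "degree f \<le> n - 1" by simp
      then have "0 < Lc c f" using f strict by (auto simp: Lc.strict_upto_def)
      then show ?thesis using 1 by (simp add: Lc_upd[OF n])
    next
      case 2
      then have "0 < (x - (c n - ?A)) * coeff f n" using x by auto
      then show ?thesis using 1(1) by (simp add: Lc_upd[OF n] algebra_simps)
    next
      case 3
      then have "0 < (c n + ?B - x) * - coeff f n" using x by (intro mult_pos_pos) auto
      then show ?thesis using 1(2) by (simp add: Lc_upd[OF n] algebra_simps)
    qed
  qed
qed

lemma next_gap:
  assumes n: "n \<ge> 1" and strict: "Lc.strict_upto c n"
    and p: "lower_ortho n c p" "upper_ortho n c p'" and q: "lower_ortho (Suc n) c q" "upper_ortho (Suc n) c q'"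
  shows "(lower_gap (Suc n) c q + upper_gap (Suc n) c q') * (lower_gap n c p + upper_gap n c p') =
    lower_gap n c p * upper_gap n c p'"
proof (cases "even n")
  case True
  then obtain k where k: "n = 2 * k" by auto
  have s: "Lc.strict_upto c (2 * k - 1)" using strict k by (auto simp: Lc.strict_upto_def)
  have k1: "k \<ge> 1" using n k by auto
  have d: "Suc n mod 2 = 1" "n mod 2 = 0" "n div 2 = k" "Suc n div 2 = k" "(n - 1) div 2 = k - 1" "(Suc n - 1) div 2 = k" "Suc (Suc n) mod 2 = 0"
    using k by presburger+
  show ?thesis
    using Lc.gap_identity_even[OF s k1, of p p' q q'] p q
    unfolding lower_ortho_def upper_ortho_def lower_gap_def upper_gap_def d by simp
next
  case False
  then obtain k where k: "n = 2 * k + 1" by (auto elim: oddE)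
  have s: "Lc.strict_upto c (2 * k)" using strict k by (auto simp: Lc.strict_upto_def)
  have d: "Suc n mod 2 = 0" "n mod 2 = 1" "n div 2 = k" "Suc n div 2 = Suc k" "(n - 1) div 2 = k" "(Suc n - 1) div 2 = k" "Suc (Suc n) mod 2 = 1"
    using k by presburger+
  show ?thesis
    using Lc.gap_identity_odd[OF s, of q q' p p'] p q
    unfolding lower_ortho_def upper_ortho_def lower_gap_def upper_gap_def d by simp
qed

text \<open>The length of the range of the next moment as a function of the position of the present one within
its own range \<open>[l, u]\<close>.\<close>

lemma slice_recursion:
  assumes n: "n \<ge> 1" and strict: "Lc.strict_upto c (n - 1)"
  obtains l u where "l < u" "slice n c = {l..u}"
    "\<And>x. x \<in> {l<..<u} \<Longrightarrow> Lc.strict_upto (c(n := x)) n \<and>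
       (\<exists>l'. slice (Suc n) (c(n := x)) = {l'..l' + (x - l) * (u - x) / (u - l)})"
proof -
  obtain p p' where p: "lower_ortho n c p" "upper_ortho n c p'"
    using ortho_both_exist[OF n strict] by blast
  define l u where "l = c n - lower_gap n c p" and "u = c n + upper_gap n c p'"
  note sl = slice_interval[OF n strict p, folded l_def u_def]
  have lu: "l < u" using sl(2) by (simp add: l_def u_def)
  have "Lc.strict_upto (c(n := x)) n \<and> (\<exists>l'. slice (Suc n) (c(n := x)) = {l'..l' + (x - l) * (u - x) / (u - l)})"
    if x: "x \<in> {l<..<u}" for x
  proof -
    let ?c = "c(n := x)"
    have s: "Lc.strict_upto ?c n" using sl(3) x by (simp add: l_def u_def)
    obtain q q' where q: "lower_ortho (Suc n) ?c q" "upper_ortho (Suc n) ?c q'"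
      using ortho_both_exist[of "Suc n" ?c] s by auto
    have p2: "lower_ortho n ?c p" "upper_ortho n ?c p'"
      using p unfolding lower_ortho_def upper_ortho_def
      unfolding ortho_upd[OF level_lower] ortho_upd[OF level_upper[OF n]] .
    have W: "coeff (wt (n mod 2) 0 * p\<^sup>2) n = 1" "coeff (wt (Suc n mod 2) 1 * p'\<^sup>2) n = -1"
      using coeff_wt_square(1)[OF level_lower, of p] coeff_wt_square(1)[OF level_upper[OF n], of p'] p
      by (auto simp: lower_ortho_def upper_ortho_def Lc.ortho_def)
    have g: "lower_gap n ?c p = x - l" "upper_gap n ?c p' = u - x"
      using W by (simp_all add: lower_gap_def upper_gap_def Lc_upd[OF n] l_def u_def)
    let ?S = "lower_gap (Suc n) ?c q + upper_gap (Suc n) ?c q'"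
    have "?S * (u - l) = (x - l) * (u - x)"
      using next_gap[OF n s p2 q] by (simp add: g)
    then have S: "?S = (x - l) * (u - x) / (u - l)" using lu by (simp add: field_simps)
    have "slice (Suc n) ?c = {?c (Suc n) - lower_gap (Suc n) ?c q .. ?c (Suc n) + upper_gap (Suc n) ?c q'}"
      using s by (intro slice_interval q) auto
    also have "?c (Suc n) + upper_gap (Suc n) ?c q' = (?c (Suc n) - lower_gap (Suc n) ?c q) + (x - l) * (u - x) / (u - l)"
      using S by simp
    finally show ?thesis using s by blast
  qed
  with lu sl(1) that show thesis by blast
qed

text \<open>If some nonnegative \<open>f \<noteq> 0\<close> is annihilated, then so are its multiples, and the next moment is
determined by the remainder of \<open>t ^ (n + 1)\<close> upon division by \<open>f\<close>.\<close>

lemma slice_degenerate: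
  assumes pos: "Lc.pos_upto c n" and "\<not> Lc.strict_upto c n"
  shows "\<exists>y. slice (Suc n) c \<subseteq> {y}"
proof -
  obtain f where f: "f \<noteq> 0" "degree f \<le> n" "nonneg01 f" "\<not> 0 < Lc c f"
    using assms(2) by (auto simp: Lc.strict_upto_def)
  then have f0: "Lc c f = 0" using pos by (force simp: Lc.pos_upto_def)
  define q r where "q = monom 1 (Suc n) div f" and "r = monom 1 (Suc n) mod f"
  have qr: "monom 1 (Suc n) = f * q + r" by (simp add: q_def r_def)
  have dr: "degree r < Suc n" using degree_mod_less[OF f(1), of "monom 1 (Suc n)"] f(2) by (auto simp: r_def)
  have dfq: "degree (f * q) \<le> Suc n"
  proof -
    have "f * q = monom 1 (Suc n) - r" using qr by simp
    then show ?thesis using dr by (auto intro!: degree_diff_le simp: degree_monom_eq)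
  qed
  have "x = Lc c r" if x: "x \<in> slice (Suc n) c" for x
  proof -
    let ?c = "c(Suc n := x)"
    have "Lc ?c (f * q) = 0"
      using x f f0 dfq by (intro Lc.null_multiple[of _ "Suc n"]) (auto simp: Lc_agree)
    then have "Lc ?c (monom 1 (Suc n)) = Lc ?c r" unfolding qr by (simp add: Lc.add)
    moreover have "Lc ?c (monom 1 (Suc n)) = x"
      by (simp add: Lc_def degree_monom_eq if_distrib[of "\<lambda>a. a * _"] cong: if_cong)
    ultimately show ?thesis using dr by (simp add: Lc_agree)
  qed
  then show ?thesis by blast
qed

lemma strict_upto_0: "Lc.strict_upto c 0"
  unfolding Lc.strict_upto_def
proof (intro allI impI)
  fix f :: "real poly" assume f: "f \<noteq> 0" "degree f \<le> 0" "nonneg01 f"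
  then obtain e where e: "f = [:e:]" by (auto elim: degree_eq_zeroE)
  with f show "0 < Lc c f" by (force simp: Lc_const nonneg01_def)
qed

text \<open>A nondegenerate functional is represented by the lower quadrature of the next level. For a degenerate
one, consider the first level at which it degenerates: there its moment is an end point of the slice, and the
annihilation of \<open>w p\<^sup>2\<close> propagates to all multiples up to degree \<open>n\<close>.\<close>

lemma representation:
  assumes pos: "Lc.pos_upto c n"
  obtains N v where "finite N" "N \<subseteq> {0..1}" "\<And>z. z \<in> N \<Longrightarrow> 0 \<le> v z"
    "\<And>f. degree f \<le> n \<Longrightarrow> Lc c f = (\<Sum>z\<in>N. v z * poly f z)"
proof (cases "Lc.strict_upto c n")
  case True
  obtain p where p: "lower_ortho (Suc n) c p"
    using ortho_both_exist[of "Suc n" c] True by auto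
  have "degree (wt (Suc n mod 2) 0 * p\<^sup>2) = Suc n" "p \<noteq> 0"
    using coeff_wt_square[OF level_lower, of p "Suc n"] p by (auto simp: lower_ortho_def Lc.ortho_def)
  then have van: "Lc c (wt (Suc n mod 2) 0 * p\<^sup>2 * q) = 0" if "degree (wt (Suc n mod 2) 0 * p\<^sup>2 * q) \<le> n" for q
    using that by (cases "q = 0") (auto simp: degree_mult_eq)
  obtain N v where "finite N" "N \<subseteq> {0..1}" "\<And>z. z \<in> N \<Longrightarrow> 0 \<le> v z"
    "\<And>f. degree f \<le> n \<Longrightarrow> Lc c f = (\<Sum>z\<in>N. v z * poly f z)"
  proof (rule Lc.quadrature[of c "Suc n", OF _ level_lower _ _ _ p[unfolded lower_ortho_def] _ van])
    show "Lc.strict_upto c (Suc n - 1)" using True by simp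
  qed auto
  then show thesis by (rule that)
next
  case False
  define j where "j = (LEAST j. \<not> Lc.strict_upto c j)"
  have j: "\<not> Lc.strict_upto c j" "j \<le> n" and least: "\<And>i. i < j \<Longrightarrow> Lc.strict_upto c i"
    unfolding j_def using LeastI[of "\<lambda>j. \<not> Lc.strict_upto c j", OF False]
      Least_le[of "\<lambda>j. \<not> Lc.strict_upto c j", OF False] not_less_Least[of _ "\<lambda>j. \<not> Lc.strict_upto c j"]
    by blast+
  have j1: "j \<ge> 1" using j(1) strict_upto_0[of c] by (cases j) auto
  then have s: "Lc.strict_upto c (j - 1)" by (intro least) auto
  obtain p p' where p: "lower_ortho j c p" "upper_ortho j c p'"
    using ortho_both_exist[OF j1 s] by blast
  have dW: "degree (wt (j mod 2) 0 * p\<^sup>2) = j" "degree (wt (Suc j mod 2) 1 * p'\<^sup>2) = j"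
    using coeff_wt_square(2)[OF level_lower, of p] coeff_wt_square(2)[OF level_upper[OF j1], of p'] p
    by (auto simp: lower_ortho_def upper_ortho_def Lc.ortho_def)
  have "0 \<le> lower_gap j c p" "0 \<le> upper_gap j c p'"
    using pos j(2) dW nonneg01_wt_mult_square by (auto simp: Lc.pos_upto_def lower_gap_def upper_gap_def)
  moreover have "\<not> (0 < lower_gap j c p \<and> 0 < upper_gap j c p')"
    using slice_interval(3)[OF j1 s p, of "c j"] j(1) by auto
  ultimately consider "lower_gap j c p = 0" | "upper_gap j c p' = 0" by linarith
  then show thesis
  proof cases
    case 1
    have van: "Lc c (wt (j mod 2) 0 * p\<^sup>2 * q) = 0" if "degree (wt (j mod 2) 0 * p\<^sup>2 * q) \<le> n" for q
      using 1 that Lc.null_multiple[OF pos nonneg01_wt_mult_square] unfolding lower_gap_def by blast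
    obtain N v where "finite N" "N \<subseteq> {0..1}" "\<And>z. z \<in> N \<Longrightarrow> 0 \<le> v z"
      "\<And>f. degree f \<le> n \<Longrightarrow> Lc c f = (\<Sum>z\<in>N. v z * poly f z)"
      by (rule Lc.quadrature[OF s level_lower _ _ j1 p(1)[unfolded lower_ortho_def] _ van]) (use j(2) in auto)
    then show thesis by (rule that)
  next
    case 2
    have van: "Lc c (wt (Suc j mod 2) 1 * p'\<^sup>2 * q) = 0" if "degree (wt (Suc j mod 2) 1 * p'\<^sup>2 * q) \<le> n" for q
      using 2 that Lc.null_multiple[OF pos nonneg01_wt_mult_square] unfolding upper_gap_def by blast
    obtain N v where "finite N" "N \<subseteq> {0..1}" "\<And>z. z \<in> N \<Longrightarrow> 0 \<le> v z"
      "\<And>f. degree f \<le> n \<Longrightarrow> Lc c f = (\<Sum>z\<in>N. v z * poly f z)"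
      by (rule Lc.quadrature[OF s level_upper[OF j1] _ _ j1 p(2)[unfolded upper_ortho_def] _ van]) (use j(2) in auto)
    then show thesis by (rule that)
  qed
qed

section \<open>The volume of the moment space\<close>

abbreviation R_pow :: "nat \<Rightarrow> (nat \<Rightarrow> real) measure" where
  "R_pow n \<equiv> PiM {1..n} (\<lambda>_. lborel)"

interpretation lborels: product_sigma_finite "\<lambda>_::nat. lborel :: real measure"
  by standard

definition pos_moments :: "nat \<Rightarrow> (nat \<Rightarrow> real) set" where
  "pos_moments n = {c \<in> space (R_pow n). Lc.pos_upto c n}"

text \<open>Moments of a measure are positive because integrals of nonnegative functions are nonnegative;
conversely, a positive functional is represented by a measure with finitely many atoms.\<close>

lemma moment_space_eq_pos_moments: "moment_space n = pos_moments n"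
proof (intro set_eqI iffI)
  fix c assume "c \<in> moment_space n"
  then obtain \<mu> where \<mu>: "prob_space \<mu>" "sets \<mu> = sets (restrict_space borel {0..1::real})"
    and c: "c = (\<lambda>i\<in>{1..n}. \<integral>t. t ^ i \<partial>\<mu>)" by (auto simp: moment_space_def)
  interpret prob_space \<mu> by fact
  have sp: "space \<mu> = {0..1}" using sets_eq_imp_space_eq[OF \<mu>(2)] by (simp add: space_restrict_space)
  have int: "integrable \<mu> (\<lambda>t. t ^ i)" for i :: nat
  proof (rule integrable_const_bound[of _ 1])
    have "(\<lambda>t. t ^ i) \<in> borel_measurable (restrict_space borel {0..1::real})"
      by (intro measurable_restrict_space1) simp
    then show "(\<lambda>t. t ^ i) \<in> borel_measurable \<mu>" using \<mu>(2) by (simp cong: measurable_cong_sets)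
    show "AE t in \<mu>. norm (t ^ i) \<le> 1" using sp by (intro AE_I2) (auto simp: power_le_one)
  qed
  have "Lc.pos_upto c n"
    unfolding Lc.pos_upto_def
  proof (intro allI impI)
    fix f :: "real poly" assume f: "degree f \<le> n" "nonneg01 f"
    have "Lc c f = (\<Sum>i\<le>degree f. \<integral>t. coeff f i * t ^ i \<partial>\<mu>)"
      unfolding Lc_def c using f(1) by (intro sum.cong) (auto simp: prob_space)
    also have "\<dots> = (\<integral>t. poly f t \<partial>\<mu>)"
      unfolding poly_altdef using int by (subst Bochner_Integration.integral_sum) auto
    also have "\<dots> \<ge> 0"
      using f(2) sp by (intro Bochner_Integration.integral_nonneg) (auto simp: nonneg01_def)
    finally show "0 \<le> Lc c f" .
  qed
  then show "c \<in> pos_moments n" by (auto simp: pos_moments_def space_PiM c)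
next
  fix c assume "c \<in> pos_moments n"
  then have ext: "c \<in> extensional {1..n}" and pos: "Lc.pos_upto c n"
    by (auto simp: pos_moments_def space_PiM PiE_def)
  obtain N v where N: "finite N" "N \<subseteq> {0..1}" "\<And>z. z \<in> N \<Longrightarrow> 0 \<le> v z"
    "\<And>f. degree f \<le> n \<Longrightarrow> Lc c f = (\<Sum>z\<in>N. v z * poly f z)"
    using representation[OF pos] by blast
  have sum1: "(\<Sum>z\<in>N. v z) = 1" using N(4)[of 1] by simp
  let ?P = "point_measure N (\<lambda>z. ennreal (v z))" and ?B = "restrict_space borel {0..1::real}"
  have meas: "(\<lambda>x. x) \<in> measurable ?P ?B" using N(2) by (auto simp: space_restrict_space)
  have "prob_space ?P"
    by standard (simp add: space_point_measure emeasure_point_measure_finite N(1,3) sum1 sum_ennreal)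
  then have "prob_space (distr ?P ?B (\<lambda>x. x))" using meas by (intro prob_space.prob_space_distr)
  moreover have "c = (\<lambda>i\<in>{1..n}. \<integral>t. t ^ i \<partial>distr ?P ?B (\<lambda>x. x))"
  proof (rule extensionalityI[OF ext])
    fix i assume i: "i \<in> {1..n}"
    have "(\<integral>t. t ^ i \<partial>distr ?P ?B (\<lambda>x. x)) = (\<integral>t. t ^ i \<partial>?P)"
      using meas by (intro integral_distr) (auto intro: measurable_restrict_space1)
    also have "\<dots> = (\<Sum>z\<in>N. v z * poly (monom 1 i) z)"
      using N(1,3) by (simp add: lebesgue_integral_point_measure_finite poly_monom)
    also have "\<dots> = Lc c (monom 1 i)" using i by (intro N(4)[symmetric]) (simp add: degree_monom_eq)
    also have "\<dots> = c i"
      using i by (simp add: Lc_def degree_monom_eq if_distrib[of "\<lambda>a. a * _"] cong: if_cong)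
    finally show "c i = (\<lambda>i\<in>{1..n}. \<integral>t. t ^ i \<partial>distr ?P ?B (\<lambda>x. x)) i" using i by simp
  qed auto
  moreover have "sets (distr ?P ?B (\<lambda>x. x)) = sets ?B" by simp
  ultimately show "c \<in> moment_space n" unfolding moment_space_def by blast
qed

lemma Lc_measurable: "degree p \<le> n \<Longrightarrow> (\<lambda>c. Lc c p) \<in> borel_measurable (R_pow n)"
  unfolding Lc_def
proof (intro borel_measurable_sum borel_measurable_times borel_measurable_const)
  fix i assume "degree p \<le> n" "i \<in> {..degree p}"
  then show "(\<lambda>c. if i = 0 then 1 else c i) \<in> borel_measurable (R_pow n)"
    using measurable_component_singleton[of i "{1..n}" "\<lambda>_. lborel :: real measure"] by (cases "i = 0") auto
qed

text \<open>Raising all coefficients slightly keeps a polynomial nonnegative on \<open>[0, 1]\<close>, where all monomials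
are nonnegative. Therefore countably many inequalities suffice, which makes the moment space measurable.\<close>

lemma pos_upto_rational:
  "Lc.pos_upto c n \<longleftrightarrow>
    (\<forall>xs :: rat list. length xs \<le> Suc n \<longrightarrow> nonneg01 (Poly (map of_rat xs)) \<longrightarrow> 0 \<le> Lc c (Poly (map of_rat xs)))"
proof (intro iffI allI impI)
  fix xs :: "rat list"
  assume "Lc.pos_upto c n" "length xs \<le> Suc n" "nonneg01 (Poly (map of_rat xs))"
  moreover have "degree (Poly (map real_of_rat xs)) \<le> n"
    using \<open>length xs \<le> Suc n\<close> by (intro degree_le) (auto simp: coeff_Poly_eq nth_default_def)
  ultimately show "0 \<le> Lc c (Poly (map of_rat xs))" by (auto simp: Lc.pos_upto_def)
next
  assume R: "\<forall>xs :: rat list. length xs \<le> Suc n \<longrightarrow> nonneg01 (Poly (map of_rat xs)) \<longrightarrow> 0 \<le> Lc c (Poly (map of_rat xs))"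
  show "Lc.pos_upto c n"
    unfolding Lc.pos_upto_def
  proof (intro allI impI)
    fix f :: "real poly" assume f: "degree f \<le> n" "nonneg01 f"
    \<comment> \<open>the summand one keeps the bound positive and leaves a strict margin at the end\<close>
    define C where "C = (\<Sum>i\<le>n. \<bar>if i = 0 then 1 else c i\<bar>) + 1"
    have C: "C > 0" unfolding C_def by (intro add_nonneg_pos sum_nonneg) auto
    show "0 \<le> Lc c f"
    proof (rule ccontr)
      assume "\<not> 0 \<le> Lc c f"
      define e where "e = - Lc c f / C"
      have e: "e > 0" using \<open>\<not> 0 \<le> Lc c f\<close> C unfolding e_def by (intro divide_pos_pos) auto
      have "\<exists>r. coeff f i < of_rat r \<and> of_rat r < coeff f i + e" for i
        using of_rat_dense[of "coeff f i" "coeff f i + e"] e by auto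
      then obtain r where r: "\<And>i. coeff f i < of_rat (r i)" "\<And>i. of_rat (r i) < coeff f i + e" by metis
      define xs where "xs = map r [0..<Suc n]"
      define g where "g = Poly (map real_of_rat xs)"
      have cg: "coeff g i = (if i \<le> n then of_rat (r i) else 0)" for i
        by (auto simp: g_def xs_def coeff_Poly_eq nth_default_def simp del: upt_Suc)
      have dg: "degree g \<le> n" by (intro degree_le) (auto simp: cg)
      have "nonneg01 g"
        unfolding nonneg01_def
      proof
        fix x :: real assume x: "x \<in> {0..1}"
        have "poly f x = (\<Sum>i\<le>n. coeff f i * x ^ i)"
          unfolding poly_altdef using f(1) by (intro sum.mono_neutral_left) (auto simp: coeff_eq_0)
        also have "\<dots> \<le> (\<Sum>i\<le>n. coeff g i * x ^ i)"
          using x r(1) by (intro sum_mono mult_right_mono) (auto simp: cg less_imp_le)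
        also have "\<dots> = poly g x"
          unfolding poly_altdef using dg by (intro sum.mono_neutral_right) (auto simp: coeff_eq_0)
        finally have "poly f x \<le> poly g x" .
        moreover have "0 \<le> poly f x" using f(2) x unfolding nonneg01_def by blast
        ultimately show "0 \<le> poly g x" by linarith
      qed
      moreover have "length xs \<le> Suc n" by (simp add: xs_def)
      ultimately have "0 \<le> Lc c g" using R by (auto simp: g_def)
      also have "Lc c g = Lc c f + (\<Sum>i\<le>n. (coeff g i - coeff f i) * (if i = 0 then 1 else c i))"
        by (simp only: Lc_sum[OF dg] Lc_sum[OF f(1)] left_diff_distrib sum_subtractf)
      also have "\<dots> \<le> Lc c f + (\<Sum>i\<le>n. e * \<bar>if i = 0 then 1 else c i\<bar>)"
      proof (intro add_left_mono sum_mono)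
        fix i assume "i \<in> {..n}"
        then have d: "0 \<le> coeff g i - coeff f i" "coeff g i - coeff f i \<le> e"
          using r(1,2)[of i] by (auto simp: cg)
        have "(coeff g i - coeff f i) * (if i = 0 then 1 else c i) \<le> (coeff g i - coeff f i) * \<bar>if i = 0 then 1 else c i\<bar>"
          using d by (intro mult_left_mono) auto
        also have "\<dots> \<le> e * \<bar>if i = 0 then 1 else c i\<bar>" using d by (intro mult_right_mono) auto
        finally show "(coeff g i - coeff f i) * (if i = 0 then 1 else c i) \<le> e * \<bar>if i = 0 then 1 else c i\<bar>" .
      qed
      also have "\<dots> = Lc c f + e * (C - 1)" by (simp add: C_def sum_distrib_left)
      also have "\<dots> = - e" using C by (simp add: e_def field_simps)
      finally show False using e by simp
    qed
  qed
qed

lemma pos_moments_measurable [measurable]: "pos_moments n \<in> sets (R_pow n)"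
proof -
  let ?S = "{xs :: rat list. length xs \<le> Suc n \<and> nonneg01 (Poly (map of_rat xs))}"
  have "{c \<in> space (R_pow n). xs \<in> ?S \<longrightarrow> 0 \<le> Lc c (Poly (map of_rat xs))} \<in> sets (R_pow n)" for xs
  proof (cases "xs \<in> ?S")
    case True
    then have "degree (Poly (map real_of_rat xs)) \<le> n"
      by (intro degree_le) (auto simp: coeff_Poly_eq nth_default_def)
    then have "{c \<in> space (R_pow n). 0 \<le> Lc c (Poly (map of_rat xs))} \<in> sets (R_pow n)"
      by (intro borel_measurable_le borel_measurable_const Lc_measurable)
    moreover have "{c \<in> space (R_pow n). xs \<in> ?S \<longrightarrow> 0 \<le> Lc c (Poly (map of_rat xs))} =
      {c \<in> space (R_pow n). 0 \<le> Lc c (Poly (map of_rat xs))}"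
      using True by blast
    ultimately show ?thesis by (simp only:)
  next
    case False
    then have "{c \<in> space (R_pow n). xs \<in> ?S \<longrightarrow> 0 \<le> Lc c (Poly (map of_rat xs))} = space (R_pow n)"
      by blast
    then show ?thesis by (simp only: sets.top)
  qed
  then have "{c \<in> space (R_pow n). \<forall>xs. xs \<in> ?S \<longrightarrow> 0 \<le> Lc c (Poly (map of_rat xs))} \<in> sets (R_pow n)"
    by (rule sets.sets_Collect_countable_All)
  moreover have "pos_moments n = {c \<in> space (R_pow n). \<forall>xs. xs \<in> ?S \<longrightarrow> 0 \<le> Lc c (Poly (map of_rat xs))}"
    unfolding pos_moments_def pos_upto_rational by blast
  ultimately show ?thesis by (simp only:)
qed

text \<open>The length of the slice, defined as an integral of the indicator function so that Fubini's theorem yields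
its measurability.\<close>

definition slice_length :: "nat \<Rightarrow> (nat \<Rightarrow> real) \<Rightarrow> ennreal" where
  "slice_length n c = (\<integral>\<^sup>+x. indicator (pos_moments (Suc n)) (c(Suc n := x)) \<partial>lborel)"

lemma insert_Suc_atLeastAtMost: "insert (Suc n) {1..n} = {1..Suc n}" by auto

lemma extend_measurable: "(\<lambda>(c, x). c(Suc n := x)) \<in> measurable (R_pow n \<Otimes>\<^sub>M lborel) (R_pow (Suc n))"
  using measurable_add_dim[of "Suc n" "{1..n}" "\<lambda>_. lborel :: real measure"]
  unfolding insert_Suc_atLeastAtMost .

lemma slice_length_measurable: "slice_length n \<in> borel_measurable (R_pow n)"
proof -
  have "(\<lambda>(c, x). indicator (pos_moments (Suc n)) (c(Suc n := x)) :: ennreal) \<in> borel_measurable (R_pow n \<Otimes>\<^sub>M lborel)"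
    using measurable_compose[OF extend_measurable borel_measurable_indicator[OF pos_moments_measurable]]
    by (simp add: split_beta')
  then show ?thesis unfolding slice_length_def[abs_def] by (rule lborel.borel_measurable_nn_integral)
qed

lemma slice_length_power_measurable:
  "(\<lambda>c. indicator (pos_moments n) c * slice_length n c ^ k) \<in> borel_measurable (R_pow n)"
proof -
  note [measurable] = slice_length_measurable[of n]
  show ?thesis by measurable
qed

lemma extend_in_pos_moments:
  assumes "c \<in> space (R_pow n)"
  shows "c(Suc n := x) \<in> pos_moments (Suc n) \<longleftrightarrow> x \<in> slice (Suc n) c"
proof -
  have "c(Suc n := x) \<in> space (R_pow (Suc n))"
    using assms unfolding space_PiM insert_Suc_atLeastAtMost[symmetric] by (intro PiE_fun_upd) auto
  then show ?thesis by (simp add: pos_moments_def)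
qed

lemma slice_length_eq: "c \<in> space (R_pow n) \<Longrightarrow> slice_length n c = (\<integral>\<^sup>+x. indicator (slice (Suc n) c) x \<partial>lborel)"
  unfolding slice_length_def by (intro nn_integral_cong) (auto simp: extend_in_pos_moments split: split_indicator)

lemma slice_length_interval:
  assumes "c \<in> space (R_pow n)" "slice (Suc n) c = {l..u}" "l \<le> u"
  shows "slice_length n c = ennreal (u - l)"
  using assms by (simp add: slice_length_eq)

lemma beta_integral: "(\<integral>\<^sup>+x. ennreal ((x * (1 - x)) ^ k) * indicator {0..1} x \<partial>lborel) = ennreal (beta_diag k)"
proof (rule nn_integral_has_integral_lebesgue')
  have "Beta (real (Suc k)) (real (Suc k)) = beta_diag k"
    using Gamma_fact[of k, where 'a = real] Gamma_fact[of "2 * k + 1", where 'a = real]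
    by (simp add: Beta_def beta_diag_def power2_eq_square algebra_simps)
  then have "((\<lambda>t. t powr (real (Suc k) - 1) * (1 - t) powr (real (Suc k) - 1)) has_integral beta_diag k) {0<..<1}"
    using has_integral_Beta_real[of "real (Suc k)" "real (Suc k)"] by (simp add: has_integral_Icc_iff_Ioo)
  moreover have "t powr (real (Suc k) - 1) * (1 - t) powr (real (Suc k) - 1) = (t * (1 - t)) ^ k" if "t \<in> {0<..<1}" for t
    using that by (simp add: powr_realpow power_mult_distrib)
  ultimately have "((\<lambda>t. (t * (1 - t)) ^ k) has_integral beta_diag k) {0<..<1}"
    by (metis (no_types, lifting) has_integral_eq)
  then show "((\<lambda>t. (t * (1 - t)) ^ k) has_integral beta_diag k) {0..1}"
    by (simp add: has_integral_Icc_iff_Ioo)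
qed auto

lemma beta_integral_interval:
  assumes "l < u"
  shows "(\<integral>\<^sup>+x. ennreal (((x - l) * (u - x) / (u - l)) ^ k) * indicator {l..u} x \<partial>lborel) =
    ennreal (beta_diag k * (u - l) ^ Suc k)"
proof -
  let ?d = "u - l"
  have "(\<integral>\<^sup>+x. ennreal (((x - l) * (u - x) / ?d) ^ k) * indicator {l..u} x \<partial>lborel) =
    ?d * (\<integral>\<^sup>+y. ennreal (((l + ?d * y - l) * (u - (l + ?d * y)) / ?d) ^ k) * indicator {l..u} (l + ?d * y) \<partial>lborel)"
    using assms by (subst nn_integral_real_affine[where c = ?d and t = l]) auto
  also have "(\<integral>\<^sup>+y. ennreal (((l + ?d * y - l) * (u - (l + ?d * y)) / ?d) ^ k) * indicator {l..u} (l + ?d * y) \<partial>lborel) =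
     (\<integral>\<^sup>+y. ennreal (?d ^ k) * (ennreal ((y * (1 - y)) ^ k) * indicator {0..1} y) \<partial>lborel)"
  proof (rule nn_integral_cong)
    fix y :: real
    have "(l + ?d * y - l) * (u - (l + ?d * y)) / ?d = ?d * (y * (1 - y))"
      using assms by (simp add: field_simps)
    moreover have "l + ?d * y \<in> {l..u} \<longleftrightarrow> y \<in> {0..1}"
    proof -
      have "l \<le> l + ?d * y \<longleftrightarrow> 0 \<le> y" using assms by (simp add: zero_le_mult_iff)
      moreover have "l + ?d * y \<le> u \<longleftrightarrow> ?d * y \<le> ?d * 1" by auto
      then have "l + ?d * y \<le> u \<longleftrightarrow> y \<le> 1" using assms by (simp only: mult_le_cancel_left_pos)
      ultimately show ?thesis by simp
    qed
    ultimately show "ennreal (((l + ?d * y - l) * (u - (l + ?d * y)) / ?d) ^ k) * indicator {l..u} (l + ?d * y) =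
       ennreal (?d ^ k) * (ennreal ((y * (1 - y)) ^ k) * indicator {0..1} y)"
      using assms by (auto simp: power_mult_distrib ennreal_mult mult_ac split: split_indicator)
  qed
  also have "\<dots> = ennreal (?d ^ k) * ennreal (beta_diag k)"
    by (subst nn_integral_cmult) (auto simp: beta_integral)
  also have "ennreal ?d * (ennreal (?d ^ k) * ennreal (beta_diag k)) = ennreal (beta_diag k * ?d ^ Suc k)"
    using assms by (simp add: beta_diag_def mult_ac flip: ennreal_mult)
  finally show ?thesis .
qed

text \<open>The induction step of the volume computation over one fibre. For degenerate \<open>c\<close> both sides
vanish, because the slice is at most a point.\<close>

lemma slice_length_power_integral:
  assumes c: "c \<in> space (R_pow n)"
  shows "(\<integral>\<^sup>+x. indicator (pos_moments (Suc n)) (c(Suc n := x)) * slice_length (Suc n) (c(Suc n := x)) ^ k \<partial>lborel) =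
    ennreal (beta_diag k) * (indicator (pos_moments n) c * slice_length n c ^ Suc k)"
proof -
  consider "\<not> Lc.pos_upto c n" | "Lc.pos_upto c n" "\<not> Lc.strict_upto c n" | "Lc.strict_upto c n" by blast
  then show ?thesis
  proof cases
    case 1
    have "x \<notin> slice (Suc n) c" for x
    proof
      assume "x \<in> slice (Suc n) c"
      then have "Lc.pos_upto (c(Suc n := x)) n" by (simp add: Lc.pos_upto_def)
      then show False using 1 pos_upd[of n "Suc n" c x] by simp
    qed
    then have "\<not> c(Suc n := x) \<in> pos_moments (Suc n)" for x using extend_in_pos_moments[OF c] by blast
    moreover have "c \<notin> pos_moments n" using 1 by (auto simp: pos_moments_def)
    ultimately show ?thesis by simp
  next
    case 2
    then obtain y where y: "slice (Suc n) c \<subseteq> {y}" using slice_degenerate by blast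
    have "slice_length n c \<le> (\<integral>\<^sup>+x. indicator {y} x \<partial>lborel)"
      unfolding slice_length_eq[OF c] using y by (intro nn_integral_mono) (auto split: split_indicator)
    then have "slice_length n c = 0" by simp
    moreover have "(\<integral>\<^sup>+x. indicator (pos_moments (Suc n)) (c(Suc n := x)) * slice_length (Suc n) (c(Suc n := x)) ^ k \<partial>lborel) =
       (\<integral>\<^sup>+x. 0 \<partial>(lborel :: real measure))"
    proof (rule nn_integral_cong_AE)
      show "AE x in lborel. indicator (pos_moments (Suc n)) (c(Suc n := x)) * slice_length (Suc n) (c(Suc n := x)) ^ k = 0"
        using AE_lborel_singleton[of y]
      proof eventually_elim
        case (elim x)
        then have "c(Suc n := x) \<notin> pos_moments (Suc n)" using y extend_in_pos_moments[OF c, of x] by blast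
        then show ?case by simp
      qed
    qed
    ultimately show ?thesis by simp
  next
    case 3
    then have s: "Lc.strict_upto c (Suc n - 1)" by simp
    obtain l u where lu: "l < u" "slice (Suc n) c = {l..u}"
      and next_slice: "\<And>x. x \<in> {l<..<u} \<Longrightarrow> Lc.strict_upto (c(Suc n := x)) (Suc n) \<and>
       (\<exists>l'. slice (Suc (Suc n)) (c(Suc n := x)) = {l'..l' + (x - l) * (u - x) / (u - l)})"
      using slice_recursion[OF _ s] by (metis One_nat_def Suc_leI zero_less_Suc)
    have "c \<in> pos_moments n" using c Lc.strict_imp_pos[OF 3] by (simp add: pos_moments_def)
    moreover have "slice_length n c = ennreal (u - l)" using slice_length_interval[OF c lu(2)] lu(1) by simp
    moreover have "(\<integral>\<^sup>+x. indicator (pos_moments (Suc n)) (c(Suc n := x)) * slice_length (Suc n) (c(Suc n := x)) ^ k \<partial>lborel) =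
      (\<integral>\<^sup>+x. ennreal (((x - l) * (u - x) / (u - l)) ^ k) * indicator {l..u} x \<partial>lborel)"
    proof (rule nn_integral_cong_AE)
      show "AE x in lborel. indicator (pos_moments (Suc n)) (c(Suc n := x)) * slice_length (Suc n) (c(Suc n := x)) ^ k =
          ennreal (((x - l) * (u - x) / (u - l)) ^ k) * indicator {l..u} x"
        using AE_lborel_singleton[of l] AE_lborel_singleton[of u]
      proof eventually_elim
        case (elim x)
        show ?case
        proof (cases "x \<in> {l..u}")
          case True
          then have x: "x \<in> {l<..<u}" using elim by auto
          then obtain l' where l': "slice (Suc (Suc n)) (c(Suc n := x)) = {l'..l' + (x - l) * (u - x) / (u - l)}"
            using next_slice by blast
          have nn: "0 \<le> (x - l) * (u - x) / (u - l)" using x by auto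
          have in_cone: "c(Suc n := x) \<in> pos_moments (Suc n)"
            using True lu(2) extend_in_pos_moments[OF c, of x] by blast
          then have "c(Suc n := x) \<in> space (R_pow (Suc n))" by (simp add: pos_moments_def)
          from slice_length_interval[OF this l'] nn
          have "slice_length (Suc n) (c(Suc n := x)) = ennreal ((x - l) * (u - x) / (u - l))" by simp
          then show ?thesis using True in_cone nn by (simp add: ennreal_power)
        next
          case False
          then have "c(Suc n := x) \<notin> pos_moments (Suc n)" using lu(2) extend_in_pos_moments[OF c, of x] by blast
          then show ?thesis using False by simp
        qed
      qed
    qed
    ultimately show ?thesis
      using lu(1) by (simp add: beta_integral_interval ennreal_power beta_diag_def flip: ennreal_mult)
  qed
qed

text \<open>Each step down in dimension raises the exponent of the length by one and splits off a Beta value.\<close>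

lemma slice_length_moments:
  "(\<integral>\<^sup>+c. indicator (pos_moments n) c * slice_length n c ^ k \<partial>R_pow n) = ennreal (\<Prod>j<n. beta_diag (k + j))"
proof (induction n arbitrary: k)
  case 0
  have sp: "(\<lambda>_. undefined) \<in> space (R_pow 0)" by (simp add: space_PiM)
  have slice: "slice (Suc 0) (\<lambda>_. undefined) = {0..1}"
  proof -
    have L: "Lc ((\<lambda>_. undefined)(Suc 0 := x)) f = (1 - x) * poly f 0 + x * poly f 1" if "degree f \<le> Suc 0" for f x
    proof -
      have "poly f 1 = coeff f 0 + coeff f (Suc 0)"
        unfolding poly_altdef using that by (cases "degree f") (auto simp: coeff_eq_0)
      then show ?thesis using that by (simp add: Lc_sum[of f "Suc 0"] poly_0_coeff_0 algebra_simps)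
    qed
    show ?thesis
    proof (intro set_eqI iffI)
      fix x assume x: "x \<in> slice (Suc 0) (\<lambda>_. undefined)"
      have "nonneg01 [:0, 1:]" "nonneg01 [:1, -1:]" by (auto simp: nonneg01_def)
      then have "0 \<le> Lc ((\<lambda>_. undefined)(Suc 0 := x)) [:0, 1:]" "0 \<le> Lc ((\<lambda>_. undefined)(Suc 0 := x)) [:1, -1:]"
        using x by (auto simp: Lc.pos_upto_def)
      then show "x \<in> {0..1}" by (simp add: L)
    next
      fix x :: real assume "x \<in> {0..1}"
      then show "x \<in> slice (Suc 0) (\<lambda>_. undefined)"
        by (auto simp: Lc.pos_upto_def L nonneg01_def)
    qed
  qed
  have len1: "slice_length 0 (\<lambda>_. undefined) = 1" using slice_length_interval[OF sp slice] by simp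
  have "(\<lambda>_. undefined) \<in> pos_moments 0"
    using Lc.strict_imp_pos[OF strict_upto_0] sp by (simp add: pos_moments_def)
  then show ?case
    using lborels.nn_integral_empty[of "\<lambda>c. indicator (pos_moments 0) c * slice_length 0 c ^ k"] len1 by simp
next
  case (Suc n)
  have "(\<integral>\<^sup>+c. indicator (pos_moments (Suc n)) c * slice_length (Suc n) c ^ k \<partial>R_pow (Suc n)) =
    (\<integral>\<^sup>+c. (\<integral>\<^sup>+x. indicator (pos_moments (Suc n)) (c(Suc n := x)) * slice_length (Suc n) (c(Suc n := x)) ^ k \<partial>lborel) \<partial>R_pow n)"
    using lborels.product_nn_integral_insert[of "{1..n}" "Suc n", unfolded insert_Suc_atLeastAtMost,
      OF _ _ slice_length_power_measurable] by simp
  also have "\<dots> = (\<integral>\<^sup>+c. ennreal (beta_diag k) * (indicator (pos_moments n) c * slice_length n c ^ Suc k) \<partial>R_pow n)"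
    by (intro nn_integral_cong slice_length_power_integral)
  also have "\<dots> = ennreal (beta_diag k) * ennreal (\<Prod>j<n. beta_diag (Suc k + j))"
    by (simp only: nn_integral_cmult[OF slice_length_power_measurable] Suc.IH)
  also have "\<dots> = ennreal (\<Prod>j<Suc n. beta_diag (k + j))"
    by (subst prod.lessThan_Suc_shift) (simp add: beta_diag_def prod_nonneg flip: ennreal_mult)
  finally show ?case .
qed

theorem Vol_moment_space: "Vol n (moment_space n) = (\<Prod>j<n. beta_diag j)"
proof -
  have "emeasure (R_pow n) (pos_moments n) = ennreal (\<Prod>j<n. beta_diag j)"
    using slice_length_moments[of n 0] by (simp del: One_nat_def)
  then show ?thesis
    by (simp del: One_nat_def add: Vol_def moment_space_eq_pos_moments Sigma_Algebra.measure_def prod_nonneg beta_diag_def)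
qed

section \<open>Biorthogonality\<close>

interpretation poly_vs: vector_space "smult :: real \<Rightarrow> real poly \<Rightarrow> real poly"
  by standard (simp_all add: smult_add_right smult_add_left)

text \<open>Vanishing on an interval forces a polynomial to be zero.\<close>

lemma poly_basis_independent:
  assumes p: "is_poly_basis J p V" and J: "finite J"
    and zero: "\<And>x. x \<in> {0<..<1} \<Longrightarrow> (\<Sum>j\<in>J. c j * poly (p j) x) = 0" and j: "j \<in> J"
  shows "c j = 0"
proof -
  have inj: "inj_on p J" and ind: "\<not> poly_vs.dependent (p ` J)"
    using p by (auto simp: is_poly_basis_def)
  have "(\<Sum>j\<in>J. smult (c j) (p j)) = 0"
  proof (rule ccontr)
    assume "(\<Sum>j\<in>J. smult (c j) (p j)) \<noteq> 0"
    then have "finite {x. poly (\<Sum>j\<in>J. smult (c j) (p j)) x = 0}" by (rule poly_roots_finite)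
    moreover have "{0<..<1} \<subseteq> {x. poly (\<Sum>j\<in>J. smult (c j) (p j)) x = 0}"
      using zero by (auto simp: poly_sum)
    ultimately have "finite {0<..<1::real}" by (rule finite_subset[rotated])
    then show False using infinite_Ioo[of 0 "1::real"] by simp
  qed
  moreover have "(\<Sum>j\<in>J. smult (c j) (p j)) = (\<Sum>v\<in>p ` J. smult (c (the_inv_into J p v)) v)"
    using inj by (simp add: sum.reindex the_inv_into_f_f)
  ultimately have "(\<Sum>v\<in>p ` J. smult (c (the_inv_into J p v)) v) = 0" by simp
  then have "c (the_inv_into J p (p j)) = 0"
    using ind J j by (auto simp: poly_vs.dependent_finite)
  then show ?thesis using inj j by (simp add: the_inv_into_f_f)
qed

lemma poly_basis_expansion:
  assumes p: "is_poly_basis J p V" and J: "finite J" and q: "q \<in> V"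
  obtains b where "q = (\<Sum>j\<in>J. smult (b j) (p j))"
proof -
  have "q \<in> poly_vs.span (p ` J)" using p q by (auto simp: is_poly_basis_def)
  then obtain u where "q = (\<Sum>v\<in>p ` J. smult (u v) v)"
    using J by (auto simp: poly_vs.span_finite)
  also have "\<dots> = (\<Sum>j\<in>J. smult (u (p j)) (p j))"
    using p by (simp add: sum.reindex is_poly_basis_def)
  finally show thesis by (rule that)
qed

text \<open>Lagrange interpolation at \<open>n + 1\<close> points that include \<open>0\<close> and \<open>1\<close>: the two basis polynomials that
do not vanish there are multiplied by zero.\<close>

lemma Pi0_lagrange:
  assumes n: "n \<ge> 1"
  obtains Y :: "real set" and l where "finite Y" "\<And>e. e \<in> Y \<Longrightarrow> l e \<in> Pi0 n"
    "\<And>f. f \<in> Pi0 n \<Longrightarrow> f = (\<Sum>e\<in>Y. smult (poly f e) (l e))"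
proof -
  \<comment> \<open>any choice of distinct points containing both end points would do\<close>
  define X where "X = (\<lambda>k. real k / real n) ` {0..n}"
  have fin: "finite X" by (simp add: X_def)
  have "inj_on (\<lambda>k. real k / real n) {0..n}" using n by (auto simp: inj_on_def)
  then have card: "card X = Suc n" by (simp add: X_def card_image)
  have "0 \<in> X" unfolding X_def by (rule image_eqI[of _ _ 0]) auto
  moreover have "1 \<in> X" unfolding X_def using n by (intro image_eqI[of _ _ n]) auto
  ultimately have X01: "{0, 1} \<subseteq> X" by simp
  define l where "l e = smult (1 / poly (node_poly (X - {e}) {}) e) (node_poly (X - {e}) {})" for e
  show thesis
  proof (rule that[of "X - {0, 1}" l])
    show "finite (X - {0, 1})" using fin by simp
    show "l e \<in> Pi0 n" if "e \<in> X - {0, 1}" for e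
    proof -
      have "degree (node_poly (X - {e}) {}) = n"
        using that fin card by (simp add: degree_node_poly)
      then have "degree (l e) \<le> n" unfolding l_def by (metis degree_smult_le)
      moreover have "poly (l e) 0 = 0" "poly (l e) 1 = 0"
        using that X01 fin by (auto simp: l_def poly_node_poly)
      ultimately show ?thesis by (simp add: Pi0_def)
    qed
    show "f = (\<Sum>e\<in>X - {0, 1}. smult (poly f e) (l e))" if f: "f \<in> Pi0 n" for f
    proof -
      have "f = (\<Sum>e\<in>X. smult (poly f e) (l e))"
        using partial_fractions[of X "{}" f] fin f card by (simp add: l_def Pi0_def)
      also have "\<dots> = (\<Sum>e\<in>X - {0, 1}. smult (poly f e) (l e))"
        using fin f by (intro sum.mono_neutral_right) (auto simp: Pi0_def)
      finally show ?thesis .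
    qed
  qed
qed

text \<open>At \<open>x = 0\<close> and at \<open>x = 1\<close> one of the two subtracted products vanishes and the other equals the
constant term.\<close>

lemma H_kernel_polynomial:
  assumes m: "m \<ge> 2"
  shows "\<exists>q\<in>Pi0 (2 * m - 1). \<forall>x. H_kernel m x t = poly q x"
proof -
  let ?J = "{1..m-1}"
  define A B where "A = (\<Prod>j\<in>?J. (t j)\<^sup>2)" and "B = (\<Prod>j\<in>?J. (1 - t j)\<^sup>2)"
  define r where "r = (\<Prod>j\<in>?J. [:t j, -1:]\<^sup>2)"
  define D where "D = Delta (m-1) t ^ 4"
  define q where "q = [:A * B * D:] - smult (A * D) ([:0, 1:] * r) - smult (B * D) ([:1, -1:] * r)"
  have "degree r \<le> (\<Sum>j\<in>?J. degree ([:t j, -1:]\<^sup>2))"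
    unfolding r_def using degree_prod_sum_le[of ?J "\<lambda>j. [:t j, -1:]\<^sup>2"] by (simp add: o_def)
  also have "\<dots> = 2 * (m - 1)" by (simp add: degree_power_eq)
  finally have r: "degree r \<le> 2 * m - 2" by simp
  have lin: "degree (s * r) \<le> 2 * m - 1" if "degree s \<le> 1" for s :: "real poly"
    using degree_mult_le[of s r] r that m by linarith
  have "degree q \<le> 2 * m - 1"
    unfolding q_def by (intro degree_diff_le order.trans[OF degree_smult_le] lin) auto
  moreover have pr: "poly r x = (\<Prod>j\<in>?J. (t j - x)\<^sup>2)" for x by (simp add: r_def poly_prod)
  have J: "J_ou m 0 t = A * B * D" "J_ol m x t = x * poly r x * A * D" "J_ou m x t = (1 - x) * poly r x * B * D" for x
    by (simp_all add: J_ou_def J_ol_def A_def B_def D_def pr del: One_nat_def)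
  have "poly r 0 = A" "poly r 1 = B" by (auto simp: pr A_def B_def power2_commute simp del: One_nat_def)
  then have "poly q 0 = 0" "poly q 1 = 0" and "H_kernel m x t = poly q x" for x
    by (simp_all add: H_kernel_def J q_def algebra_simps)
  ultimately show ?thesis by (auto simp: Pi0_def)
qed

text \<open>The scaling makes the constant equal to one, since the Selberg integral in \<open>H_bar_reproducing\<close> is
\<open>(2 m - 1)! (m - 1)!\<close> times the volume of the moment space.\<close>

lemma H_bar_hat_reproducing:
  assumes m: "m \<ge> 2" and x: "0 < x" "x < 1" and \<phi>: "\<phi> \<in> Pi0 (2 * m - 1)"
  shows "(\<integral>s. poly \<phi> s * H_bar_hat m x s \<partial>I01) = poly \<phi> x"
proof -
  obtain k where k: "m = Suc (Suc k)" using m by (metis Suc_le_D numeral_2_eq_2 Suc_le_mono)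
  define P where "P = (\<Prod>j<2 * m - 1. beta_diag j)"
  have P: "P > 0" unfolding P_def by (intro prod_pos) (auto simp: beta_diag_def)
  define F :: real where "F = fact (2 * m - 1)"
  have F: "F > 0" by (simp add: F_def)
  define G :: real where "G = fact k"
  have G: "G > 0" by (simp add: G_def)
  have "real m * selberg {0, 1} {..<m - 1} = F * fact m * P"
    using selberg_shift[of m] selberg_evaluation[of m] m by (simp add: P_def F_def)
  also have "fact m = real m * (real (Suc k) * G)" by (simp add: k G_def)
  finally have "real m * selberg {0, 1} {..<m - 1} = real m * (F * (real (Suc k) * G) * P)"
    by (simp only: mult_ac)
  then have selberg: "selberg {0, 1} {..<m - 1} = F * (real (Suc k) * G) * P"
    using m by (simp only: mult_cancel_left) auto
  have "2 * real (Suc k) * (\<integral>s. poly \<phi> s * H_bar m x s \<partial>I01) = poly \<phi> x * (F * (real (Suc k) * G) * P)"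
    using H_bar_reproducing[OF m x \<phi>] unfolding selberg by (simp only: k diff_Suc_1)
  then have "real (Suc k) * (2 * (\<integral>s. poly \<phi> s * H_bar m x s \<partial>I01)) = real (Suc k) * (poly \<phi> x * (F * G * P))"
    by (simp only: mult_ac)
  then have "2 * (\<integral>s. poly \<phi> s * H_bar m x s \<partial>I01) = poly \<phi> x * (F * G * P)"
    by (simp only: mult_cancel_left) auto
  moreover have "(\<integral>s. poly \<phi> s * H_bar_hat m x s \<partial>I01) = 1 / P * (2 / (F * G)) * (\<integral>s. poly \<phi> s * H_bar m x s \<partial>I01)"
    unfolding H_bar_hat_def Vol_moment_space P_def[symmetric] F_def[symmetric]
    by (subst integral_mult_right_zero[symmetric]) (simp add: k G_def mult_ac)
  ultimately show ?thesis using P F G by (simp add: field_simps)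
qed

text \<open>Interpolating under the integral sign shows at once that the marginal kernel is a polynomial in \<open>x\<close>
and that its coefficients are combinations of the measurable functions \<open>H_bar m e\<close>.\<close>

lemma H_bar_lagrange:
  assumes m: "m \<ge> 2" and s: "s \<in> {0..1}"
    and l: "finite Y" "\<And>f. f \<in> Pi0 (2 * m - 1) \<Longrightarrow> f = (\<Sum>e\<in>Y. smult (poly f e) (l e))"
  shows "H_bar m x s = (\<Sum>e\<in>Y. H_bar m e s * poly (l e) x)"
proof -
  interpret P: prob_space "cube {2..m-1}" by (rule prob_space_cube)
  have int: "integrable (cube {2..m-1}) (\<lambda>t. H_kernel m e (t(1 := s)))" for e
  proof -
    obtain B where "\<forall>t\<in>space (cube {2..m-1}). \<forall>s\<in>{0..1}. \<bar>H_kernel m e (t(1 := s))\<bar> \<le> B"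
      using H_kernel_insert_bounded[OF m] by blast
    moreover have "(\<lambda>t. H_kernel m e (t(1 := s))) \<in> borel_measurable (cube {2..m-1})"
      using measurable_Pair1[OF H_kernel_insert_measurable[OF m, of e], of s] s by simp
    ultimately show ?thesis using s by (intro P.integrable_const_bound[of _ B] AE_I2) auto
  qed
  have "H_kernel m x (t(1 := s)) = (\<Sum>e\<in>Y. poly (l e) x * H_kernel m e (t(1 := s)))" for t
  proof -
    obtain q where q: "q \<in> Pi0 (2 * m - 1)" "\<And>x. H_kernel m x (t(1 := s)) = poly q x"
      using H_kernel_polynomial[OF m] by blast
    have "poly q x = poly (\<Sum>e\<in>Y. smult (poly q e) (l e)) x" using l(2)[OF q(1)] by (rule arg_cong)
    then show ?thesis unfolding q(2) by (simp add: poly_sum mult.commute)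
  qed
  then have "H_bar m x s = (\<integral>t. (\<Sum>e\<in>Y. poly (l e) x * H_kernel m e (t(1 := s))) \<partial>cube {2..m-1})"
    unfolding H_bar_eq by simp
  also have "\<dots> = (\<Sum>e\<in>Y. poly (l e) x * H_bar m e s)"
    unfolding H_bar_eq using int by (subst Bochner_Integration.integral_sum) auto
  finally show ?thesis by (simp add: mult.commute)
qed

lemma in_L2_I_bounded:
  assumes g: "g \<in> borel_measurable I01" and B: "\<forall>s\<in>{0..1}. \<bar>g s\<bar> \<le> B" and eq: "\<And>s. s \<in> {0..1} \<Longrightarrow> f s = g s"
  shows "in_L2_I f"
proof -
  have i: "(\<lambda>x. indicator {0..1} x *\<^sub>R f x) = (\<lambda>x. indicator {0..1} x *\<^sub>R g x)"
    "(\<lambda>x. indicator {0..1} x *\<^sub>R (f x)\<^sup>2) = (\<lambda>x. indicator {0..1} x *\<^sub>R (g x)\<^sup>2)"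
    using eq by (auto split: split_indicator)
  have "set_borel_measurable lborel {0..1} f"
    using g unfolding set_borel_measurable_def i by (simp add: I01_def borel_measurable_restrict_space_iff)
  moreover have "integrable I01 (\<lambda>x. (g x)\<^sup>2)"
  proof (rule I01.integrable_const_bound)
    have "norm ((g x)\<^sup>2) \<le> B\<^sup>2" if "x \<in> {0..1}" for x
      using power_mono[of "\<bar>g x\<bar>" B 2] B that by simp
    then show "AE x in I01. norm ((g x)\<^sup>2) \<le> B\<^sup>2" by (intro AE_I2) simp
    show "(\<lambda>x. (g x)\<^sup>2) \<in> borel_measurable I01" using g by simp
  qed
  then have "set_integrable lborel {0..1} (\<lambda>x. (f x)\<^sup>2)"
    unfolding set_integrable_def i by (simp add: I01_def integrable_restrict_space)
  ultimately show ?thesis by (simp add: in_L2_I_def)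
qed

lemma poly_bounded_I: "\<exists>B. \<forall>s\<in>{0..1}. \<bar>poly p s\<bar> \<le> B" for p :: "real poly"
proof -
  have "bounded (poly p ` {0..1})"
    by (intro compact_imp_bounded compact_continuous_image continuous_intros) auto
  then show ?thesis by (auto simp: bounded_iff)
qed

theorem corollary8p3:
  fixes m :: nat
  assumes "m \<ge> 2"
  shows "(\<forall>s\<in>{0..1}. \<exists>q\<in>Pi0 (2*m-1). \<forall>ts\<in>{0..1}. H_bar_hat m ts s = poly q ts) \<and>
    (\<forall>p :: nat \<Rightarrow> real poly. is_poly_basis {1..2*m-2} p (Pi0 (2*m-1)) \<longrightarrow>
       (\<exists>h :: nat \<Rightarrow> real \<Rightarrow> real. \<forall>ts\<in>{0..1}. \<forall>s\<in>{0..1}.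
          H_bar_hat m ts s = (\<Sum>j\<in>{1..2*m-2}. h j s * poly (p j) ts)) \<and>
       (\<forall>h :: nat \<Rightarrow> real \<Rightarrow> real.
          (\<forall>ts\<in>{0..1}. \<forall>s\<in>{0..1}.
             H_bar_hat m ts s = (\<Sum>j\<in>{1..2*m-2}. h j s * poly (p j) ts)) \<longrightarrow>
          L2_biorthogonal {1..2*m-2} h (\<lambda>j. poly (p j))))"
proof -
  let ?n = "2 * m - 1" and ?J = "{1..2 * m - 2}"
  obtain Y l where Y: "finite Y" and l: "\<And>e. e \<in> Y \<Longrightarrow> l e \<in> Pi0 ?n"
    and interp: "\<And>f. f \<in> Pi0 ?n \<Longrightarrow> f = (\<Sum>e\<in>Y. smult (poly f e) (l e))"
  proof -
    have "?n \<ge> 1" using assms by auto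
    from Pi0_lagrange[OF this] show thesis using that by blast
  qed
  have expand: "H_bar_hat m x s = (\<Sum>e\<in>Y. H_bar_hat m e s * poly (l e) x)" if "s \<in> {0..1}" for x s
  proof -
    have "H_bar m x s = (\<Sum>e\<in>Y. H_bar m e s * poly (l e) x)"
      by (rule H_bar_lagrange[OF assms that Y interp])
    then show ?thesis unfolding H_bar_hat_def by (simp only: sum_distrib_left mult.assoc)
  qed
  have part1: "\<exists>q\<in>Pi0 ?n. \<forall>ts\<in>{0..1}. H_bar_hat m ts s = poly q ts" if s: "s \<in> {0..1}" for s
  proof (intro bexI ballI)
    show "H_bar_hat m ts s = poly (\<Sum>e\<in>Y. smult (H_bar_hat m e s) (l e)) ts" for ts
      by (subst expand[OF s]) (simp add: poly_sum)
    have "degree (\<Sum>e\<in>Y. smult (H_bar_hat m e s) (l e)) \<le> ?n"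
      using l Y by (intro degree_sum_le order.trans[OF degree_smult_le]) (auto simp: Pi0_def)
    then show "(\<Sum>e\<in>Y. smult (H_bar_hat m e s) (l e)) \<in> Pi0 ?n"
      using l by (auto simp: Pi0_def poly_sum)
  qed
  have part2: "(\<exists>h. \<forall>ts\<in>{0..1}. \<forall>s\<in>{0..1}. H_bar_hat m ts s = (\<Sum>j\<in>?J. h j s * poly (p j) ts)) \<and>
     (\<forall>h. (\<forall>ts\<in>{0..1}. \<forall>s\<in>{0..1}. H_bar_hat m ts s = (\<Sum>j\<in>?J. h j s * poly (p j) ts)) \<longrightarrow>
        L2_biorthogonal ?J h (\<lambda>j. poly (p j)))"
    if p: "is_poly_basis ?J p (Pi0 ?n)" for p :: "nat \<Rightarrow> real poly"
  proof -
    have "\<exists>b. \<forall>e\<in>Y. l e = (\<Sum>j\<in>?J. smult (b e j) (p j))"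
      using poly_basis_expansion[OF p] l by (intro bchoice) (metis finite_atLeastAtMost)
    then obtain b where b: "\<And>e. e \<in> Y \<Longrightarrow> l e = (\<Sum>j\<in>?J. smult (b e j) (p j))" by blast
    \<comment> \<open>the coefficient functions expressed through the kernel itself, hence measurable and bounded\<close>
    define h0 where "h0 j s = (\<Sum>e\<in>Y. b e j * H_bar_hat m e s)" for j s
    have h0: "H_bar_hat m x s = (\<Sum>j\<in>?J. h0 j s * poly (p j) x)" if "s \<in> {0..1}" for x s
    proof -
      have "H_bar_hat m x s = (\<Sum>e\<in>Y. \<Sum>j\<in>?J. H_bar_hat m e s * (b e j * poly (p j) x))"
        unfolding expand[OF that, of x]
        by (intro sum.cong refl) (simp add: b poly_sum sum_distrib_left)
      also have "\<dots> = (\<Sum>j\<in>?J. \<Sum>e\<in>Y. H_bar_hat m e s * (b e j * poly (p j) x))" by (rule sum.swap)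
      also have "\<dots> = (\<Sum>j\<in>?J. h0 j s * poly (p j) x)"
        by (simp add: h0_def sum_distrib_left mult_ac)
      finally show ?thesis .
    qed
    have h0_meas: "h0 j \<in> borel_measurable I01" for j
      unfolding h0_def[abs_def] H_bar_hat_def
      using H_bar_measurable_bounded(1)[OF assms] by (intro borel_measurable_sum borel_measurable_times borel_measurable_const)
    have h0_bound: "\<exists>B. \<forall>s\<in>{0..1}. \<bar>h0 j s\<bar> \<le> B" for j
    proof -
      have "\<exists>B. \<forall>e. \<forall>s\<in>{0..1}. \<bar>H_bar m e s\<bar> \<le> B e"
        using H_bar_measurable_bounded(2)[OF assms] by (intro choice) blast
      then obtain B where B: "\<And>e s. s \<in> {0..1} \<Longrightarrow> \<bar>H_bar m e s\<bar> \<le> B e" by blast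
      define \<kappa> where "\<kappa> = 1 / Vol ?n (moment_space ?n) * (2 / (fact ?n * fact (m - 2)))"
      have "\<bar>h0 j s\<bar> \<le> (\<Sum>e\<in>Y. \<bar>b e j\<bar> * (\<bar>\<kappa>\<bar> * B e))" if "s \<in> {0..1}" for s
        unfolding h0_def H_bar_hat_def \<kappa>_def[symmetric]
        by (intro order.trans[OF sum_abs] sum_mono) (auto simp: abs_mult intro!: mult_left_mono B that)
      then show ?thesis by blast
    qed
    have "L2_biorthogonal ?J h (\<lambda>j. poly (p j))"
      if h: "\<forall>ts\<in>{0..1}. \<forall>s\<in>{0..1}. H_bar_hat m ts s = (\<Sum>j\<in>?J. h j s * poly (p j) ts)" for h
    proof -
      have h_eq: "h j s = h0 j s" if "j \<in> ?J" "s \<in> {0..1}" for j s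
      proof -
        have "(\<Sum>j\<in>?J. (h j s - h0 j s) * poly (p j) x) = 0" if "x \<in> {0<..<1}" for x
          using h h0[OF \<open>s \<in> {0..1}\<close>, of x] that \<open>s \<in> {0..1}\<close>
          by (simp add: left_diff_distrib sum_subtractf)
        then have "h j s - h0 j s = 0"
          using poly_basis_independent[OF p, of "\<lambda>j. h j s - h0 j s" j] \<open>j \<in> ?J\<close> by blast
        then show ?thesis by simp
      qed
      have L2: "in_L2_I (h j)" "in_L2_I (poly (p j))" if "j \<in> ?J" for j
      proof -
        obtain B where "\<forall>s\<in>{0..1}. \<bar>h0 j s\<bar> \<le> B" using h0_bound by blast
        then show "in_L2_I (h j)" using h_eq that by (intro in_L2_I_bounded[OF h0_meas]) auto
        obtain C where C: "\<forall>s\<in>{0..1}. \<bar>poly (p j) s\<bar> \<le> C" using poly_bounded_I by blast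
        show "in_L2_I (poly (p j))"
          by (rule in_L2_I_bounded[OF borel_measurable_integrable[OF integrable_poly_I01] C refl])
      qed
      have "(LBINT x:{0..1}. h j x * poly (p k) x) = (if j = k then 1 else 0)" if jk: "j \<in> ?J" "k \<in> ?J" for j k
      proof -
        define a where "a i = (\<integral>s. h0 i s * poly (p k) s \<partial>I01)" for i
        have pk: "p k \<in> Pi0 ?n"
        proof -
          have "p k \<in> poly_vs.span (p ` ?J)" using jk(2) by (intro poly_vs.span_base imageI)
          then show ?thesis using p unfolding is_poly_basis_def by blast
        qed
        have int: "integrable I01 (\<lambda>s. h0 i s * poly (p k) s)" for i
        proof -
          obtain B C where B: "\<forall>s\<in>{0..1}. \<bar>h0 i s\<bar> \<le> B" and C: "\<forall>s\<in>{0..1}. \<bar>poly (p k) s\<bar> \<le> C"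
            using h0_bound[of i] poly_bounded_I[of "p k"] by blast
          have "\<bar>h0 i s * poly (p k) s\<bar> \<le> B * C" if "s \<in> {0..1}" for s
            unfolding abs_mult using B C that by (intro mult_mono) (auto intro: order.trans[OF abs_ge_zero])
          then show ?thesis
            using h0_meas borel_measurable_integrable[OF integrable_poly_I01]
            by (intro I01.integrable_const_bound[of _ "B * C"] AE_I2) auto
        qed
        have "(\<Sum>i\<in>?J. (a i - (if i = k then 1 else 0)) * poly (p i) x) = 0" if x: "x \<in> {0<..<1}" for x
        proof -
          have "poly (p k) x = (\<integral>s. poly (p k) s * H_bar_hat m x s \<partial>I01)"
            using H_bar_hat_reproducing[OF assms _ _ pk, of x] x by simp
          also have "\<dots> = (\<integral>s. (\<Sum>i\<in>?J. poly (p i) x * (h0 i s * poly (p k) s)) \<partial>I01)"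
          proof (rule Bochner_Integration.integral_cong[OF refl])
            fix s assume "s \<in> space I01"
            then have "s \<in> {0..1}" by simp
            from h0[OF this, of x]
            show "poly (p k) s * H_bar_hat m x s = (\<Sum>i\<in>?J. poly (p i) x * (h0 i s * poly (p k) s))"
              by (simp add: sum_distrib_left mult_ac)
          qed
          also have "\<dots> = (\<Sum>i\<in>?J. poly (p i) x * a i)"
            unfolding a_def using int by (subst Bochner_Integration.integral_sum) auto
          finally have "poly (p k) x = (\<Sum>i\<in>?J. a i * poly (p i) x)" by (simp add: mult.commute)
          moreover have "(\<Sum>i\<in>?J. (if i = k then 1 else 0) * poly (p i) x) = poly (p k) x"
            using jk by (simp add: if_distrib[of "\<lambda>c. c * _"] cong: if_cong)
          ultimately show ?thesis by (simp add: left_diff_distrib sum_subtractf)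
        qed
        then have "a j - (if j = k then 1 else 0) = 0"
          using poly_basis_independent[OF p, of "\<lambda>i. a i - (if i = k then 1 else 0)" j] jk by blast
        moreover have "(LBINT x:{0..1}. h j x * poly (p k) x) = a j"
          unfolding a_def integral_I01 using h_eq[OF jk(1)]
          by (intro set_lebesgue_integral_cong) auto
        ultimately show ?thesis by (simp split: if_splits)
      qed
      with L2 show ?thesis by (auto simp: L2_biorthogonal_def)
    qed
    moreover have "\<exists>h. \<forall>ts\<in>{0..1}. \<forall>s\<in>{0..1}. H_bar_hat m ts s = (\<Sum>j\<in>?J. h j s * poly (p j) ts)"
      using h0 by blast
    ultimately show ?thesis by blast
  qed
  show ?thesis using part1 part2 by blast
qed

end
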